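(* Let $n\ge4$ and let $R=\bigoplus_{\alpha\in Q_+}R_\alpha$ be a KLR algebra of type $D_n$ over a field $\mathbb F$. (1) The set of irreducible homogeneous representations of $R$ is decomposed into packets and collections according to the decomposition of the set of homogeneous words in $\mathcal W_n$: the modules $S(\boldsymbol w)$, with $\boldsymbol w$ running over the homogeneous words in $\mathcal W_n$, form a complete and irredundant list of the homogeneous representations of the algebras $R_\alpha$ ($\alpha\in Q_+$) up to isomorphism and degree shift; hence the set of homogeneous representations of $R$ (up to isomorphism and degree shift) is the disjoint union, over $0\le k\le n$ and over the collections $\mathbf c\in\mathcal P(n,k)$, of the sets $\{S(\boldsymbol w):\boldsymbol w\in\mathbf c\}$. (2) For each $0\le k\le n$ and each collection $\mathbf c\in\mathcal P(n,k)$, the number of homogeneous representations of $R$ in the collection $\mathbf c$, i.e. in $\{S(\boldsymbol w):\boldsymbol w\in\mathbf c\}$, is the entry $C(n,k)$ of Catalan's triangle.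
   Context: **KLR algebras.** Let $\Gamma$ be a quiver whose underlying graph is the Dynkin diagram of type $D_n$, with vertex set $I=\{1,\dots,n\}$; vertices are neighbors iff they are $\{i,i+1\}$ with $1\le i\le n-2$, or $\{n-2,n\}$. Let $Q_+=\bigoplus_{i\in I}\mathbb Z_{\ge0}\alpha_i$. For $\alpha=\sum c_i\alpha_i$ let $d=\sum c_i$ (the height) and let $\langle I\rangle_\alpha$ be the set of words $[w_1,\dots,w_d]$ in $I$ in which each $i$ occurs exactly $c_i$ times. The simple transposition $s_k\in S_d$ acts on words by swapping the letters in positions $k,k+1$. $R_\alpha$ is the associative $\mathbb F$-algebra generated by $e(\boldsymbol w)$ ($\boldsymbol w\in\langle I\rangle_\alpha$), $\psi_1,\dots,\psi_{d-1}$, $y_1,\dots,y_d$ with relations: $e(\boldsymbol w)e(\boldsymbol v)=\delta_{\boldsymbol w\boldsymbol v}e(\boldsymbol w)$; $\sum_{\boldsymbol w}e(\boldsymbol w)=1$; $y_ke(\boldsymbol w)=e(\boldsymbol w)y_k$; $\psi_ke(\boldsymbol w)=e(s_k\boldsymbol w)\psi_k$; $y_ky_\ell=y_\ell y_k$; $y_k\psi_\ell=\psi_\ell y_k$ for $k\ne\ell,\ell+1$; both $(y_{k+1}\psi_k-\psi_ky_k)e(\boldsymbol w)$ and $(\psi_ky_{k+1}-y_k\psi_k)e(\boldsymbol w)$ equal $e(\boldsymbol w)$ if $w_k=w_{k+1}$ and $0$ otherwise; $\psi_k^2e(\boldsymbol w)$ equals $0$ if $w_k=w_{k+1}$, $(y_k-y_{k+1})e(\boldsymbol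 w)$ if $w_k\to w_{k+1}$, $(y_{k+1}-y_k)e(\boldsymbol w)$ if $w_k\leftarrow w_{k+1}$, and $e(\boldsymbol w)$ otherwise; $\psi_k\psi_\ell=\psi_\ell\psi_k$ for $|k-\ell|>1$; $(\psi_{k+1}\psi_k\psi_{k+1}-\psi_k\psi_{k+1}\psi_k)e(\boldsymbol w)$ equals $e(\boldsymbol w)$ if $w_{k+2}=w_k\to w_{k+1}$, $-e(\boldsymbol w)$ if $w_{k+2}=w_k\leftarrow w_{k+1}$, and $0$ otherwise. It is $\mathbb Z$-graded by $\deg e(\boldsymbol w)=0$, $\deg y_i=2$, $\deg\psi_ie(\boldsymbol w)=-2$ if $w_i=w_{i+1}$, $1$ if $w_i,w_{i+1}$ are neighbors, $0$ otherwise. ($R_0=\mathbb F$, with the single idempotent $e([~])$.) A homogeneous representation of $R$ is an irreducible finite-dimensional graded module over some $R_\alpha$ that is concentrated in a single degree. **Homogeneous words and the modules $S(\boldsymbol w)$.** A word $[w_1,\dots,w_d]$ is homogeneous if whenever $w_r=w_s$ with $r<s$, there exist $t,u$ with $r<t<u<s$ such that $w_r$ is a neighbor of both $w_t$ and $w_u$. The weight graph $G_\alpha$ has vertex set $\langle I\rangle_\alpha$, with $\boldsymbol w,\boldsymbol v$ joined by an edge if $\boldsymbol v=s_r\boldsymbol w$ for some $r$ such that $w_r,w_{r+1}$ are neither equal nor neighbors. For a homogeneous word $\boldsymbol w\in\langle I\rangle_\alpha$, let $C$ be its connected component in $G_\alpha$ (all of its words are then homogeneous), and let $S(\boldsymbol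 w)$ be the $R_\alpha$-module with basis $\{v_{\boldsymbol u}:\boldsymbol u\in C\}$ (in degree $0$) and action $e(\boldsymbol u')v_{\boldsymbol u}=\delta_{\boldsymbol u,\boldsymbol u'}v_{\boldsymbol u}$, $y_rv_{\boldsymbol u}=0$, $\psi_rv_{\boldsymbol u}=v_{s_r\boldsymbol u}$ if $s_r$ joins $\boldsymbol u$ to $s_r\boldsymbol u$ by an edge of $G_\alpha$ (so that $s_r\boldsymbol u\in C$), and $0$ otherwise. **Canonical words, collections, packets.** Juxtaposition of words is concatenation and $[~]$ is the empty word. For $1\le i\le n-1$ let $s_{ij}=[i,i-1,\dots,j]$ if $i\ge j$ and $s_{ij}=[~]$ if $i<j$. Let $s_{nj}=[n,n-2,n-3,\dots,j]$ if $j\le n-2$, $s_{nj}=[n]$ if $j\in\{n-1,n\}$, and $s_{nj}=[~]$ if $j>n$. (These words are not to be confused with the transpositions $s_k$.) A prefix is a word $s_{1i_1}s_{2i_2}\cdots s_{n-1\,i_{n-1}}$ with $1\le i_m\le m+1$ for $1\le m\le n-1$. A suffix is a word $s_{nj_1}s_{n-1\,j_2}s_{nj_3}s_{n-1\,j_4}\cdots s_{n-1+[\ell]_2\,j_\ell}$ with $\ell\ge 0$ and $1\le j_1<\cdots<j_\ell\le n-1$, where $[\ell]_2=1$ if $\ell$ is odd and $0$ if $\ell$ is even. $\mathcal W_n$ is the set of words $\boldsymbol w_0\boldsymbol w'$ with $\boldsymbol w_0$ a prefix and $\boldsymbol w'$ a suffix (canonical reduced words, one for each element of the Coxeter group of type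 $D_n$); $\boldsymbol w'$ is the suffix of $\boldsymbol w_0\boldsymbol w'$. For a suffix $\boldsymbol w'$, the collection $\mathbf c^n_{\boldsymbol w'}$ is the set of homogeneous words in $\mathcal W_n$ whose suffix is $\boldsymbol w'$. The $(n,k)$-packet $\mathcal P(n,k)$, $0\le k\le n$, is the following set of collections: - $\mathcal P(n,0)$: the collections labeled by suffixes $s_{n1}s_{n-1\,j_2}s_{nj_3}\cdots s_{n-1+[\ell]_2\,j_\ell}$ with $\ell\ge2$ (so $j_1=1$). - $\mathcal P(n,k)$, $1\le k\le n-3$: the collections labeled by $s_{nk}$ or by suffixes $s_{n\,k+1}s_{n-1\,j_2}s_{nj_3}\cdots s_{n-1+[\ell]_2\,j_\ell}$ with $\ell\ge 2$ (so $j_1=k+1$). - $\mathcal P(n,n-2)$: only the collection labeled by $[n,n-2]$. - $\mathcal P(n,n-1)$: only the collection labeled by $[n]$. - $\mathcal P(n,n)$: only the collection labeled by $[~]$. Catalan's triangle: $C(0,0)=1$ and, for $n\ge1$, $C(n,0)=C(n-1,0)$, $C(n,k)=C(n,k-1)+C(n-1,k)$ for $0<k<n$, and $C(n,n)=C(n,n-1)$. Equivalently $C(n,k)=\frac{(n+k)!\,(n-k+1)}{k!\,(n+1)!}$. *)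

theory Defs
  imports "HOL-Library.Poly_Mapping" "HOL-Combinatorics.Multiset_Permutations"
    "HOL-Algebra.QuotRing" "HOL-Algebra.Module"
begin

section \<open>Quivers of type D and words\<close>

definition D_vertices :: "nat \<Rightarrow> nat set" where
  "D_vertices n = {1..n}"

definition D_neighbors :: "nat \<Rightarrow> nat \<Rightarrow> nat \<Rightarrow> bool" where
  "D_neighbors n a b \<longleftrightarrow> (\<exists>i. 1 \<le> i \<and> i \<le> n - 2 \<and> {a, b} = {i, i + 1}) \<or> {a, b} = {n - 2, n}"

text \<open>A quiver is given by its set of arrows; the orientation is arbitrary.\<close>

definition type_D_quiver :: "nat \<Rightarrow> (nat \<times> nat) set \<Rightarrow> bool" where
  "type_D_quiver n \<Gamma> \<longleftrightarrow>
     \<Gamma> \<subseteq> D_vertices n \<times> D_vertices n \<and>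
     (\<forall>a\<in>D_vertices n. \<forall>b\<in>D_vertices n. D_neighbors n a b \<longleftrightarrow> (a, b) \<in> \<Gamma> \<or> (b, a) \<in> \<Gamma>) \<and>
     (\<forall>a b. (a, b) \<in> \<Gamma> \<longrightarrow> (b, a) \<notin> \<Gamma>)"

text \<open>
  Elements \<open>\<alpha> = \<Sum> c\<^sub>i \<alpha>\<^sub>i\<close> of \<open>Q\<^sub>+\<close> are multisets of vertices (\<open>i\<close> has multiplicity \<open>c\<^sub>i\<close>), so that
  \<^term>\<open>size \<alpha>\<close> is the height of \<open>\<alpha>\<close> and \<^term>\<open>permutations_of_multiset \<alpha>\<close> is the set of words
  of content \<open>\<alpha>\<close>.
\<close>

definition Q_plus :: "nat \<Rightarrow> nat multiset set" where
  "Q_plus n = {\<alpha>. set_mset \<alpha> \<subseteq> D_vertices n}"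

text \<open>Positions in words, and hence the indices of \<open>\<psi>\<close> and \<open>y\<close>, are counted from 1.\<close>

definition letter :: "nat list \<Rightarrow> nat \<Rightarrow> nat" where
  "letter w k = w ! (k - 1)"

definition swap_at :: "nat \<Rightarrow> nat list \<Rightarrow> nat list" where
  "swap_at k w = w[k - 1 := letter w (k + 1), k := letter w k]"


section \<open>The KLR algebra\<close>

subsection \<open>The free algebra on the generators\<close>

datatype klr_gen = EGen "nat list" | PsiGen nat | YGen nat

datatype 'g monomial = Monomial (factors: "'g list")

instantiation monomial :: (type) monoid_add
begin

definition zero_monomial :: "'g monomial" where
  "zero_monomial = Monomial []"

definition plus_monomial :: "'g monomial \<Rightarrow> 'g monomial \<Rightarrow> 'g monomial" where
  "plus_monomial a b = Monomial (factors a @ factors b)"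

instance
  by standard (simp_all add: zero_monomial_def plus_monomial_def)

end

text \<open>
  As \<^typ>\<open>'g monomial\<close> is the free monoid on \<^typ>\<open>'g\<close> (written additively), the type
  \<^typ>\<open>'g monomial \<Rightarrow>\<^sub>0 'f\<close> with its convolution product is the free associative algebra.
\<close>

type_synonym 'f klr_free_elt = "klr_gen monomial \<Rightarrow>\<^sub>0 'f"

definition gen :: "klr_gen \<Rightarrow> ('f::field) klr_free_elt" where
  "gen g = Poly_Mapping.single (Monomial [g]) 1"

definition scalar :: "'f \<Rightarrow> ('f::field) klr_free_elt" where
  "scalar c = Poly_Mapping.single 0 c"

abbreviation ee where "ee w \<equiv> gen (EGen w)"
abbreviation \<psi> where "\<psi> k \<equiv> gen (PsiGen k)"
abbreviation yy where "yy k \<equiv> gen (YGen k)"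

definition klr_gens :: "nat multiset \<Rightarrow> klr_gen set" where
  "klr_gens \<alpha> = EGen ` permutations_of_multiset \<alpha> \<union> PsiGen ` {1..<size \<alpha>} \<union> YGen ` {1..size \<alpha>}"

definition klr_free :: "nat multiset \<Rightarrow> ('f::field) klr_free_elt ring" where
  "klr_free \<alpha> =
     \<lparr>carrier = {p. \<forall>m\<in>Poly_Mapping.keys p. set (factors m) \<subseteq> klr_gens \<alpha>},
      mult = (*), one = 1, zero = 0, add = (+)\<rparr>"

subsection \<open>Relations\<close>

text \<open>The element \<open>a - b\<close> stands for the relation \<open>a = b\<close>.\<close>

inductive_set klr_relations ::
    "(nat \<times> nat) set \<Rightarrow> nat multiset \<Rightarrow> ('f::field) klr_free_elt set"
  for \<Gamma> :: "(nat \<times> nat) set" and \<alpha> :: "nat multiset" where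
  idem:
    "\<lbrakk>w \<in> permutations_of_multiset \<alpha>; v \<in> permutations_of_multiset \<alpha>\<rbrakk> \<Longrightarrow>
     ee w * ee v - (if w = v then ee w else 0) \<in> klr_relations \<Gamma> \<alpha>"
| unit:
    "(\<Sum>w\<in>permutations_of_multiset \<alpha>. ee w) - 1 \<in> klr_relations \<Gamma> \<alpha>"
| y_e:
    "\<lbrakk>w \<in> permutations_of_multiset \<alpha>; 1 \<le> k; k \<le> size \<alpha>\<rbrakk> \<Longrightarrow>
     yy k * ee w - ee w * yy k \<in> klr_relations \<Gamma> \<alpha>"
| psi_e:
    "\<lbrakk>w \<in> permutations_of_multiset \<alpha>; 1 \<le> k; k < size \<alpha>\<rbrakk> \<Longrightarrow>
     \<psi> k * ee w - ee (swap_at k w) * \<psi> k \<in> klr_relations \<Gamma> \<alpha>"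
| y_y:
    "\<lbrakk>1 \<le> k; k \<le> size \<alpha>; 1 \<le> l; l \<le> size \<alpha>\<rbrakk> \<Longrightarrow>
     yy k * yy l - yy l * yy k \<in> klr_relations \<Gamma> \<alpha>"
| y_psi_far:
    "\<lbrakk>1 \<le> k; k \<le> size \<alpha>; 1 \<le> l; l < size \<alpha>; k \<noteq> l; k \<noteq> l + 1\<rbrakk> \<Longrightarrow>
     yy k * \<psi> l - \<psi> l * yy k \<in> klr_relations \<Gamma> \<alpha>"
| y_psi:
    "\<lbrakk>w \<in> permutations_of_multiset \<alpha>; 1 \<le> k; k < size \<alpha>\<rbrakk> \<Longrightarrow>
     (yy (k + 1) * \<psi> k - \<psi> k * yy k) * ee w
       - (if letter w k = letter w (k + 1) then ee w else 0) \<in> klr_relations \<Gamma> \<alpha>"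
| psi_y:
    "\<lbrakk>w \<in> permutations_of_multiset \<alpha>; 1 \<le> k; k < size \<alpha>\<rbrakk> \<Longrightarrow>
     (\<psi> k * yy (k + 1) - yy k * \<psi> k) * ee w
       - (if letter w k = letter w (k + 1) then ee w else 0) \<in> klr_relations \<Gamma> \<alpha>"
| psi_sq:
    "\<lbrakk>w \<in> permutations_of_multiset \<alpha>; 1 \<le> k; k < size \<alpha>\<rbrakk> \<Longrightarrow>
     \<psi> k * \<psi> k * ee w
       - (if letter w k = letter w (k + 1) then 0
          else if (letter w k, letter w (k + 1)) \<in> \<Gamma> then (yy k - yy (k + 1)) * ee w
          else if (letter w (k + 1), letter w k) \<in> \<Gamma> then (yy (k + 1) - yy k) * ee w
          else ee w) \<in> klr_relations \<Gamma> \<alpha>"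
| psi_far:
    "\<lbrakk>1 \<le> k; k < size \<alpha>; 1 \<le> l; l < size \<alpha>; k + 1 < l \<or> l + 1 < k\<rbrakk> \<Longrightarrow>
     \<psi> k * \<psi> l - \<psi> l * \<psi> k \<in> klr_relations \<Gamma> \<alpha>"
| braid:
    "\<lbrakk>w \<in> permutations_of_multiset \<alpha>; 1 \<le> k; k + 1 < size \<alpha>\<rbrakk> \<Longrightarrow>
     (\<psi> (k + 1) * \<psi> k * \<psi> (k + 1) - \<psi> k * \<psi> (k + 1) * \<psi> k) * ee w
       - (if letter w (k + 2) = letter w k \<and> (letter w k, letter w (k + 1)) \<in> \<Gamma> then ee w
          else if letter w (k + 2) = letter w k \<and> (letter w (k + 1), letter w k) \<in> \<Gamma> then - ee w
          else 0) \<in> klr_relations \<Gamma> \<alpha>"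

definition klr_ideal :: "(nat \<times> nat) set \<Rightarrow> nat multiset \<Rightarrow> ('f::field) klr_free_elt set" where
  "klr_ideal \<Gamma> \<alpha> = Idl\<^bsub>klr_free \<alpha>\<^esub> (klr_relations \<Gamma> \<alpha>)"

definition klr :: "(nat \<times> nat) set \<Rightarrow> nat multiset \<Rightarrow> ('f::field) klr_free_elt set ring" where
  "klr \<Gamma> \<alpha> = klr_free \<alpha> Quot klr_ideal \<Gamma> \<alpha>"

definition klr_class ::
    "(nat \<times> nat) set \<Rightarrow> nat multiset \<Rightarrow> ('f::field) klr_free_elt \<Rightarrow> 'f klr_free_elt set" where
  "klr_class \<Gamma> \<alpha> p = klr_ideal \<Gamma> \<alpha> +>\<^bsub>klr_free \<alpha>\<^esub> p"

subsection \<open>Grading\<close>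

definition psi_degree :: "nat \<Rightarrow> nat \<Rightarrow> nat list \<Rightarrow> int" where
  "psi_degree n k w =
     (if letter w k = letter w (k + 1) then -2
      else if D_neighbors n (letter w k) (letter w (k + 1)) then 1 else 0)"

text \<open>
  The linear combinations of those products of the elements \<open>e(w)\<close>, \<open>y\<^sub>k\<close> and \<open>\<psi>\<^sub>k e(w)\<close> whose
  degrees add up to \<open>d\<close>; the degree of \<open>\<psi>\<^sub>k\<close> alone is not defined.
\<close>

inductive klr_homogeneous ::
    "nat \<Rightarrow> nat multiset \<Rightarrow> int \<Rightarrow> ('f::field) klr_free_elt \<Rightarrow> bool"
  for n :: nat and \<alpha> :: "nat multiset" where
  one: "klr_homogeneous n \<alpha> 0 1"
| mult_e: "\<lbrakk>klr_homogeneous n \<alpha> d p; w \<in> permutations_of_multiset \<alpha>\<rbrakk> \<Longrightarrow>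
     klr_homogeneous n \<alpha> d (ee w * p)"
| mult_y: "\<lbrakk>klr_homogeneous n \<alpha> d p; 1 \<le> k; k \<le> size \<alpha>\<rbrakk> \<Longrightarrow>
     klr_homogeneous n \<alpha> (2 + d) (yy k * p)"
| mult_psi: "\<lbrakk>klr_homogeneous n \<alpha> d p; w \<in> permutations_of_multiset \<alpha>; 1 \<le> k; k < size \<alpha>\<rbrakk> \<Longrightarrow>
     klr_homogeneous n \<alpha> (psi_degree n k w + d) (\<psi> k * ee w * p)"
| zero: "klr_homogeneous n \<alpha> d 0"
| add: "\<lbrakk>klr_homogeneous n \<alpha> d p; klr_homogeneous n \<alpha> d q\<rbrakk> \<Longrightarrow> klr_homogeneous n \<alpha> d (p + q)"
| scale: "klr_homogeneous n \<alpha> d p \<Longrightarrow> klr_homogeneous n \<alpha> d (scalar c * p)"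

definition klr_component ::
    "nat \<Rightarrow> (nat \<times> nat) set \<Rightarrow> nat multiset \<Rightarrow> int \<Rightarrow> ('f::field) klr_free_elt set set" where
  "klr_component n \<Gamma> \<alpha> d = {klr_class \<Gamma> \<alpha> p | p. klr_homogeneous n \<alpha> d p}"


section \<open>Graded modules\<close>

text \<open>
  The locale \<^locale>\<open>module\<close> of the library is restricted to commutative rings. Left modules over
  arbitrary rings use the same record type, of which the fields \<open>mult\<close> and \<open>one\<close> play no role.
\<close>

locale left_module = R?: ring R + M?: abelian_group M
  for R :: "('r, 'm) ring_scheme" (structure) and M :: "('r, 'v, 'n) module_scheme" (structure) +
  assumes smult_closed:
      "\<lbrakk>a \<in> carrier R; x \<in> carrier M\<rbrakk> \<Longrightarrow> a \<odot>\<^bsub>M\<^esub> x \<in> carrier M"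
    and smult_l_distr:
      "\<lbrakk>a \<in> carrier R; b \<in> carrier R; x \<in> carrier M\<rbrakk> \<Longrightarrow>
       (a \<oplus>\<^bsub>R\<^esub> b) \<odot>\<^bsub>M\<^esub> x = a \<odot>\<^bsub>M\<^esub> x \<oplus>\<^bsub>M\<^esub> b \<odot>\<^bsub>M\<^esub> x"
    and smult_r_distr:
      "\<lbrakk>a \<in> carrier R; x \<in> carrier M; z \<in> carrier M\<rbrakk> \<Longrightarrow>
       a \<odot>\<^bsub>M\<^esub> (x \<oplus>\<^bsub>M\<^esub> z) = a \<odot>\<^bsub>M\<^esub> x \<oplus>\<^bsub>M\<^esub> a \<odot>\<^bsub>M\<^esub> z"
    and smult_assoc:
      "\<lbrakk>a \<in> carrier R; b \<in> carrier R; x \<in> carrier M\<rbrakk> \<Longrightarrow>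
       (a \<otimes>\<^bsub>R\<^esub> b) \<odot>\<^bsub>M\<^esub> x = a \<odot>\<^bsub>M\<^esub> (b \<odot>\<^bsub>M\<^esub> x)"
    and smult_one:
      "x \<in> carrier M \<Longrightarrow> \<one>\<^bsub>R\<^esub> \<odot>\<^bsub>M\<^esub> x = x"

record ('r, 'v) graded_module = "('r, 'v) module" +
  component :: "int \<Rightarrow> 'v set"

text \<open>
  \<open>M\<close> is the internal direct sum of its components: every element is in exactly one way the sum of a
  finitely supported family of homogeneous elements.
\<close>

definition is_graded_module ::
    "'r ring \<Rightarrow> (int \<Rightarrow> 'r set) \<Rightarrow> ('r, 'v) graded_module \<Rightarrow> bool" where
  "is_graded_module R Rc M \<longleftrightarrow>
     left_module R M \<and>
     (\<forall>d. additive_subgroup (component M d) M) \<and>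
     (\<forall>x\<in>carrier M. \<exists>!f. (\<forall>d. f d \<in> component M d) \<and> finite {d. f d \<noteq> \<zero>\<^bsub>M\<^esub>} \<and>
        x = finsum M f {d. f d \<noteq> \<zero>\<^bsub>M\<^esub>}) \<and>
     (\<forall>i j. \<forall>a\<in>Rc i. \<forall>x\<in>component M j. a \<odot>\<^bsub>M\<^esub> x \<in> component M (i + j))"

definition graded_submodule :: "'r ring \<Rightarrow> ('r, 'v) graded_module \<Rightarrow> 'v set \<Rightarrow> bool" where
  "graded_submodule R M N \<longleftrightarrow>
     additive_subgroup N M \<and>
     (\<forall>a\<in>carrier R. \<forall>x\<in>N. a \<odot>\<^bsub>M\<^esub> x \<in> N) \<and>
     (\<forall>x\<in>N. \<exists>f. (\<forall>d. f d \<in> N \<inter> component M d) \<and> finite {d. f d \<noteq> \<zero>\<^bsub>M\<^esub>} \<and>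
        x = finsum M f {d. f d \<noteq> \<zero>\<^bsub>M\<^esub>})"

definition graded_irreducible :: "'r ring \<Rightarrow> ('r, 'v) graded_module \<Rightarrow> bool" where
  "graded_irreducible R M \<longleftrightarrow>
     carrier M \<noteq> {\<zero>\<^bsub>M\<^esub>} \<and>
     (\<forall>N. graded_submodule R M N \<longrightarrow> N = {\<zero>\<^bsub>M\<^esub>} \<or> N = carrier M)"

definition in_single_degree :: "('r, 'v) graded_module \<Rightarrow> bool" where
  "in_single_degree M \<longleftrightarrow> (\<exists>d. \<forall>d'. d' \<noteq> d \<longrightarrow> component M d' = {\<zero>\<^bsub>M\<^esub>})"

definition degree_shift :: "int \<Rightarrow> ('r, 'v) graded_module \<Rightarrow> ('r, 'v) graded_module" where
  "degree_shift m M = M\<lparr>component := \<lambda>d. component M (d - m)\<rparr>"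

definition graded_isomorphic ::
    "'r ring \<Rightarrow> ('r, 'v) graded_module \<Rightarrow> ('r, 'w) graded_module \<Rightarrow> bool" where
  "graded_isomorphic R M N \<longleftrightarrow>
     (\<exists>\<phi>. bij_betw \<phi> (carrier M) (carrier N) \<and>
        (\<forall>x\<in>carrier M. \<forall>z\<in>carrier M. \<phi> (x \<oplus>\<^bsub>M\<^esub> z) = \<phi> x \<oplus>\<^bsub>N\<^esub> \<phi> z) \<and>
        (\<forall>a\<in>carrier R. \<forall>x\<in>carrier M. \<phi> (a \<odot>\<^bsub>M\<^esub> x) = a \<odot>\<^bsub>N\<^esub> \<phi> x) \<and>
        (\<forall>d. \<phi> ` component M d = component N d))"

definition isomorphic_up_to_shift ::
    "'r ring \<Rightarrow> ('r, 'v) graded_module \<Rightarrow> ('r, 'w) graded_module \<Rightarrow> bool" where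
  "isomorphic_up_to_shift R M N \<longleftrightarrow> (\<exists>m. graded_isomorphic R M (degree_shift m N))"


section \<open>Homogeneous representations\<close>

type_synonym ('f, 'v) klr_module = "('f klr_free_elt set, 'v) graded_module"

definition finite_dimensional ::
    "(nat \<times> nat) set \<Rightarrow> nat multiset \<Rightarrow> ('f::field, 'v) klr_module \<Rightarrow> bool" where
  "finite_dimensional \<Gamma> \<alpha> M \<longleftrightarrow>
     (\<exists>B. finite B \<and> B \<subseteq> carrier M \<and>
        (\<forall>x\<in>carrier M. \<exists>c. x = (\<Oplus>\<^bsub>M\<^esub>b\<in>B. klr_class \<Gamma> \<alpha> (scalar (c b)) \<odot>\<^bsub>M\<^esub> b)))"

definition homogeneous_rep ::
    "nat \<Rightarrow> (nat \<times> nat) set \<Rightarrow> nat multiset \<Rightarrow> ('f::field, 'v) klr_module \<Rightarrow> bool" where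
  "homogeneous_rep n \<Gamma> \<alpha> M \<longleftrightarrow>
     \<alpha> \<in> Q_plus n \<and>
     is_graded_module (klr \<Gamma> \<alpha>) (klr_component n \<Gamma> \<alpha>) M \<and>
     finite_dimensional \<Gamma> \<alpha> M \<and>
     graded_irreducible (klr \<Gamma> \<alpha>) M \<and>
     in_single_degree M"

subsection \<open>Homogeneous words and the modules \<open>S(w)\<close>\<close>

definition homogeneous_word :: "nat \<Rightarrow> nat list \<Rightarrow> bool" where
  "homogeneous_word n w \<longleftrightarrow>
     (\<forall>r s. 1 \<le> r \<and> r < s \<and> s \<le> length w \<and> letter w r = letter w s \<longrightarrow>
        (\<exists>t u. r < t \<and> t < u \<and> u < s \<and>
           D_neighbors n (letter w r) (letter w t) \<and> D_neighbors n (letter w r) (letter w u)))"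

definition admissible_swap :: "nat \<Rightarrow> nat \<Rightarrow> nat list \<Rightarrow> bool" where
  "admissible_swap n r w \<longleftrightarrow>
     1 \<le> r \<and> r < length w \<and>
     letter w r \<noteq> letter w (r + 1) \<and> \<not> D_neighbors n (letter w r) (letter w (r + 1))"

definition weight_graph :: "nat \<Rightarrow> nat multiset \<Rightarrow> (nat list \<times> nat list) set" where
  "weight_graph n \<alpha> =
     {(w, swap_at r w) | w r. w \<in> permutations_of_multiset \<alpha> \<and> admissible_swap n r w}"

definition word_component :: "nat \<Rightarrow> nat list \<Rightarrow> nat list set" where
  "word_component n w = (weight_graph n (mset w))\<^sup>* `` {w}"

text \<open>
  \<open>S(w)\<close> consists of the functions \<open>f\<close> supported on the component of \<open>w\<close>; \<open>f\<close> represents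
  \<open>\<Sum>\<^sub>u f(u) v\<^sub>u\<close>.
\<close>

definition basis_vector :: "nat list \<Rightarrow> nat list \<Rightarrow> 'f::field" where
  "basis_vector u = (\<lambda>x. if x = u then 1 else 0)"

fun act_on_basis :: "nat \<Rightarrow> klr_gen \<Rightarrow> nat list \<Rightarrow> (nat list \<Rightarrow> 'f::field)" where
  "act_on_basis n (EGen u') u = (if u = u' then basis_vector u else (\<lambda>_. 0))"
| "act_on_basis n (YGen r) u = (\<lambda>_. 0)"
| "act_on_basis n (PsiGen r) u =
     (if admissible_swap n r u then basis_vector (swap_at r u) else (\<lambda>_. 0))"

definition act_gen ::
    "nat \<Rightarrow> nat list \<Rightarrow> klr_gen \<Rightarrow> (nat list \<Rightarrow> 'f) \<Rightarrow> (nat list \<Rightarrow> 'f::field)" where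
  "act_gen n w g f = (\<lambda>x. \<Sum>u\<in>word_component n w. f u * act_on_basis n g u x)"

definition act_free ::
    "nat \<Rightarrow> nat list \<Rightarrow> 'f klr_free_elt \<Rightarrow> (nat list \<Rightarrow> 'f) \<Rightarrow> (nat list \<Rightarrow> 'f::field)" where
  "act_free n w p f =
     (\<lambda>x. \<Sum>m\<in>Poly_Mapping.keys p. Poly_Mapping.lookup p m * foldr (act_gen n w) (factors m) f x)"

text \<open>
  For homogeneous \<open>w\<close> the defining relations act by zero on \<open>S(w)\<close>, so that all representatives of a
  class \<open>X\<close> in the quotient act in the same way.
\<close>

definition S_module :: "nat \<Rightarrow> nat list \<Rightarrow> ('f::field, nat list \<Rightarrow> 'f) klr_module" where
  "S_module n w =
     \<lparr>carrier = {f. \<forall>u. u \<notin> word_component n w \<longrightarrow> f u = 0},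
      mult = undefined, one = undefined,
      zero = (\<lambda>_. 0), add = (\<lambda>f g x. f x + g x),
      smult = (\<lambda>X f. the_elem ((\<lambda>p. act_free n w p f) ` X)),
      component = (\<lambda>d. if d = 0 then {f. \<forall>u. u \<notin> word_component n w \<longrightarrow> f u = 0} else {\<lambda>_. 0})\<rparr>"

subsection \<open>Isomorphism classes\<close>

definition homogeneous_reps ::
    "nat \<Rightarrow> (nat \<times> nat) set \<Rightarrow> (nat multiset \<times> ('f::field, 'v) klr_module) set" where
  "homogeneous_reps n \<Gamma> = {(\<alpha>, M). homogeneous_rep n \<Gamma> \<alpha> M}"

definition rep_equiv ::
    "nat \<Rightarrow> (nat \<times> nat) set \<Rightarrow> (nat multiset \<times> ('f::field, 'v) klr_module) rel" where
  "rep_equiv n \<Gamma> =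
     {((\<alpha>, M), (\<beta>, N)). (\<alpha>, M) \<in> homogeneous_reps n \<Gamma> \<and> (\<beta>, N) \<in> homogeneous_reps n \<Gamma> \<and>
        \<alpha> = \<beta> \<and> isomorphic_up_to_shift (klr \<Gamma> \<alpha>) M N}"

text \<open>
  The homogeneous representations up to isomorphism and degree shift, on subsets of the type
  \<^typ>\<open>nat list \<Rightarrow> 'f\<close>, which is large enough to contain all finite-dimensional modules.
\<close>

definition rep_classes ::
    "nat \<Rightarrow> (nat \<times> nat) set \<Rightarrow> (nat multiset \<times> ('f::field, nat list \<Rightarrow> 'f) klr_module) set set" where
  "rep_classes n \<Gamma> = homogeneous_reps n \<Gamma> // rep_equiv n \<Gamma>"

definition S_class ::
    "nat \<Rightarrow> (nat \<times> nat) set \<Rightarrow> nat list \<Rightarrow>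
     (nat multiset \<times> ('f::field, nat list \<Rightarrow> 'f) klr_module) set" where
  "S_class n \<Gamma> w = rep_equiv n \<Gamma> `` {(mset w, S_module n w)}"


section \<open>Canonical reduced words, collections and packets\<close>

definition s_word :: "nat \<Rightarrow> nat \<Rightarrow> nat \<Rightarrow> nat list" where
  "s_word n i j =
     (if i < n then rev [j..<i + 1]
      else if j \<le> n - 2 then n # rev [j..<n - 1]
      else if j \<le> n then [n]
      else [])"

definition prefixes :: "nat \<Rightarrow> nat list set" where
  "prefixes n =
     {concat (map (\<lambda>m. s_word n m (i m)) [1..<n]) | i. \<forall>m\<in>{1..n - 1}. 1 \<le> i m \<and> i m \<le> m + 1}"

definition suffix_labels :: "nat \<Rightarrow> nat list set" where
  "suffix_labels n = {js. sorted_wrt (<) js \<and> set js \<subseteq> {1..n - 1}}"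

text \<open>Lists are indexed from 0, so \<open>j\<^sub>t\<^sub>+\<^sub>1\<close> is the entry at \<open>t\<close>.\<close>

definition suffix_word :: "nat \<Rightarrow> nat list \<Rightarrow> nat list" where
  "suffix_word n js =
     concat (map (\<lambda>t. s_word n (if even t then n else n - 1) (js ! t)) [0..<length js])"

definition suffixes_D :: "nat \<Rightarrow> nat list set" where
  "suffixes_D n = suffix_word n ` suffix_labels n"

definition canonical_words :: "nat \<Rightarrow> nat list set" where
  "canonical_words n = {w0 @ w' | w0 w'. w0 \<in> prefixes n \<and> w' \<in> suffixes_D n}"

definition homogeneous_canonical :: "nat \<Rightarrow> nat list set" where
  "homogeneous_canonical n = {w \<in> canonical_words n. homogeneous_word n w}"

definition collection :: "nat \<Rightarrow> nat list \<Rightarrow> nat list set" where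
  "collection n w' = {w \<in> homogeneous_canonical n. \<exists>w0\<in>prefixes n. w = w0 @ w'}"

definition packet :: "nat \<Rightarrow> nat \<Rightarrow> nat list set set" where
  "packet n k =
     (if k = 0 then
        {collection n (suffix_word n js) | js. js \<in> suffix_labels n \<and> 2 \<le> length js \<and> hd js = 1}
      else if k \<le> n - 3 then
        {collection n (s_word n n k)} \<union>
        {collection n (suffix_word n js) | js. js \<in> suffix_labels n \<and> 2 \<le> length js \<and> hd js = k + 1}
      else if k = n - 2 then {collection n [n, n - 2]}
      else if k = n - 1 then {collection n [n]}
      else {collection n []})"

fun catalan_triangle :: "nat \<Rightarrow> nat \<Rightarrow> nat" where
  "catalan_triangle 0 k = (if k = 0 then 1 else 0)"
| "catalan_triangle (Suc n) 0 = catalan_triangle n 0"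
| "catalan_triangle (Suc n) (Suc k) =
     (if k < n then catalan_triangle (Suc n) k + catalan_triangle n (Suc k)
      else if k = n then catalan_triangle (Suc n) k
      else 0)"

end

(*
  Every y_k, and every psi_k e(w) of nonzero degree, acts by zero on a module M that is concentrated
  in a single degree. The defining relations then show that no weight of M is related by
  commutations to a word with a factor a a or a b a (a, b neighbors), which means that all weights
  are homogeneous words, and that transporting a weight vector along admissible swaps depends only on
  the end points of the path. Hence an irreducible M with weight w is isomorphic to S(w), and S(w) is
  determined by the commutation class of w.

  Each commutation class of homogeneous words contains exactly one canonical word: a letter appended
  to a canonical word commutes past blocks until it extends one of them, unless homogeneity fails;
  and canonical words are lexicographic normal forms, of which a class has only one.

  In a homogeneous prefix the smallest letters of the nonempty blocks increase strictly. A suffix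
  with at least two blocks bounds them from above, the suffix s_nk allows those that are at least k
  to be a final segment of the interval from k to n-1, and removing the last block of the prefix
  gives the recursion of Catalan's triangle.
*)
theory Submission
  imports Defs
begin

section \<open>Commutation classes of words\<close>

text \<open>Homogeneity is tested by letting a word act on counters, one for each letter, as an
  automaton would. Inside a descending block each letter has just been preceded by a neighbor, so it
  needs only one more from before the block. Hence a prefix restricts what may follow it only
  through the letters that it leaves with counter 0, and counting prefixes becomes counting words by
  the position of these zeros. The obstacle to path independence is that a closed path in the weight
  graph does not visibly decompose into squares and hexagons. Swaps are therefore oriented from
  descents to ascents, and confluence is proved for pairs of a word and a vector. Two overlapping
  descents a > b > c can be completed to a braid hexagon only if a and c commute too. This depends
  on the numbering of the diagram: neighbors with a letter strictly between them can only be n - 2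
  and n, the letter between is then n - 1, and it is itself a neighbor of n - 2, which contradicts
  that b and c commute.\<close>

definition commute :: "nat \<Rightarrow> nat \<Rightarrow> nat \<Rightarrow> bool" where
  "commute n a b \<longleftrightarrow> a \<noteq> b \<and> \<not> D_neighbors n a b"

inductive comm_step :: "nat \<Rightarrow> nat list \<Rightarrow> nat list \<Rightarrow> bool" for n where
  swap: "commute n a b \<Longrightarrow> comm_step n (p @ a # b # q) (p @ b # a # q)"

abbreviation comm_equiv :: "nat \<Rightarrow> nat list \<Rightarrow> nat list \<Rightarrow> bool" where
  "comm_equiv n \<equiv> (comm_step n)\<^sup>*\<^sup>*"

lemma D_neighbors_sym: "D_neighbors n a b \<longleftrightarrow> D_neighbors n b a"
  by (simp add: D_neighbors_def insert_commute)

lemma D_neighbors_iff: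
  "D_neighbors n a b \<longleftrightarrow>
     (1 \<le> a \<and> a \<le> n - 2 \<and> b = a + 1) \<or> (1 \<le> b \<and> b \<le> n - 2 \<and> a = b + 1) \<or>
     (a = n - 2 \<and> b = n) \<or> (b = n - 2 \<and> a = n)"
  unfolding D_neighbors_def by (auto simp: doubleton_eq_iff)

lemma commute_sym: "commute n a b \<longleftrightarrow> commute n b a"
  using D_neighbors_sym by (auto simp: commute_def)

lemma comm_step_sym: "comm_step n u v \<Longrightarrow> comm_step n v u"
  by (metis comm_step.cases comm_step.swap commute_sym)

lemma comm_equiv_sym: "comm_equiv n u v \<Longrightarrow> comm_equiv n v u"
  by (induction rule: rtranclp_induct) (auto intro: comm_step_sym converse_rtranclp_into_rtranclp)

lemma comm_step_append: "comm_step n u v \<Longrightarrow> comm_step n (p @ u @ q) (p @ v @ q)"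
proof (induction rule: comm_step.induct)
  case (swap a b p' q')
  then show ?case
    using comm_step.swap[of n a b "p @ p'" "q' @ q"] by simp
qed

lemma comm_equiv_append: "comm_equiv n u v \<Longrightarrow> comm_equiv n (p @ u @ q) (p @ v @ q)"
  by (induction rule: rtranclp_induct) (auto intro: comm_step_append rtranclp.rtrancl_into_rtrancl)

lemma comm_equiv_appendR: "comm_equiv n u v \<Longrightarrow> comm_equiv n (u @ q) (v @ q)"
  using comm_equiv_append[of n u v "[]" q] by simp

lemma comm_equiv_move:
  assumes "\<And>x. x \<in> set p \<Longrightarrow> commute n a x"
  shows "comm_equiv n (p @ a # q) (a # p @ q)"
  using assms
proof (induction p)
  case (Cons b p)
  then have "comm_equiv n (b # p @ a # q) (b # a # p @ q)"
    using comm_equiv_append[of n "p @ a # q" "a # p @ q" "[b]" "[]"] by simp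
  also have "comm_step n (b # a # p @ q) (a # b # p @ q)"
    using Cons.prems[of b] comm_step.swap[of n b a "[]" "p @ q"] commute_sym[of n a b] by simp
  finally show ?case by simp
qed simp

lemma comm_equiv_mset: "comm_equiv n u v \<Longrightarrow> mset v = mset u"
proof (induction rule: rtranclp_induct)
  case (step y z)
  from step.hyps(2) show ?case
    by cases (use step.IH in \<open>simp add: add_mset_commute\<close>)
qed simp

lemma admissible_swapE:
  assumes "admissible_swap n r w"
  obtains p a b q where "w = p @ a # b # q" "length p = r - 1" "swap_at r w = p @ b # a # q"
    "commute n a b"
proof -
  have r: "1 \<le> r" "r < length w" and c: "commute n (w ! (r - 1)) (w ! r)"
    using assms by (auto simp: admissible_swap_def letter_def commute_def)
  have w: "w = take (r - 1) w @ w ! (r - 1) # w ! r # drop (r + 1) w"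
    using r by (metis Cons_nth_drop_Suc Suc_eq_plus1 append_take_drop_id diff_less_Suc
        le_add_diff_inverse2 less_imp_diff_less)
  have "swap_at r w = take (r - 1) w @ w ! r # w ! (r - 1) # drop (r + 1) w"
    using r unfolding swap_at_def letter_def
    by (intro nth_equalityI)
      (auto simp: nth_append nth_list_update nth_Cons' min_def not_le not_less le_Suc_eq less_Suc_eq)
  with w c r show ?thesis by (intro that[of "take (r - 1) w"]) auto
qed

lemma admissible_swap_append:
  assumes "commute n a b"
  shows "admissible_swap n (length p + 1) (p @ a # b # q)"
    and "swap_at (length p + 1) (p @ a # b # q) = p @ b # a # q"
  using assms by (auto simp: admissible_swap_def swap_at_def letter_def nth_append commute_def
      list_update_append)

text \<open>The combinatorics works with factorizations of words, the operators
  \<open>\<psi> k\<close> with positions; this is the passage between the two.\<close>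

lemma comm_step_iff: "comm_step n u v \<longleftrightarrow> (\<exists>r. admissible_swap n r u \<and> v = swap_at r u)"
  by (metis admissible_swapE admissible_swap_append comm_step.cases comm_step.swap)

text \<open>Commutations preserve the multiset of letters, so a path that starts at \<open>w\<close>
  never leaves the words of content \<open>mset w\<close>.\<close>

lemma word_component_eq: "word_component n w = {u. comm_equiv n w u}"
proof -
  have "(w, u) \<in> (weight_graph n (mset w))\<^sup>* \<longleftrightarrow> comm_equiv n w u" for u
  proof
    assume "(w, u) \<in> (weight_graph n (mset w))\<^sup>*"
    then show "comm_equiv n w u"
      by (induction rule: rtrancl_induct)
        (auto simp: weight_graph_def comm_step_iff intro: rtranclp.rtrancl_into_rtrancl)
  next
    assume "comm_equiv n w u"
    then show "(w, u) \<in> (weight_graph n (mset w))\<^sup>*"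
    proof (induction rule: rtranclp_induct)
      case (step y z)
      then have "(y, z) \<in> weight_graph n (mset w)"
        using comm_equiv_mset
        by (auto simp: weight_graph_def comm_step_iff permutations_of_multiset_def)
      with step.IH show ?case by (rule rtrancl_into_rtrancl)
    qed simp
  qed
  then show ?thesis by (auto simp: word_component_def)
qed

section \<open>Homogeneity as a run of gap counters\<close>

text \<open>
  A counter for each letter records the number of its neighbors read since its last occurrence;
  a letter may be read if its counter is at least 2. Counters start at 2, so that the first
  occurrence of a letter is unconstrained.
\<close>

definition tick :: "nat \<Rightarrow> nat \<Rightarrow> (nat \<Rightarrow> nat) \<Rightarrow> nat \<Rightarrow> nat" where
  "tick n x \<sigma> = (\<lambda>y. if y = x then 0 else if D_neighbors n x y then Suc (\<sigma> y) else \<sigma> y)"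

abbreviation gaps :: "nat \<Rightarrow> nat list \<Rightarrow> (nat \<Rightarrow> nat) \<Rightarrow> nat \<Rightarrow> nat" where
  "gaps n \<equiv> fold (tick n)"

primrec gaps_ok :: "nat \<Rightarrow> (nat \<Rightarrow> nat) \<Rightarrow> nat list \<Rightarrow> bool" where
  "gaps_ok n \<sigma> [] \<longleftrightarrow> True"
| "gaps_ok n \<sigma> (x # w) \<longleftrightarrow> 2 \<le> \<sigma> x \<and> gaps_ok n (tick n x \<sigma>) w"

abbreviation fresh :: "nat \<Rightarrow> nat" where "fresh \<equiv> \<lambda>_. 2"

lemma gaps_ok_append [simp]:
  "gaps_ok n \<sigma> (u @ v) \<longleftrightarrow> gaps_ok n \<sigma> u \<and> gaps_ok n (gaps n u \<sigma>) v"
  by (induction u arbitrary: \<sigma>) auto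

lemma tick_commute: "commute n a b \<Longrightarrow> tick n a (tick n b \<sigma>) = tick n b (tick n a \<sigma>)"
  using D_neighbors_sym by (fastforce simp: tick_def commute_def)

text \<open>Distinct letters that are not neighbors do not touch each other's counter, and their
  ticks commute. A swap thus preserves the two tests as well as the counters handed to the rest of
  the word.\<close>

lemma gaps_ok_comm_equiv: "comm_equiv n u v \<Longrightarrow> gaps_ok n \<sigma> u \<Longrightarrow> gaps_ok n \<sigma> v"
proof (induction rule: rtranclp_induct)
  case (step y z)
  from step.hyps(2) show ?case
  proof cases
    case (swap a b p q)
    then show ?thesis
      using step D_neighbors_sym[of n a b]
      by (auto simp: tick_commute[of n a b]) (auto simp: tick_def commute_def split: if_splits)
  qed
qed

text \<open>\<open>Q\<close> receives the position besides the letter, so that in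
  \<open>gaps_ge_2\<close> the search for an earlier position can be hidden inside it.\<close>

lemma ex_nth_snoc:
  "(\<exists>t. r < t \<and> t < length (w @ [x]) \<and> Q t ((w @ [x]) ! t)) \<longleftrightarrow>
     (\<exists>t. r < t \<and> t < length w \<and> Q t (w ! t)) \<or> (r < length w \<and> Q (length w) x)" (is "?L \<longleftrightarrow> ?R")
proof
  assume ?L
  then obtain t where "r < t" "t < length w \<or> t = length w" "Q t ((w @ [x]) ! t)"
    by (auto simp: less_Suc_eq)
  then show ?R by (auto simp: nth_append)
next
  assume ?R
  then show ?L
  proof
    assume "\<exists>t. r < t \<and> t < length w \<and> Q t (w ! t)"
    then obtain t where "r < t" "t < length w" "Q t (w ! t)" by blast
    then show ?L by (intro exI[of _ t]) (simp add: nth_append)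
  qed (intro exI[of _ "length w"], simp)
qed

lemma all_nth_snoc:
  "(\<forall>r<length (w @ [x]). Q r ((w @ [x]) ! r)) \<longleftrightarrow> (\<forall>r<length w. Q r (w ! r)) \<and> Q (length w) x"
  by (auto simp: less_Suc_eq nth_append)

text \<open>The counter only sees the last occurrence of \<open>a\<close>, but a neighbor after the
  last occurrence also comes after every earlier one, so all occurrences may be quantified. Without
  any occurrence the counter is at least 2 thanks to \<open>fresh\<close>.\<close>

lemma gaps_ge_1:
  "1 \<le> gaps n w fresh a \<longleftrightarrow>
     (\<forall>r<length w. w ! r = a \<longrightarrow> (\<exists>t. r < t \<and> t < length w \<and> D_neighbors n a (w ! t)))"
proof (induction w rule: rev_induct)
  case (snoc x w)
  have "(\<forall>r<length (w @ [x]). (w @ [x]) ! r = a \<longrightarrow>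
        (\<exists>t. r < t \<and> t < length (w @ [x]) \<and> D_neighbors n a ((w @ [x]) ! t))) \<longleftrightarrow>
     x \<noteq> a \<and> (D_neighbors n a x \<or> 1 \<le> gaps n w fresh a)"
    (is "?L \<longleftrightarrow> _")
  proof -
    have "?L \<longleftrightarrow> (\<forall>r<length w. w ! r = a \<longrightarrow> (\<exists>t. r < t \<and> t < length w \<and> D_neighbors n a (w ! t)) \<or>
        r < length w \<and> D_neighbors n a x) \<and>
       (x = a \<longrightarrow> (\<exists>t. length w < t \<and> t < length w \<and> D_neighbors n a (w ! t)) \<or>
        length w < length w \<and> D_neighbors n a x)"
      unfolding ex_nth_snoc[where Q = "\<lambda>_ y. D_neighbors n a y"] by (rule all_nth_snoc)
    then show ?thesis
      unfolding snoc.IH by (cases "D_neighbors n a x") auto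
  qed
  moreover have "1 \<le> gaps n (w @ [x]) fresh a \<longleftrightarrow>
     x \<noteq> a \<and> (D_neighbors n a x \<or> 1 \<le> gaps n w fresh a)"
    using D_neighbors_sym[of n a x] by (auto simp: tick_def)
  ultimately show ?case by blast
qed simp

lemma gaps_ge_2:
  "2 \<le> gaps n w fresh a \<longleftrightarrow>
     (\<forall>r<length w. w ! r = a \<longrightarrow> (\<exists>u. r < u \<and> u < length w \<and>
        D_neighbors n a (w ! u) \<and> (\<exists>t. r < t \<and> t < u \<and> D_neighbors n a (w ! t))))"
proof (induction w rule: rev_induct)
  case (snoc x w)
  define A where "A r \<longleftrightarrow> (\<exists>u. r < u \<and> u < length w \<and> D_neighbors n a (w ! u) \<and>
        (\<exists>t. r < t \<and> t < u \<and> D_neighbors n a (w ! t)))" for r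
  define B where "B r \<longleftrightarrow> (\<exists>t. r < t \<and> t < length w \<and> D_neighbors n a (w ! t))" for r
  have AB: "A r \<Longrightarrow> B r" for r
    unfolding A_def B_def by blast
  have A_len: "\<not> A (length w)"
    unfolding A_def by (meson less_asym)
  \<comment> \<open>The appended letter can only be the later of the two neighbors; \<open>B\<close>
    then provides the earlier one.\<close>
  have ex: "(\<exists>u. r < u \<and> u < length (w @ [x]) \<and> D_neighbors n a ((w @ [x]) ! u) \<and>
        (\<exists>t. r < t \<and> t < u \<and> D_neighbors n a ((w @ [x]) ! t))) \<longleftrightarrow>
      A r \<or> (r < length w \<and> D_neighbors n a x \<and> B r)" for r
    unfolding ex_nth_snoc[where Q = "\<lambda>u y. D_neighbors n a y \<and>
        (\<exists>t. r < t \<and> t < u \<and> D_neighbors n a ((w @ [x]) ! t))"] A_def B_def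
    by (intro arg_cong2[of _ _ _ _ "(\<or>)"] ex_cong1 conj_cong refl)
      (simp_all add: nth_append)
  have "(\<forall>r<length (w @ [x]). (w @ [x]) ! r = a \<longrightarrow> (\<exists>u. r < u \<and> u < length (w @ [x]) \<and>
        D_neighbors n a ((w @ [x]) ! u) \<and> (\<exists>t. r < t \<and> t < u \<and> D_neighbors n a ((w @ [x]) ! t)))) \<longleftrightarrow>
     x \<noteq> a \<and> (2 \<le> gaps n w fresh a \<or> D_neighbors n a x \<and> 1 \<le> gaps n w fresh a)"
    (is "?L \<longleftrightarrow> _")
  proof -
    have "?L \<longleftrightarrow> (\<forall>r<length w. w ! r = a \<longrightarrow> A r \<or> r < length w \<and> D_neighbors n a x \<and> B r) \<and>
       (x = a \<longrightarrow> A (length w) \<or> length w < length w \<and> D_neighbors n a x \<and> B (length w))"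
      unfolding ex by (rule all_nth_snoc)
    also have "\<dots> \<longleftrightarrow> x \<noteq> a \<and> ((\<forall>r<length w. w ! r = a \<longrightarrow> A r) \<or>
        D_neighbors n a x \<and> (\<forall>r<length w. w ! r = a \<longrightarrow> B r))"
      using AB A_len by (cases "D_neighbors n a x") auto
    finally show ?thesis
      unfolding A_def B_def snoc.IH gaps_ge_1 .
  qed
  moreover have "2 \<le> gaps n (w @ [x]) fresh a \<longleftrightarrow>
     x \<noteq> a \<and> (2 \<le> gaps n w fresh a \<or> D_neighbors n a x \<and> 1 \<le> gaps n w fresh a)"
    using D_neighbors_sym[of n a x] by (auto simp: tick_def)
  ultimately show ?case by blast
qed simp

lemma homogeneous_word_snoc:
  "homogeneous_word n (w @ [a]) \<longleftrightarrow> homogeneous_word n w \<and> 2 \<le> gaps n w fresh a"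
proof -
  \<comment> \<open>Positions are shifted to start at 0, and the later of the two equal letters is
    quantified outermost, so that an appended letter contributes exactly the instance
    \<open>s = length w\<close>.\<close>
  have pos: "(\<forall>r s. 1 \<le> r \<and> r < s \<and> s \<le> length v \<and> letter v r = letter v s \<longrightarrow>
        (\<exists>t u. r < t \<and> t < u \<and> u < s \<and>
           D_neighbors n (letter v r) (letter v t) \<and> D_neighbors n (letter v r) (letter v u))) \<longleftrightarrow>
     (\<forall>s<length v. \<forall>r<s. v ! r = v ! s \<longrightarrow> (\<exists>u. r < u \<and> u < s \<and>
        D_neighbors n (v ! s) (v ! u) \<and> (\<exists>t. r < t \<and> t < u \<and> D_neighbors n (v ! s) (v ! t))))" (is "?A \<longleftrightarrow> ?B") for v
  proof
    assume A: ?A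
    show ?B
    proof (intro allI impI)
      fix s r assume "s < length v" "r < s" "v ! r = v ! s"
      with A[rule_format, of "Suc r" "Suc s"] obtain t u where
        tu: "Suc r < t" "t < u" "u < Suc s"
          "D_neighbors n (v ! r) (v ! (t - 1))" "D_neighbors n (v ! r) (v ! (u - 1))"
        by (auto simp: letter_def)
      then show "\<exists>u. r < u \<and> u < s \<and> D_neighbors n (v ! s) (v ! u) \<and>
          (\<exists>t. r < t \<and> t < u \<and> D_neighbors n (v ! s) (v ! t))"
        using \<open>v ! r = v ! s\<close>
        by (intro exI[of _ "t - 1"] exI[of _ "u - 1"] conjI) auto
    qed
  next
    assume B: ?B
    show ?A
    proof (intro allI impI)
      fix r s assume rs: "1 \<le> r \<and> r < s \<and> s \<le> length v \<and> letter v r = letter v s"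
      then have "s - 1 < length v" "r - 1 < s - 1" "v ! (r - 1) = v ! (s - 1)"
        by (auto simp: letter_def)
      with B obtain t u where "r - 1 < t" "t < u" "u < s - 1"
          "D_neighbors n (v ! (s - 1)) (v ! t)" "D_neighbors n (v ! (s - 1)) (v ! u)"
        by blast
      with rs show "\<exists>t u. r < t \<and> t < u \<and> u < s \<and>
           D_neighbors n (letter v r) (letter v t) \<and> D_neighbors n (letter v r) (letter v u)"
        by (intro exI[of _ "Suc t"] exI[of _ "Suc u"]) (auto simp: letter_def)
    qed
  qed
  have less: "(\<forall>s<length (w @ [a]). P s) \<longleftrightarrow> (\<forall>s<length w. P s) \<and> P (length w)" for P
    by (auto simp: less_Suc_eq)
  show ?thesis
    unfolding homogeneous_word_def pos less gaps_ge_2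
    by (simp add: nth_append cong: conj_cong imp_cong)
qed

lemma homogeneous_word_iff: "homogeneous_word n w \<longleftrightarrow> gaps_ok n fresh w"
proof (induction w rule: rev_induct)
  case Nil
  show ?case by (simp add: homogeneous_word_def)
qed (simp add: homogeneous_word_snoc)

lemma homogeneous_word_comm_equiv:
  "comm_equiv n u v \<Longrightarrow> homogeneous_word n u \<Longrightarrow> homogeneous_word n v"
  by (simp add: homogeneous_word_iff gaps_ok_comm_equiv)

section \<open>Canonical words\<close>

lemma rev_upt_snoc: "j < m \<Longrightarrow> rev [j..<m] = rev [Suc j..<m] @ [j]"
  by (simp add: upt_conv_Cons)

lemma tick_apply: "tick n x \<sigma> y = (if y = x then 0 else if D_neighbors n x y then Suc (\<sigma> y) else \<sigma> y)"
  by (simp add: tick_def)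

lemma D_neighbors_iff_add:
  "2 \<le> n \<Longrightarrow> D_neighbors n a b \<longleftrightarrow>
     (1 \<le> a \<and> a + 2 \<le> n \<and> b = a + 1) \<or> (1 \<le> b \<and> b + 2 \<le> n \<and> a = b + 1) \<or>
     (a + 2 = n \<and> b = n) \<or> (b + 2 = n \<and> a = n)"
  unfolding D_neighbors_iff by linarith

text \<open>All letters of the run are at most n - 2, so each is a neighbor of the next. An inner
  letter is reset when read and advanced once by the next one, and \<open>j\<close> stays at 0.
  Outside the run only j - 1, m and, if n - 2 was read, also n see a neighbor.\<close>

lemma gaps_rev_upt:
  assumes "j \<le> m" "1 \<le> j" "m < n" "1 \<le> y"
  shows "gaps n (rev [j..<m]) \<sigma> y =
    (if j \<le> y \<and> y < m then (if y = j then 0 else 1)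
     else if j < m \<and> (y + 1 = j \<or> y = m \<or> y = n \<and> m + 1 = n) then Suc (\<sigma> y) else \<sigma> y)"
  using assms(1,2)
proof (induction j rule: inc_induct)
  case (step j)
  have IH: "gaps n (rev [Suc j..<m]) \<sigma> y =
    (if Suc j \<le> y \<and> y < m then (if y = Suc j then 0 else 1)
     else if Suc j < m \<and> (y + 1 = Suc j \<or> y = m \<or> y = n \<and> m + 1 = n) then Suc (\<sigma> y) else \<sigma> y)"
    by (rule step.IH) simp
  have nb: "D_neighbors n j y \<longleftrightarrow> y + 1 = j \<or> y = j + 1 \<or> y = n \<and> j + 2 = n"
    using step.hyps step.prems assms(3,4) by (subst D_neighbors_iff_add) auto
  have snoc: "gaps n (rev [j..<m]) \<sigma> y = tick n j (gaps n (rev [Suc j..<m]) \<sigma>) y"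
    using step.hyps by (simp add: rev_upt_snoc)
  note tick = tick_apply[of n j "gaps n (rev [Suc j..<m]) \<sigma>" y]
  consider "y < j" | "y = j" | "y = Suc j" | "Suc j < y" "y < m" | "Suc j < y" "y = m"
    | "Suc j < y" "m < y" "y = n" | "Suc j < y" "m < y" "y \<noteq> n" by linarith
  then show ?case
    unfolding snoc tick IH nb
    using step.hyps step.prems assms(3,4) by cases simp_all
qed simp

text \<open>Every letter but the first has its counter raised by the letter read just before it, so
  1 suffices for it at the start of the run.\<close>

lemma gaps_ok_rev_upt:
  assumes "j \<le> m" "1 \<le> j" "m < n"
  shows "gaps_ok n \<sigma> (rev [j..<m]) \<longleftrightarrow> (j < m \<longrightarrow> 2 \<le> \<sigma> (m - 1)) \<and> (\<forall>y\<in>{j..<m - 1}. 1 \<le> \<sigma> y)"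
  using assms(1,2)
proof (induction j rule: inc_induct)
  case (step j)
  have snoc: "gaps_ok n \<sigma> (rev [j..<m]) \<longleftrightarrow>
      gaps_ok n \<sigma> (rev [Suc j..<m]) \<and> 2 \<le> gaps n (rev [Suc j..<m]) \<sigma> j"
    using step.hyps by (simp add: rev_upt_snoc)
  have gap: "gaps n (rev [Suc j..<m]) \<sigma> j = (if Suc j < m then Suc (\<sigma> j) else \<sigma> j)"
    using step assms by (subst gaps_rev_upt) auto
  have IH: "gaps_ok n \<sigma> (rev [Suc j..<m]) \<longleftrightarrow>
      (Suc j < m \<longrightarrow> 2 \<le> \<sigma> (m - 1)) \<and> (\<forall>y\<in>{Suc j..<m - 1}. 1 \<le> \<sigma> y)"
    using step by simp
  show ?case
  proof (cases "Suc j < m")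
    case True
    then have "{j..<m - 1} = insert j {Suc j..<m - 1}" by auto
    with True show ?thesis unfolding snoc gap IH by auto
  next
    case False
    then have "m = Suc j" using step.hyps by simp
    then show ?thesis by simp
  qed
qed simp

text \<open>
  The blocks of canonical words are \<open>[x, m-1, \<dots>, j]\<close> where \<open>x = m\<close>, or \<open>x = n\<close> and \<open>m = n - 1\<close>.
\<close>

definition block_top :: "nat \<Rightarrow> nat \<Rightarrow> nat \<Rightarrow> bool" where
  "block_top n x m \<longleftrightarrow> 1 \<le> m \<and> m < n \<and> (x = m \<or> x = n \<and> m + 1 = n)"

lemma block_top_neighbor:
  "block_top n x m \<Longrightarrow> 1 \<le> y \<Longrightarrow> y < m \<Longrightarrow> D_neighbors n x y \<longleftrightarrow> y + 1 = m"
  by (subst D_neighbors_iff_add) (auto simp: block_top_def)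

text \<open>The top is a neighbor of m - 1 in both kinds of block, so it relieves the first letter
  of the tail as well: only the top itself must start at 2.\<close>

lemma gaps_ok_block:
  assumes "block_top n x m" "1 \<le> j" "j \<le> m"
  shows "gaps_ok n \<sigma> (x # rev [j..<m]) \<longleftrightarrow> 2 \<le> \<sigma> x \<and> (\<forall>y\<in>{j..<m}. 1 \<le> \<sigma> y)"
proof -
  have tick: "tick n x \<sigma> y = (if y + 1 = m then Suc (\<sigma> y) else \<sigma> y)" if "y \<in> {j..<m}" for y
    using that assms block_top_neighbor[of n x m y] by (auto simp: tick_apply block_top_def)
  have "gaps_ok n \<sigma> (x # rev [j..<m]) \<longleftrightarrow> 2 \<le> \<sigma> x \<and>
      (j < m \<longrightarrow> 2 \<le> tick n x \<sigma> (m - 1)) \<and> (\<forall>y\<in>{j..<m - 1}. 1 \<le> tick n x \<sigma> y)"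
    using assms by (simp add: gaps_ok_rev_upt block_top_def)
  also have "(\<forall>y\<in>{j..<m - 1}. 1 \<le> tick n x \<sigma> y) \<longleftrightarrow> (\<forall>y\<in>{j..<m - 1}. 1 \<le> \<sigma> y)"
    using tick by (intro ball_cong) (auto split: if_splits)
  also have "(j < m \<longrightarrow> 2 \<le> tick n x \<sigma> (m - 1)) \<longleftrightarrow> (j < m \<longrightarrow> 1 \<le> \<sigma> (m - 1))"
    using tick[of "m - 1"] assms by (intro imp_cong) auto
  also have "2 \<le> \<sigma> x \<and> (j < m \<longrightarrow> 1 \<le> \<sigma> (m - 1)) \<and> (\<forall>y\<in>{j..<m - 1}. 1 \<le> \<sigma> y) \<longleftrightarrow>
      2 \<le> \<sigma> x \<and> (\<forall>y\<in>{j..<m}. 1 \<le> \<sigma> y)"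
  proof (cases "j < m")
    case True
    then have "{j..<m} = insert (m - 1) {j..<m - 1}" by auto
    with True show ?thesis by simp
  qed simp
  finally show ?thesis .
qed

text \<open>The last fact concerns the two tops n - 1 and n. They share the neighbor n - 2, so a
  block with one of them as top and a nonempty tail advances the counter of the other; this is what
  lets tops alternate in a suffix.\<close>

lemma gaps_block:
  assumes "block_top n x m" "1 \<le> j" "j \<le> m" "1 \<le> y"
  shows "y = x \<Longrightarrow> gaps n (x # rev [j..<m]) \<sigma> y = (if j < m then 1 else 0)"
    and "j \<le> y \<Longrightarrow> y < m \<Longrightarrow> gaps n (x # rev [j..<m]) \<sigma> y = (if y = j then 0 else 1)"
    and "y + 1 = j \<Longrightarrow> gaps n (x # rev [j..<m]) \<sigma> y = Suc (\<sigma> y)"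
    and "y + 1 < j \<Longrightarrow> gaps n (x # rev [j..<m]) \<sigma> y = \<sigma> y"
    and "m \<le> y \<Longrightarrow> y \<noteq> x \<Longrightarrow> \<sigma> y \<le> gaps n (x # rev [j..<m]) \<sigma> y"
    and "m + 1 = n \<Longrightarrow> x \<noteq> y \<Longrightarrow> y = m \<or> y = n \<Longrightarrow>
      gaps n (x # rev [j..<m]) \<sigma> y = (if j < m then Suc (\<sigma> y) else \<sigma> y)"
proof -
  have top: "1 \<le> m" "m < n" "x = m \<or> x = n \<and> m + 1 = n" "2 \<le> n"
    using assms(1) by (auto simp: block_top_def)
  note gaps = gaps_rev_upt[OF assms(3,2) top(2) assms(4), of "tick n x \<sigma>"]
  have eq: "gaps n (x # rev [j..<m]) \<sigma> y = gaps n (rev [j..<m]) (tick n x \<sigma>) y"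
    by simp
  note nb = D_neighbors_iff_add[OF top(4)]
  show "y = x \<Longrightarrow> gaps n (x # rev [j..<m]) \<sigma> y = (if j < m then 1 else 0)"
    unfolding eq gaps tick_apply[of n x \<sigma> y]
    using top(1-3) assms(2-4) by (elim disjE) simp_all
  show "j \<le> y \<Longrightarrow> y < m \<Longrightarrow> gaps n (x # rev [j..<m]) \<sigma> y = (if y = j then 0 else 1)"
    unfolding eq gaps tick_apply[of n x \<sigma> y]
    using top assms(2-4) by simp
  show "y + 1 = j \<Longrightarrow> gaps n (x # rev [j..<m]) \<sigma> y = Suc (\<sigma> y)"
    unfolding eq gaps tick_apply[of n x \<sigma> y]
    using top(1-3) assms(2-4) by (elim disjE) (simp_all add: nb)
  show "y + 1 < j \<Longrightarrow> gaps n (x # rev [j..<m]) \<sigma> y = \<sigma> y"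
    unfolding eq gaps tick_apply[of n x \<sigma> y]
    using top(1-3) assms(2-4) by (elim disjE) (simp_all add: nb)
  show "m \<le> y \<Longrightarrow> y \<noteq> x \<Longrightarrow> \<sigma> y \<le> gaps n (x # rev [j..<m]) \<sigma> y"
    unfolding eq gaps tick_apply[of n x \<sigma> y]
    using assms(2-4) by simp
  show "m + 1 = n \<Longrightarrow> x \<noteq> y \<Longrightarrow> y = m \<or> y = n \<Longrightarrow>
      gaps n (x # rev [j..<m]) \<sigma> y = (if j < m then Suc (\<sigma> y) else \<sigma> y)"
    unfolding eq gaps tick_apply[of n x \<sigma> y]
    using top(1-3) assms(2-4) by (elim disjE) (simp_all add: nb)
qed

text \<open>These are the canonical reduced words of type A on the letters 1 to m, one block at a
  time. The bound on \<open>i\<close> includes \<open>Suc (Suc m)\<close>, which stands for the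
  empty block.\<close>

primrec A_words :: "nat \<Rightarrow> nat list set" where
  "A_words 0 = {[]}"
| "A_words (Suc m) = {w @ rev [i..<Suc (Suc m)] | w i. w \<in> A_words m \<and> 1 \<le> i \<and> i \<le> Suc (Suc m)}"

lemma A_words_set: "w \<in> A_words m \<Longrightarrow> set w \<subseteq> {1..m}"
  by (induction m arbitrary: w) (fastforce+)

lemma rev_upt_Suc: "j \<le> m \<Longrightarrow> rev [j..<Suc m] = m # rev [j..<m]"
  by simp

lemma A_words_SucE:
  assumes "w \<in> A_words (Suc m)"
  obtains "w \<in> A_words m"
  | v i where "v \<in> A_words m" "w = v @ Suc m # rev [i..<Suc m]" "1 \<le> i" "i \<le> Suc m"
proof -
  from assms obtain v i where "v \<in> A_words m" "w = v @ rev [i..<Suc (Suc m)]" "1 \<le> i" "i \<le> Suc (Suc m)"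
    by auto
  then show ?thesis
    using that rev_upt_Suc[of i "Suc m"] by (cases "i = Suc (Suc m)") auto
qed

lemma A_words_SucI1: "w \<in> A_words m \<Longrightarrow> w \<in> A_words (Suc m)"
  by (auto intro!: exI[of _ w] exI[of _ "Suc (Suc m)"])

lemma A_words_SucI2:
  "w \<in> A_words m \<Longrightarrow> 1 \<le> i \<Longrightarrow> i \<le> Suc m \<Longrightarrow> w @ Suc m # rev [i..<Suc m] \<in> A_words (Suc m)"
  using rev_upt_Suc[of i "Suc m"] by (auto intro!: exI[of _ w] exI[of _ i])

lemma A_words_SucI:
  "w \<in> A_words m \<Longrightarrow> 1 \<le> i \<Longrightarrow> i \<le> Suc (Suc m) \<Longrightarrow> w @ rev [i..<Suc (Suc m)] \<in> A_words (Suc m)"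
  unfolding A_words.simps by blast

lemma A_words_SucD:
  "w \<in> A_words (Suc m) \<Longrightarrow>
     \<exists>v i. v \<in> A_words m \<and> w = v @ rev [i..<Suc (Suc m)] \<and> 1 \<le> i \<and> i \<le> Suc (Suc m)"
  unfolding A_words.simps by blast

declare A_words.simps(2) [simp del]

lemma prefixes_eq:
  assumes "m < n"
  shows "{concat (map (\<lambda>m. s_word n m (i m)) [1..<Suc m]) | i. \<forall>k\<in>{1..m}. 1 \<le> i k \<and> i k \<le> k + 1} =
    A_words m"
  using assms
proof (induction m)
  case (Suc m)
  let ?P = "\<lambda>m i. \<forall>k\<in>{1..m}. 1 \<le> i k \<and> i k \<le> k + (1::nat)"
  let ?c = "\<lambda>m i. concat (map (\<lambda>m. s_word n m (i m)) [1..<Suc m])"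
  have snoc: "?c (Suc m) i = ?c m i @ rev [i (Suc m)..<Suc (Suc m)]" for i
    using Suc.prems by (simp add: s_word_def)
  have IH: "{?c m i | i. ?P m i} = A_words m"
    using Suc by simp
  show ?case
  proof (rule subset_antisym; rule subsetI)
    fix w assume "w \<in> {?c (Suc m) i | i. ?P (Suc m) i}"
    then obtain i where i: "w = ?c (Suc m) i" "?P (Suc m) i" by blast
    then have "?c m i \<in> A_words m" unfolding IH[symmetric] by auto
    moreover have "1 \<le> i (Suc m)" "i (Suc m) \<le> Suc (Suc m)" using i(2) by auto
    ultimately show "w \<in> A_words (Suc m)" unfolding i(1) snoc by (rule A_words_SucI)
  next
    fix w assume "w \<in> A_words (Suc m)"
    then obtain v k where v: "v \<in> A_words m" "w = v @ rev [k..<Suc (Suc m)]" "1 \<le> k" "k \<le> Suc (Suc m)"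
      by (blast dest: A_words_SucD)
    then obtain i where i: "v = ?c m i" "?P m i" unfolding IH[symmetric] by blast
    let ?i = "i(Suc m := k)"
    have "?c m ?i = ?c m i" by (intro arg_cong[of _ _ concat] map_cong) auto
    then have "w = ?c (Suc m) ?i" unfolding snoc using v i by simp
    moreover have "?P (Suc m) ?i" using v i by auto
    ultimately show "w \<in> {?c (Suc m) i | i. ?P (Suc m) i}" by blast
  qed
qed simp

lemma prefixes_A_words: "1 \<le> n \<Longrightarrow> prefixes n = A_words (n - 1)"
  using prefixes_eq[of "n - 1" n] by (simp add: prefixes_def)

text \<open>A suffix built from its left end: the tops trade places at each block while all tails
  start at n - 2. For labels up to n - 1 no block is empty; the label n - 1 leaves the top
  alone.\<close>

fun alt_blocks :: "nat \<Rightarrow> nat \<Rightarrow> nat \<Rightarrow> nat list \<Rightarrow> nat list" where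
  "alt_blocks n x y [] = []"
| "alt_blocks n x y (j # js) = x # rev [j..<n - 1] @ alt_blocks n y x js"

lemma alt_blocks_snoc:
  "alt_blocks n x y (js @ [j]) =
     alt_blocks n x y js @ (if even (length js) then x else y) # rev [j..<n - 1]"
  by (induction js arbitrary: x y) auto

lemma suffix_word_eq:
  assumes "2 \<le> n" "set js \<subseteq> {1..n - 1}"
  shows "suffix_word n js = alt_blocks n n (n - 1) js"
proof -
  have s: "s_word n n j = n # rev [j..<n - 1]" "s_word n (n - 1) j = (n - 1) # rev [j..<n - 1]"
    if "j \<in> {1..n - 1}" for j
  proof -
    show "s_word n n j = n # rev [j..<n - 1]" using that by (auto simp: s_word_def)
    have "Suc (n - 1) = n" using assms by simp
    then show "s_word n (n - 1) j = (n - 1) # rev [j..<n - 1]"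
      using that rev_upt_Suc[of j "n - 1"] assms by (simp add: s_word_def)
  qed
  from assms(2) show ?thesis
  proof (induction js rule: rev_induct)
    case (snoc j js)
    have "suffix_word n (js @ [j]) = suffix_word n js @ s_word n (if even (length js) then n else n - 1) j"
    proof -
      let ?f = "\<lambda>js t. s_word n (if even t then n else n - 1) (js ! t)"
      have eq: "map (?f (js @ [j])) [0..<length js] = map (?f js) [0..<length js]"
        by (intro map_cong) (auto simp: nth_append)
      have "suffix_word n (js @ [j]) =
          concat (map (?f (js @ [j])) [0..<length js]) @ ?f (js @ [j]) (length js)"
        unfolding suffix_word_def by simp
      then show ?thesis unfolding eq by (simp add: suffix_word_def)
    qed
    with snoc s[of j] show ?case by (simp add: alt_blocks_snoc)
  qed (simp add: suffix_word_def)
qed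

lemma canonical_words_eq:
  assumes "2 \<le> n"
  shows "canonical_words n =
    {w0 @ alt_blocks n n (n - 1) js | w0 js. w0 \<in> A_words (n - 1) \<and> js \<in> suffix_labels n}"
proof -
  have "suffixes_D n = alt_blocks n n (n - 1) ` suffix_labels n"
    unfolding suffixes_D_def
    by (intro image_cong refl suffix_word_eq assms) (simp add: suffix_labels_def)
  then show ?thesis
    using assms by (auto simp: canonical_words_def prefixes_A_words)
qed

subsection \<open>Inserting a letter\<close>

lemma commute_below:
  assumes "block_top n x m" "y \<in> set (x # rev [j..<m])" "a + 1 < j" "j \<le> m"
  shows "commute n a y"
proof -
  have "y \<noteq> a" "2 \<le> n" using assms by (auto simp: block_top_def)
  moreover have "\<not> D_neighbors n a y"
    using assms \<open>2 \<le> n\<close> by (subst D_neighbors_iff_add) (auto simp: block_top_def)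
  ultimately show ?thesis by (simp add: commute_def)
qed

lemma move_past_block:
  assumes "block_top n x m" "a + 1 < j" "j \<le> m"
  shows "comm_equiv n (w @ (x # rev [j..<m]) @ [a]) (w @ a # x # rev [j..<m])"
  using comm_equiv_append[OF comm_equiv_move[of "x # rev [j..<m]" n a "[]"], of w "[]"]
    commute_below[OF assms(1) _ assms(2,3)] by simp

text \<open>After the block, its last letter has seen no neighbor since it was read, and each other
  letter just one, the letter following it in the block.\<close>

lemma gap_in_block:
  assumes "block_top n x m" "1 \<le> j" "j \<le> m" "a = x \<or> j \<le> a \<and> a < m"
  shows "\<not> gaps_ok n \<sigma> (w @ (x # rev [j..<m]) @ [a])"
proof -
  have "1 \<le> a" using assms by (auto simp: block_top_def)
  then have "gaps n (x # rev [j..<m]) (gaps n w \<sigma>) a \<le> 1"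
    using gaps_block(1,2)[OF assms(1-3), of a "gaps n w \<sigma>"] assms(4) by auto
  then show ?thesis by auto
qed

text \<open>The last letter \<open>i\<close> of a nonempty last block decides. A letter below i - 1
  passes the whole block, i - 1 prolongs it, and the letters from i up to the top are forbidden by
  \<open>gap_in_block\<close>.\<close>

lemma A_words_insert:
  assumes "m < n" "w \<in> A_words m" "1 \<le> a" "a \<le> m" "gaps_ok n \<sigma> (w @ [a])"
  shows "\<exists>w'\<in>A_words m. comm_equiv n (w @ [a]) w'"
  using assms
proof (induction m arbitrary: w)
  case (Suc m)
  have top: "block_top n (Suc m) (Suc m)" using Suc.prems by (simp add: block_top_def)
  from Suc.prems(2) show ?case
  proof (cases rule: A_words_SucE)
    case 1
    show ?thesis
    proof (cases "a = Suc m")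
      case True
      have "w @ [a] \<in> A_words (Suc m)"
        using A_words_SucI2[OF 1, of "Suc m"] True by simp
      then show ?thesis by blast
    next
      case False
      then show ?thesis
        using Suc.IH[OF _ 1] Suc.prems by (auto intro: A_words_SucI1)
    qed
  next
    case (2 v i)
    consider "a + 1 < i" | "a + 1 = i" | "i \<le> a" by linarith
    then show ?thesis
    proof cases
      case 1
      have move: "comm_equiv n (w @ [a]) ((v @ [a]) @ Suc m # rev [i..<Suc m])"
        using move_past_block[OF top 1, of v] 2 by simp
      then have "gaps_ok n \<sigma> (v @ [a])"
        using Suc.prems(5) gaps_ok_comm_equiv by fastforce
      then obtain v' where "v' \<in> A_words m" "comm_equiv n (v @ [a]) v'"
        using Suc.IH[OF _ 2(1)] Suc.prems 1 2 by auto
      with move 2 show ?thesis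
        by (meson A_words_SucI2 comm_equiv_appendR rtranclp_trans)
    next
      case 2: 2
      have "w @ [a] = v @ Suc m # rev [a..<Suc m]"
        using 2 \<open>w = _\<close> Suc.prems \<open>i \<le> Suc m\<close> rev_upt_snoc[of a "Suc m"] by simp
      then show ?thesis
        using A_words_SucI2[OF \<open>v \<in> _\<close>, of a] Suc.prems by auto
    next
      case 3
      have eq: "w @ [a] = v @ (Suc m # rev [i..<Suc m]) @ [a]"
        using \<open>w = _\<close> by simp
      have "\<not> gaps_ok n \<sigma> (w @ [a])"
        unfolding eq by (rule gap_in_block[OF top]) (use 2 3 Suc.prems(3,4) in auto)
      then have False
        using Suc.prems(5) by blast
      then show ?thesis ..
    qed
  qed
qed simp

lemma suffix_labels_snoc:
  "js @ [j] \<in> suffix_labels n \<longleftrightarrow> js \<in> suffix_labels n \<and> j \<in> {1..n - 1} \<and> (\<forall>i\<in>set js. i < j)"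
  by (auto simp: suffix_labels_def sorted_wrt_append)

lemma block_top_even: "2 \<le> n \<Longrightarrow> block_top n (if b then n else n - 1) (n - 1)"
  by (simp add: block_top_def)

lemma gaps_ok_last: "gaps_ok n \<sigma> (u @ v @ w @ [a]) \<Longrightarrow> 2 \<le> gaps n w (gaps n v (gaps n u \<sigma>)) a"
  by simp

text \<open>The clauses on \<open>js'\<close> serve to put the last block back in the induction:
  equal length preserves its top, and the bound on the labels keeps them below its label
  \<open>j\<close>.\<close>

lemma suffix_insert:
  assumes "2 \<le> n" "w0 \<in> A_words (n - 1)" "js \<in> suffix_labels n" "1 \<le> a" "a \<le> n - 2"
    "gaps_ok n \<sigma> (w0 @ alt_blocks n n (n - 1) js @ [a])"
  shows "\<exists>w0'\<in>A_words (n - 1). \<exists>js'\<in>suffix_labels n. length js' = length js \<and>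
    set js' \<subseteq> insert a (set js) \<and>
    comm_equiv n (w0 @ alt_blocks n n (n - 1) js @ [a]) (w0' @ alt_blocks n n (n - 1) js')"
  using assms(3-6)
proof (induction js arbitrary: a rule: rev_induct)
  case Nil
  then have "\<exists>w'\<in>A_words (n - 1). comm_equiv n (w0 @ [a]) w'"
    using assms(2) by (intro A_words_insert) auto
  then show ?case using Nil by force
next
  case (snoc j js)
  let ?S = "alt_blocks n n (n - 1)"
  define x where "x = (if even (length js) then n else n - 1)"
  have top: "block_top n x (n - 1)" using assms(1) unfolding x_def by (rule block_top_even)
  have js: "js \<in> suffix_labels n" "1 \<le> j" "j \<le> n - 1" "\<forall>i\<in>set js. i < j"
    using snoc.prems(1) by (auto simp: suffix_labels_snoc)
  have S: "?S (js @ [j]) = ?S js @ x # rev [j..<n - 1]"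
    by (simp add: alt_blocks_snoc x_def)
  consider "a + 1 < j" | "a + 1 = j" | "j \<le> a" by linarith
  then show ?case
  proof cases
    case 1
    have move: "comm_equiv n (w0 @ ?S (js @ [j]) @ [a]) ((w0 @ ?S js @ [a]) @ x # rev [j..<n - 1])"
      using move_past_block[OF top 1, of "w0 @ ?S js"] js S by simp
    then have "gaps_ok n \<sigma> (w0 @ ?S js @ [a])"
      using snoc.prems(4) gaps_ok_comm_equiv gaps_ok_append by blast
    from snoc.IH[OF js(1) snoc.prems(2,3) this] obtain w0' js' where IH:
      "w0' \<in> A_words (n - 1)" "js' \<in> suffix_labels n" "length js' = length js"
      "set js' \<subseteq> insert a (set js)" "comm_equiv n (w0 @ ?S js @ [a]) (w0' @ ?S js')"
      by blast
    have "comm_equiv n (w0 @ ?S (js @ [j]) @ [a]) ((w0' @ ?S js') @ x # rev [j..<n - 1])"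
      using move comm_equiv_appendR[OF IH(5)] by (rule rtranclp_trans)
    also have "(w0' @ ?S js') @ x # rev [j..<n - 1] = w0' @ ?S (js' @ [j])"
      using IH(3) by (simp add: alt_blocks_snoc x_def)
    finally show ?thesis
      using IH js 1 by (intro bexI[of _ w0'] bexI[of _ "js' @ [j]"]) (auto simp: suffix_labels_snoc)
  next
    case 2
    have eq: "w0 @ ?S (js @ [j]) @ [a] = w0 @ ?S (js @ [a])"
      using 2 snoc.prems rev_upt_snoc[of a "n - 1"] by (simp add: alt_blocks_snoc)
    \<comment> \<open>Were \<open>a\<close> a label already, it would be the preceding one. Then
      \<open>a\<close> ends the preceding block and sees a single neighbor in the last one, so it
      could not be read again.\<close>
    have "a \<notin> set js"
    proof
      assume a: "a \<in> set js"
      then obtain js0 k where k: "js = js0 @ [k]" by (metis empty_iff empty_set rev_exhaust)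
      then have ka: "k = a" using a js 2 by (fastforce simp: suffix_labels_snoc)
      define y where "y = (if even (length js0) then n else n - 1)"
      have topy: "block_top n y (n - 1)" using assms(1) unfolding y_def by (rule block_top_even)
      let ?\<sigma> = "gaps n (y # rev [a..<n - 1]) (gaps n (w0 @ ?S js0) \<sigma>)"
      have "?\<sigma> a = 0"
        using gaps_block(2)[OF topy, of a a] snoc.prems by simp
      then have "gaps n (x # rev [j..<n - 1]) ?\<sigma> a = 1"
        using gaps_block(3)[OF top, of j a ?\<sigma>] 2 snoc.prems js by simp
      moreover have "w0 @ ?S (js @ [j]) @ [a] =
          (w0 @ ?S js0) @ (y # rev [a..<n - 1]) @ (x # rev [j..<n - 1]) @ [a]"
        using S k ka by (simp add: alt_blocks_snoc y_def)
      ultimately show False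
        using gaps_ok_last[of n \<sigma> "w0 @ ?S js0" "y # rev [a..<n - 1]" "x # rev [j..<n - 1]" a]
          snoc.prems(4) by (metis Suc_1 not_less_eq_eq order_refl)
    qed
    then have "i < a" if "i \<in> set js" for i
      using that js(4) 2 by (metis less_Suc_eq Suc_eq_plus1)
    then have "js @ [a] \<in> suffix_labels n"
      using js(1) 2 snoc.prems by (auto simp: suffix_labels_snoc)
    then show ?thesis
      unfolding eq using assms(2) by (intro bexI[of _ w0] bexI[of _ "js @ [a]"]) auto
  next
    case 3
    moreover have "a < n - 1" using snoc.prems(2,3) by linarith
    ultimately have False
      using gap_in_block[OF top js(2,3), of a \<sigma> "w0 @ ?S js"] S snoc.prems(4) by auto
    then show ?thesis ..
  qed
qed

text \<open>The letters n - 1 and n are treated apart from \<open>suffix_insert\<close> because only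
  they can open a new suffix block.\<close>

lemma canonical_insert:
  assumes "3 \<le> n" "w \<in> canonical_words n" "1 \<le> a" "a \<le> n" "gaps_ok n \<sigma> (w @ [a])"
  shows "\<exists>w'\<in>canonical_words n. comm_equiv n (w @ [a]) w'"
proof -
  let ?S = "alt_blocks n n (n - 1)"
  have canon: "w0 @ ?S js \<in> canonical_words n" if "w0 \<in> A_words (n - 1)" "js \<in> suffix_labels n" for w0 js
    using that assms(1) by (auto simp: canonical_words_eq)
  from assms obtain w0 js where w: "w0 \<in> A_words (n - 1)" "js \<in> suffix_labels n" "w = w0 @ ?S js"
    by (auto simp: canonical_words_eq)
  have labels: "n - 1 \<in> {1..n - 1}" using assms(1) by simp
  show ?thesis
  proof (cases "a \<le> n - 2")
    case True
    then show ?thesis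
      using suffix_insert[OF _ w(1,2) assms(3) True, of \<sigma>] assms(1,5) w(3) canon by fastforce
  next
    case False
    then have a: "a = n - 1 \<or> a = n" using assms by linarith
    show ?thesis
    proof (cases js rule: rev_cases)
      case Nil
      show ?thesis
      proof (cases "a = n")
        case True
        have "[n - 1] \<in> suffix_labels n" using labels by (simp add: suffix_labels_def)
        then show ?thesis using canon[OF w(1), of "[n - 1]"] w Nil True by auto
      next
        case False
        then have "\<exists>w'\<in>A_words (n - 1). comm_equiv n (w0 @ [a]) w'"
          using a assms w Nil by (intro A_words_insert[of _ _ _ _ \<sigma>]) auto
        then show ?thesis using canon[of _ "[]"] w(2,3) Nil by auto
      qed
    next
      case (snoc js0 j)
      define x where "x = (if even (length js0) then n else n - 1)"
      have top: "block_top n x (n - 1)" using assms(1) unfolding x_def by (intro block_top_even) simp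
      have js: "js0 \<in> suffix_labels n" "1 \<le> j" "j \<le> n - 1" "\<forall>i\<in>set js0. i < j"
        using w(2) snoc by (auto simp: suffix_labels_snoc)
      have S: "w = (w0 @ ?S js0) @ x # rev [j..<n - 1]"
        using w snoc by (simp add: alt_blocks_snoc x_def)
      have "a \<noteq> x"
        using gap_in_block[OF top js(2,3), of a \<sigma> "w0 @ ?S js0"] S assms(5) by auto
      then have next_top: "a = (if even (length js) then n else n - 1)"
        using a snoc unfolding x_def by auto
      show ?thesis
      proof (cases "j = n - 1")
        case False
        then have "js @ [n - 1] \<in> suffix_labels n"
          unfolding suffix_labels_snoc[of js] using w(2) js labels snoc by fastforce
        then have "w0 @ ?S (js @ [n - 1]) \<in> canonical_words n" by (rule canon[OF w(1)])
        moreover have "w0 @ ?S (js @ [n - 1]) = w @ [a]"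
          using w next_top by (simp add: alt_blocks_snoc)
        ultimately show ?thesis by auto
      next
        case jn: True
        show ?thesis
        proof (cases js0 rule: rev_cases)
          case Nil
          then have a': "a = n - 1" "x = n" using a \<open>a \<noteq> x\<close> by (auto simp: x_def)
          \<comment> \<open>The suffix is \<open>[n]\<close> alone here. The two letters n - 1 and n
            commute, so n - 1 slips in front of it and is inserted into the prefix.\<close>
          have "commute n n a"
            using a' assms(1) by (auto simp: commute_def D_neighbors_iff)
          then have sw: "comm_equiv n (w0 @ [n, a]) (w0 @ [a, n])"
            using comm_step.swap[of n n a w0 "[]"] by auto
          have wa: "w @ [a] = w0 @ [n, a]" using S jn Nil a' by simp
          then have "gaps_ok n \<sigma> ((w0 @ [a]) @ [n])"
            using gaps_ok_comm_equiv[OF sw] assms(5) by simp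
          then have "\<exists>w'\<in>A_words (n - 1). comm_equiv n (w0 @ [a]) w'"
            unfolding gaps_ok_append[of n \<sigma> "w0 @ [a]"]
            using a' assms w by (intro A_words_insert[of _ _ _ _ \<sigma>]) auto
          then obtain w' where w': "w' \<in> A_words (n - 1)" "comm_equiv n (w0 @ [a]) w'" by blast
          have "[n - 1] \<in> suffix_labels n" using labels by (simp add: suffix_labels_def)
          from canon[OF w'(1) this] have "w' @ [n] \<in> canonical_words n" by simp
          moreover have "comm_equiv n (w0 @ [n, a]) (w' @ [n])"
            using sw comm_equiv_appendR[OF w'(2), of "[n]"] by simp
          ultimately show ?thesis unfolding wa by blast
        next
          case js0: (snoc js1 i)
          have i: "1 \<le> i" "i < n - 1"
            using js js0 jn by (auto simp: suffix_labels_snoc)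
          have topa: "block_top n a (n - 1)" and wa: "w @ [a] = (w0 @ ?S js1) @ (a # rev [i..<n - 1]) @ [x] @ [a]"
            using next_top S jn js0 snoc assms(1) block_top_even[of n "even (length js)"]
            by (simp_all add: alt_blocks_snoc)
          \<comment> \<open>The block before the last has top \<open>a\<close>. Since then only its
            letter n - 2 was a neighbor of \<open>a\<close>, because the last block is just
            \<open>[x]\<close> and n - 1 and n are not neighbors.\<close>
          let ?\<sigma> = "gaps n (a # rev [i..<n - 1]) (gaps n (w0 @ ?S js1) \<sigma>)"
          have "?\<sigma> a = 1"
            using gaps_block(1)[OF topa i(1), of a] i assms(3) by simp
          moreover have "\<not> D_neighbors n x a"
            using a assms(1) by (auto simp: x_def D_neighbors_iff)
          ultimately have "gaps n [x] ?\<sigma> a = 1"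
            using \<open>a \<noteq> x\<close> tick_apply[of n x ?\<sigma> a] by simp
          then have False
            using gaps_ok_last[of n \<sigma> "w0 @ ?S js1" "a # rev [i..<n - 1]" "[x]" a] assms(5) wa
            by (metis Suc_1 not_less_eq_eq order_refl)
          then show ?thesis ..
        qed
      qed
    qed
  qed
qed

lemma homogeneous_word_canonical:
  assumes "3 \<le> n" "homogeneous_word n u" "set u \<subseteq> {1..n}"
  shows "\<exists>w\<in>homogeneous_canonical n. comm_equiv n u w"
proof -
  have "\<exists>w\<in>canonical_words n. comm_equiv n u w"
    using assms(2,3)
  proof (induction u rule: rev_induct)
    case Nil
    have "[] \<in> A_words m" for m
      by (induction m) (auto intro: A_words_SucI1)
    then have "[] \<in> canonical_words n"
      using assms(1) by (auto simp: canonical_words_eq suffix_labels_def intro!: exI[of _ "[]"])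
    then show ?case by blast
  next
    case (snoc a u)
    then obtain w where w: "w \<in> canonical_words n" "comm_equiv n u w"
      by (auto simp: homogeneous_word_iff)
    then have ua: "comm_equiv n (u @ [a]) (w @ [a])"
      by (intro comm_equiv_appendR)
    then have "gaps_ok n fresh (w @ [a])"
      using snoc.prems gaps_ok_comm_equiv homogeneous_word_iff by blast
    then show ?case
      using canonical_insert[OF assms(1) w(1), of a fresh] snoc.prems ua
      by (auto intro: rtranclp_trans)
  qed
  then show ?thesis
    using assms(2) homogeneous_word_comm_equiv unfolding homogeneous_canonical_def by blast
qed

section \<open>Uniqueness of canonical words\<close>

text \<open>
  Canonical words are lexicographic normal forms of their commutation classes in the sense of
  Anisimov and Knuth.
\<close>

definition lex_normal :: "nat \<Rightarrow> nat list \<Rightarrow> bool" where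
  "lex_normal n w \<longleftrightarrow>
     (\<forall>p b u a q. w = p @ b # u @ a # q \<and> a < b \<longrightarrow> (\<exists>c\<in>set (b # u). \<not> commute n c a))"

lemma lex_normal_snoc:
  assumes "lex_normal n w"
    and "\<And>p b u. w = p @ b # u \<Longrightarrow> a < b \<Longrightarrow> \<exists>c\<in>set (b # u). \<not> commute n c a"
  shows "lex_normal n (w @ [a])"
  unfolding lex_normal_def
proof (intro allI impI)
  fix p b u a' q assume *: "w @ [a] = p @ b # u @ a' # q \<and> a' < b"
  show "\<exists>c\<in>set (b # u). \<not> commute n c a'"
  proof (cases q rule: rev_cases)
    case Nil
    then have "w = p @ b # u" "a' = a" using * by (simp_all flip: append_Cons append_assoc)
    then show ?thesis using assms(2) * by blast
  next
    case (snoc q' z)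
    then have "w @ [a] = (p @ b # u @ a' # q') @ [z]" using * by simp
    then have "w = p @ b # u @ a' # q'" unfolding append1_eq_conv by blast
    then show ?thesis using assms(1) * unfolding lex_normal_def by blast
  qed
qed

lemma lex_normal_Cons: "lex_normal n (x # w) \<Longrightarrow> lex_normal n w"
  unfolding lex_normal_def by (metis append_Cons)

text \<open>Any factor that ends just before the new letter contains \<open>c\<close>, which blocks
  the new letter.\<close>

lemma lex_normal_snoc_descent:
  assumes "lex_normal n (w @ [c])" "\<not> commute n c a"
  shows "lex_normal n (w @ [c, a])"
proof -
  have "lex_normal n ((w @ [c]) @ [a])"
  proof (rule lex_normal_snoc[OF assms(1)])
    fix p b u assume "w @ [c] = p @ b # u"
    then have "c = last (b # u)" by (metis last_appendR last_snoc list.distinct(1))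
    then have "c \<in> set (b # u)" by (metis last_in_set list.distinct(1))
    then show "\<exists>c\<in>set (b # u). \<not> commute n c a" using assms(2) by blast
  qed
  then show ?thesis by simp
qed

lemma lex_normal_block:
  assumes "block_top n x m" "1 \<le> j" "j \<le> m" "lex_normal n (w @ [x])"
  shows "lex_normal n (w @ x # rev [j..<m])"
  using assms(3,2)
proof (induction j rule: inc_induct)
  case base
  then show ?case using assms(4) by simp
next
  case (step j)
  have IH: "lex_normal n (w @ x # rev [Suc j..<m])" by (rule step.IH) simp
  have snoc: "w @ x # rev [j..<m] = w @ x # rev [Suc j..<m] @ [j]"
    using step.hyps by (simp add: rev_upt_snoc)
  show ?case
  proof (cases "Suc j < m")
    case True
    have rev: "rev [Suc j..<m] = rev [Suc (Suc j)..<m] @ [Suc j]"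
      using True by (rule rev_upt_snoc)
    have nc: "\<not> commute n (Suc j) j"
      using True step.prems assms(1) by (auto simp: commute_def D_neighbors_iff_add block_top_def)
    have "lex_normal n ((w @ x # rev [Suc (Suc j)..<m]) @ [Suc j])"
      using IH unfolding rev by simp
    from lex_normal_snoc_descent[OF this nc] show ?thesis
      unfolding snoc rev by simp
  next
    case False
    then have m: "m = Suc j" using step.hyps by simp
    have "\<not> commute n x j"
      using block_top_neighbor[OF assms(1), of j] step.prems m by (simp add: commute_def)
    from lex_normal_snoc_descent[OF assms(4) this] show ?thesis
      unfolding snoc using m by simp
  qed
qed

lemma lex_normal_A_words: "m < n \<Longrightarrow> w \<in> A_words m \<Longrightarrow> lex_normal n w"
proof (induction m arbitrary: w)
  case 0
  then show ?case by (simp add: lex_normal_def)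
next
  case (Suc m)
  from Suc.prems(2) show ?case
  proof (cases rule: A_words_SucE)
    case 1
    then show ?thesis using Suc by simp
  next
    case (2 v i)
    have "lex_normal n (v @ [Suc m])"
    proof (rule lex_normal_snoc)
      show "lex_normal n v" using Suc 2 by simp
      fix p b u assume "v = p @ b # u" "Suc m < b"
      then show "\<exists>c\<in>set (b # u). \<not> commute n c (Suc m)"
        using A_words_set[OF 2(1)] by auto
    qed
    then show ?thesis
      unfolding \<open>w = _\<close> using 2 Suc.prems by (intro lex_normal_block) (auto simp: block_top_def)
  qed
qed

text \<open>A letter \<open>b\<close> that is missing from the end \<open>r\<close> occurs before
  it, so what follows this \<open>b\<close> contains all of \<open>r\<close>.\<close>

lemma set_suffix_subset:
  assumes "p @ b # u = v @ r" "b \<notin> set r"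
  shows "set r \<subseteq> set u"
proof -
  from assms(1) consider us where "us @ b # u = r" | us where "b # u = us @ r"
    by (auto simp: append_eq_append_conv2)
  then show ?thesis
    using assms(2) by cases (auto simp: Cons_eq_append_conv)
qed

lemma alt_blocks_set: "z \<in> set (alt_blocks n x y js) \<Longrightarrow> z = x \<or> z = y \<or> z < n - 1"
  by (induction js arbitrary: x y) fastforce+

lemma lex_normal_canonical:
  assumes "3 \<le> n" "w \<in> canonical_words n"
  shows "lex_normal n w"
proof -
  let ?S = "alt_blocks n n (n - 1)"
  from assms obtain w0 js where w: "w0 \<in> A_words (n - 1)" "js \<in> suffix_labels n" "w = w0 @ ?S js"
    by (auto simp: canonical_words_eq)
  have le_n: "b \<le> n" if "b \<in> set (w0 @ ?S js)" for b js
    using that A_words_set[OF w(1)] alt_blocks_set[of b n n "n - 1" js] by fastforce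
  have "lex_normal n (w0 @ ?S js)" using w(2)
  proof (induction js rule: rev_induct)
    case Nil
    then show ?case using lex_normal_A_words[OF _ w(1)] assms(1) by simp
  next
    case (snoc j js)
    define x where "x = (if even (length js) then n else n - 1)"
    have top: "block_top n x (n - 1)" using assms(1) unfolding x_def by (intro block_top_even) simp
    have js: "js \<in> suffix_labels n" "1 \<le> j" "j \<le> n - 1" "\<forall>i\<in>set js. i < j"
      using snoc.prems by (auto simp: suffix_labels_snoc)
    have "lex_normal n ((w0 @ ?S js) @ [x])"
    proof (rule lex_normal_snoc)
      show "lex_normal n (w0 @ ?S js)" using snoc js by simp
      fix p b u assume split: "w0 @ ?S js = p @ b # u" and "x < b"
      \<comment> \<open>Only the top n - 1 can have a larger letter before it, and this letter is n.
        The last block then has top n and contains n - 2, which lies between the two and does not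
        commute with n - 1.\<close>
      have "b \<le> n" using le_n[of b js] unfolding split by simp
      then have x: "x = n - 1" "b = n" "odd (length js)"
        using \<open>x < b\<close> unfolding x_def by (auto split: if_splits)
      then obtain js0 i where i: "js = js0 @ [i]" by (metis even_zero list.size(3) rev_exhaust)
      have i': "1 \<le> i" "i \<le> n - 2" using js i by (auto simp: suffix_labels_snoc)
      have "w0 @ ?S js = (w0 @ ?S js0 @ [n]) @ rev [i..<n - 1]"
        using x(3) i by (simp add: alt_blocks_snoc)
      moreover have "b \<notin> set (rev [i..<n - 1])" using x(2) assms(1) by auto
      ultimately have "set (rev [i..<n - 1]) \<subseteq> set u"
        unfolding split by (rule set_suffix_subset)
      then have "n - 2 \<in> set u" using i' assms(1) by auto
      moreover have "\<not> commute n (n - 2) x"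
        using x(1) assms(1) by (auto simp: commute_def D_neighbors_iff_add)
      ultimately show "\<exists>c\<in>set (b # u). \<not> commute n c x" by auto
    qed
    then have "lex_normal n ((w0 @ ?S js) @ x # rev [j..<n - 1])"
      using top js by (intro lex_normal_block)
    then show ?case unfolding alt_blocks_snoc x_def append_assoc .
  qed
  then show ?thesis using w by simp
qed

text \<open>
  Commutation classes are compared through the projections of words to pairs of letters that do not
  commute: for these, cancelling a common first letter is immediate.
\<close>

abbreviation pair_proj :: "nat \<Rightarrow> nat \<Rightarrow> nat list \<Rightarrow> nat list" where
  "pair_proj x y \<equiv> filter (\<lambda>z. z = x \<or> z = y)"

lemma pair_proj_comm_equiv:
  assumes "comm_equiv n u v" "\<not> commute n x y"
  shows "pair_proj x y u = pair_proj x y v"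
  using assms(1)
proof (induction rule: rtranclp_induct)
  case (step v w)
  from step.hyps(2) have "pair_proj x y v = pair_proj x y w"
  proof cases
    case (swap a b p q)
    then show ?thesis using assms(2) commute_sym[of n a b] by (auto simp: commute_def)
  qed
  with step.IH show ?case by simp
qed simp

text \<open>If \<open>a < b\<close>, normality puts before the first \<open>a\<close> of
  \<open>b # v\<close> some letter \<open>c\<close> that does not commute with \<open>a\<close>. The
  projection of \<open>b # v\<close> to this pair then starts with \<open>c\<close>, that of
  \<open>a # u\<close> with \<open>a\<close>. Pairs with equal entries are included, which shows
  that \<open>a\<close> occurs in \<open>b # v\<close> at all.\<close>

lemma lex_normal_head_le:
  assumes "lex_normal n (b # v)" "\<And>x y. \<not> commute n x y \<Longrightarrow> pair_proj x y (a # u) = pair_proj x y (b # v)"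
  shows "b \<le> a"
proof (rule ccontr)
  assume "\<not> b \<le> a"
  then have ab: "a < b" by simp
  have "\<not> commute n a a" by (simp add: commute_def)
  then have "pair_proj a a (a # u) = pair_proj a a (b # v)" by (rule assms(2))
  moreover have "a \<in> set (pair_proj a a (a # u))" by simp
  ultimately have "a \<in> set (pair_proj a a (b # v))" by (simp only:)
  then have "a \<in> set (b # v)" unfolding set_filter by blast
  then obtain p q where pq: "b # v = p @ a # q" "a \<notin> set p" by (meson split_list_first)
  then obtain p' where p': "p = b # p'" using ab by (cases p) auto
  then have "b # v = [] @ b # p' @ a # q" using pq by simp
  then obtain c where c: "c \<in> set (b # p')" "\<not> commute n c a"
    using assms(1) ab unfolding lex_normal_def by blast
  have "pair_proj c a (a # u) = pair_proj c a (p @ a # q)"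
    using assms(2)[OF c(2)] pq(1) by simp
  moreover have "pair_proj c a p \<noteq> []" using c(1) p' by (auto simp: filter_empty_conv)
  ultimately have "hd (pair_proj c a p) = a" by (cases "pair_proj c a p") auto
  moreover have "hd (pair_proj c a p) \<in> set (pair_proj c a p)"
    using \<open>pair_proj c a p \<noteq> []\<close> by (rule hd_in_set)
  ultimately show False using pq(2) by simp
qed

lemma lex_normal_unique:
  assumes "lex_normal n u" "lex_normal n v"
    and "\<And>x y. \<not> commute n x y \<Longrightarrow> pair_proj x y u = pair_proj x y v"
  shows "u = v"
  using assms
proof (induction u arbitrary: v)
  case Nil
  have "pair_proj x x v = []" for x
    using Nil.prems(3)[of x x] by (simp add: commute_def)
  then have "pair_proj (hd v) (hd v) v = []" .
  then show ?case by (cases v) simp_all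
next
  case (Cons a u)
  have "pair_proj a a v = a # pair_proj a a u"
    using Cons.prems(3)[of a a, symmetric] by (simp add: commute_def)
  then obtain b v' where v: "v = b # v'" by (cases v) auto
  have "b \<le> a"
    using lex_normal_head_le[of n b v' a u] Cons.prems(2,3) v by simp
  moreover have "a \<le> b"
    using lex_normal_head_le[of n a u b v'] Cons.prems(1,3) v by simp
  ultimately have ab: "a = b" by simp
  have "u = v'"
  proof (rule Cons.IH)
    show "lex_normal n u" "lex_normal n v'"
      using Cons.prems v lex_normal_Cons by blast+
    show "pair_proj x y u = pair_proj x y v'" if "\<not> commute n x y" for x y
      using Cons.prems(3)[OF that] v ab by (auto split: if_splits)
  qed
  then show ?case using v ab by simp
qed

lemma canonical_unique:
  assumes "3 \<le> n" "w \<in> canonical_words n" "w' \<in> canonical_words n" "comm_equiv n w w'"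
  shows "w = w'"
  by (rule lex_normal_unique[OF lex_normal_canonical[OF assms(1,2)]
        lex_normal_canonical[OF assms(1,3)] pair_proj_comm_equiv[OF assms(4)]])

section \<open>Counting\<close>

lemma gaps_unused: "y \<notin> set w \<Longrightarrow> \<sigma> y \<le> gaps n w \<sigma> y"
proof (induction w arbitrary: \<sigma>)
  case (Cons x w)
  have "\<sigma> y \<le> tick n x \<sigma> y" using Cons.prems by (simp add: tick_apply)
  also have "\<dots> \<le> gaps n w (tick n x \<sigma>) y" using Cons by simp
  finally show ?case by simp
qed simp

lemma gaps_A_words: "w \<in> A_words m \<Longrightarrow> m < y \<Longrightarrow> 2 \<le> gaps n w fresh y"
  using gaps_unused[of y w fresh n] A_words_set[of w m] by fastforce

text \<open>
  The smallest letters of the nonempty blocks of a homogeneous prefix increase strictly, and the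
  largest of them is the largest letter with counter 0. So the words below are the homogeneous
  prefixes all of whose blocks end in a letter at most \<open>t\<close>.
\<close>

definition zeros_le :: "nat \<Rightarrow> nat \<Rightarrow> nat \<Rightarrow> nat list set" where
  "zeros_le n m t = {w \<in> A_words m. gaps_ok n fresh w \<and> (\<forall>y>t. 1 \<le> gaps n w fresh y)}"

text \<open>The top is new to \<open>v\<close> and may be read freely; each letter of the tail
  requires a nonzero counter. As letters above m never have counter 0, this says that all zeros of
  \<open>v\<close> lie below \<open>i\<close>.\<close>

lemma gaps_ok_A_block:
  assumes "v \<in> A_words m" "Suc m < n" "1 \<le> i" "i \<le> Suc m"
  shows "gaps_ok n fresh (v @ Suc m # rev [i..<Suc m]) \<longleftrightarrow> v \<in> zeros_le n m (i - 1)"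
proof -
  have top: "block_top n (Suc m) (Suc m)" using assms(2) by (simp add: block_top_def)
  have "gaps_ok n fresh (v @ Suc m # rev [i..<Suc m]) \<longleftrightarrow> gaps_ok n fresh v \<and>
      2 \<le> gaps n v fresh (Suc m) \<and> (\<forall>y\<in>{i..<Suc m}. 1 \<le> gaps n v fresh y)"
    unfolding gaps_ok_append gaps_ok_block[OF top assms(3,4)] by blast
  also have "2 \<le> gaps n v fresh (Suc m) \<longleftrightarrow> True"
    using gaps_A_words[OF assms(1)] by simp
  also have "(\<forall>y\<in>{i..<Suc m}. 1 \<le> gaps n v fresh y) \<longleftrightarrow> (\<forall>y>i - 1. 1 \<le> gaps n v fresh y)"
  proof -
    have "1 \<le> gaps n v fresh y" if "Suc m \<le> y" for y
      using gaps_A_words[OF assms(1), of y n] that by simp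
    then show ?thesis using assms(3) by (metis One_nat_def Suc_le_eq Suc_pred atLeastLessThan_iff le_less_linear less_Suc_eq_le)
  qed
  finally show ?thesis using assms(1) by (simp add: zeros_le_def)
qed

text \<open>A nonempty new block makes its smallest letter \<open>i\<close> the largest zero: it has
  counter 0, and the letters of the block above it have counter 1. So the bound \<open>t\<close>
  turns into a bound on \<open>i\<close>, and the older zeros are bounded by i - 1.\<close>

lemma zeros_le_Suc:
  assumes "Suc m < n"
  shows "zeros_le n (Suc m) t = zeros_le n m t \<union>
    (\<Union>i\<in>{1..min t (Suc m)}. (\<lambda>w. w @ Suc m # rev [i..<Suc m]) ` zeros_le n m (i - 1))"
proof -
  have top: "block_top n (Suc m) (Suc m)" using assms by (simp add: block_top_def)
  have gap: "(\<forall>y>t. 1 \<le> gaps n (v @ Suc m # rev [i..<Suc m]) fresh y) \<longleftrightarrow> i \<le> t"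
    if v: "v \<in> A_words m" and i: "1 \<le> i" "i \<le> Suc m" for v i
  proof
    note block = gaps_block[OF top i, where \<sigma> = "gaps n v fresh"]
    assume *: "\<forall>y>t. 1 \<le> gaps n (v @ Suc m # rev [i..<Suc m]) fresh y"
    have "gaps n (Suc m # rev [i..<Suc m]) (gaps n v fresh) i = 0"
      using block(1)[of i] block(2)[of i] i by (cases "i = Suc m") auto
    then have "gaps n (v @ Suc m # rev [i..<Suc m]) fresh i = 0"
      unfolding fold_append comp_apply .
    with * show "i \<le> t" by (metis not_le not_one_le_zero)
  next
    note block = gaps_block[OF top i, where \<sigma> = "gaps n v fresh"]
    assume "i \<le> t"
    show "\<forall>y>t. 1 \<le> gaps n (v @ Suc m # rev [i..<Suc m]) fresh y"
    proof (intro allI impI)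
      fix y assume "t < y"
      then have y: "i < y" "1 \<le> y" using \<open>i \<le> t\<close> by auto
      have "1 \<le> gaps n (Suc m # rev [i..<Suc m]) (gaps n v fresh) y"
      proof -
        consider "y = Suc m" | "y < Suc m" | "Suc m < y" by linarith
        then show ?thesis
        proof cases
          case 1
          then show ?thesis using block(1)[of y] y by simp
        next
          case 2
          then show ?thesis using block(2)[of y] y by simp
        next
          case 3
          then show ?thesis using block(5)[of y] gaps_A_words[OF v, of y n] y by linarith
        qed
      qed
      then show "1 \<le> gaps n (v @ Suc m # rev [i..<Suc m]) fresh y"
        unfolding fold_append comp_apply .
    qed
  qed
  show ?thesis (is "?L = ?R")
  proof (rule subset_antisym; rule subsetI)
    fix w assume w: "w \<in> ?L"
    then have "w \<in> A_words (Suc m)" by (simp add: zeros_le_def)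
    then show "w \<in> ?R"
    proof (cases rule: A_words_SucE)
      case 1
      then show ?thesis using w by (simp add: zeros_le_def)
    next
      case (2 v i)
      have "v \<in> zeros_le n m (i - 1)" "i \<le> t"
        using w gaps_ok_A_block[OF 2(1) assms 2(3,4)] gap[OF 2(1,3,4)]
        unfolding zeros_le_def \<open>w = _\<close> by blast+
      then show ?thesis using 2 by auto
    qed
  next
    fix w assume "w \<in> ?R"
    then consider "w \<in> zeros_le n m t" | i v where "1 \<le> i" "i \<le> t" "i \<le> Suc m"
        "v \<in> zeros_le n m (i - 1)" "w = v @ Suc m # rev [i..<Suc m]"
      by auto
    then show "w \<in> ?L"
    proof cases
      case 1
      then show ?thesis by (auto simp: zeros_le_def A_words_SucI1)
    next
      case 2
      have v: "v \<in> A_words m" using 2 by (simp add: zeros_le_def)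
      have "w \<in> A_words (Suc m)" unfolding \<open>w = _\<close> using v 2 by (intro A_words_SucI2)
      moreover have "gaps_ok n fresh w"
        unfolding \<open>w = _\<close> using gaps_ok_A_block[OF v assms 2(1,3)] 2 by blast
      moreover have "\<forall>y>t. 1 \<le> gaps n w fresh y"
        unfolding \<open>w = _\<close> using gap[OF v 2(1,3)] 2 by blast
      ultimately show ?thesis by (simp add: zeros_le_def)
    qed
  qed
qed

lemma finite_A_words: "finite (A_words m)"
proof (induction m)
  case (Suc m)
  have "A_words (Suc m) \<subseteq> (\<lambda>(w, i). w @ rev [i..<Suc (Suc m)]) ` (A_words m \<times> {1..Suc (Suc m)})"
  proof
    fix w assume "w \<in> A_words (Suc m)"
    then obtain v i where "v \<in> A_words m" "w = v @ rev [i..<Suc (Suc m)]" "1 \<le> i" "i \<le> Suc (Suc m)"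
      by (blast dest: A_words_SucD)
    then show "w \<in> (\<lambda>(w, i). w @ rev [i..<Suc (Suc m)]) ` (A_words m \<times> {1..Suc (Suc m)})"
      by (intro image_eqI[of _ _ "(v, i)"]) auto
  qed
  then show ?case using Suc by (auto intro: finite_subset)
qed simp

lemma finite_zeros_le: "finite (zeros_le n m t)"
  using finite_A_words[of m] by (simp add: zeros_le_def)

text \<open>The letter \<open>Suc m\<close> does not occur in members of \<open>A_words m\<close>,
  so its first occurrence marks the start of the last block.\<close>

lemma append_Suc_inject:
  assumes "v \<in> A_words m" "v' \<in> A_words m" "v @ Suc m # r = v' @ Suc m # r'"
  shows "v = v' \<and> r = r'"
proof -
  have "takeWhile (\<lambda>z. z \<noteq> Suc m) (u @ Suc m # s) = u" if "u \<in> A_words m" for u s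
    using A_words_set[OF that] by (subst takeWhile_append2) auto
  then have "v = v'" using assms by metis
  then show ?thesis using assms by simp
qed

lemma card_zeros_le_Suc:
  assumes "Suc m < n"
  shows "card (zeros_le n (Suc m) t) =
    card (zeros_le n m t) + (\<Sum>i\<in>{1..min t (Suc m)}. card (zeros_le n m (i - 1)))"
proof -
  let ?I = "{1..min t (Suc m)}"
  let ?f = "\<lambda>(i, w). w @ Suc m # rev [i..<Suc m]"
  let ?\<Sigma> = "Sigma ?I (\<lambda>i. zeros_le n m (i - 1))"
  have A: "w \<in> A_words m" if "w \<in> zeros_le n m s" for w s
    using that by (simp add: zeros_le_def)
  have img: "(\<Union>i\<in>?I. (\<lambda>w. w @ Suc m # rev [i..<Suc m]) ` zeros_le n m (i - 1)) = ?f ` ?\<Sigma>"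
    by (auto simp del: upt_Suc)
  have inj: "inj_on ?f ?\<Sigma>"
  proof (rule inj_onI)
    fix p q assume p: "p \<in> ?\<Sigma>" "q \<in> ?\<Sigma>" "?f p = ?f q"
    obtain i w j v where pq: "p = (i, w)" "q = (j, v)" by (cases p, cases q)
    have "w = v \<and> rev [i..<Suc m] = rev [j..<Suc m]"
      by (rule append_Suc_inject[of _ m]) (use p A pq in auto)
    then have "w = v" "Suc m - i = Suc m - j" by (metis, metis length_rev length_upt)
    then show "p = q" using p pq by auto
  qed
  have "zeros_le n m t \<inter> ?f ` ?\<Sigma> = {}"
    using A_words_set A by fastforce
  then have "card (zeros_le n (Suc m) t) = card (zeros_le n m t) + card (?f ` ?\<Sigma>)"
    unfolding zeros_le_Suc[OF assms] img using finite_zeros_le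
    by (intro card_Un_disjoint) auto
  also have "card (?f ` ?\<Sigma>) = card ?\<Sigma>" using inj by (rule card_image)
  also have "\<dots> = (\<Sum>i\<in>?I. card (zeros_le n m (i - 1)))"
    using finite_zeros_le by (intro card_SigmaI) auto
  finally show ?thesis .
qed

lemma zeros_le_max: "m \<le> t \<Longrightarrow> zeros_le n m t = {w \<in> A_words m. gaps_ok n fresh w}"
proof -
  assume "m \<le> t"
  then have "1 \<le> gaps n w fresh y" if "w \<in> A_words m" "t < y" for w y
    using gaps_A_words[OF that(1), of y n] that(2) by linarith
  then show ?thesis by (auto simp: zeros_le_def)
qed

text \<open>Raising \<open>t\<close> by one in \<open>card_zeros_le_Suc\<close> adds one term to the
  sum and changes the first summand; together this is the rule C(m+2, t+1) = C(m+2, t) + C(m+1,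
  t+1). The last column repeats its predecessor because no zero exceeds m + 1.\<close>

lemma card_zeros_le:
  assumes "m < n" "t \<le> Suc m"
  shows "card (zeros_le n m t) = catalan_triangle (Suc m) t"
  using assms
proof (induction m arbitrary: t)
  case 0
  have "zeros_le n 0 t = {[]}" by (auto simp: zeros_le_def)
  then show ?case using 0 by (cases t) (auto simp: le_Suc_eq)
next
  case (Suc m)
  have IH: "card (zeros_le n m t) = catalan_triangle (Suc m) t" if "t \<le> Suc m" for t
    using Suc that by simp
  have small: "card (zeros_le n (Suc m) t) = catalan_triangle (Suc (Suc m)) t" if "t \<le> Suc m" for t
    using that
  proof (induction t)
    case 0
    then show ?case using card_zeros_le_Suc[OF Suc.prems(1), of 0] IH[of 0] by simp
  next
    case (Suc t)
    have "{1..min (Suc t) (Suc m)} = insert (Suc t) {1..min t (Suc m)}" "min t (Suc m) = t"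
      using Suc.prems by auto
    then have "card (zeros_le n (Suc m) (Suc t)) =
        card (zeros_le n (Suc m) t) + card (zeros_le n m (Suc t))"
      unfolding card_zeros_le_Suc[OF \<open>Suc m < n\<close>] by simp
    then show ?case using Suc IH by simp
  qed
  show ?case
  proof (cases "t \<le> Suc m")
    case True
    then show ?thesis by (rule small)
  next
    case False
    then have t: "t = Suc (Suc m)" using Suc.prems(2) by simp
    have "zeros_le n (Suc m) t = zeros_le n (Suc m) (Suc m)"
      using t by (simp add: zeros_le_max)
    then show ?thesis using t small[of "Suc m"] by simp
  qed
qed

definition no_zeros_from :: "nat \<Rightarrow> nat \<Rightarrow> nat \<Rightarrow> nat list set" where
  "no_zeros_from n m k = {w \<in> A_words m. gaps_ok n fresh w \<and> (\<forall>y\<in>{k..<m}. 1 \<le> gaps n w fresh y)}"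

text \<open>If the counter of \<open>Suc m\<close> is positive, there is no zero from
  \<open>k\<close> on. If it is 0, the last block is \<open>[Suc m]\<close>. Reading this letter has
  advanced the counter of \<open>m\<close>, so nothing is required of \<open>m\<close> once the
  block is removed.\<close>

lemma no_zeros_from_Suc:
  assumes "Suc m < n" "1 \<le> k" "k \<le> Suc m"
  shows "no_zeros_from n (Suc m) k =
    zeros_le n (Suc m) (k - 1) \<union> (\<lambda>w. w @ [Suc m]) ` no_zeros_from n m k"
    and "zeros_le n (Suc m) (k - 1) \<inter> (\<lambda>w. w @ [Suc m]) ` no_zeros_from n m k = {}"
proof -
  have top: "block_top n (Suc m) (Suc m)" using assms by (simp add: block_top_def)
  have gap: "gaps n (v @ [Suc m]) fresh y = gaps n v fresh y" if "1 \<le> y" "y < m" for v y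
    using gaps_block(4)[OF top, of "Suc m" y "gaps n v fresh"] that by simp
  have gap_m: "1 \<le> gaps n (v @ [Suc m]) fresh m" if "1 \<le> m" for v
    using gaps_block(3)[OF top, of "Suc m" m "gaps n v fresh"] that by simp
  have gap_top: "gaps n (v @ [Suc m]) fresh (Suc m) = 0" for v
    using gaps_block(1)[OF top, of "Suc m" "Suc m" "gaps n v fresh"] by simp
  show "no_zeros_from n (Suc m) k =
    zeros_le n (Suc m) (k - 1) \<union> (\<lambda>w. w @ [Suc m]) ` no_zeros_from n m k" (is "?L = ?R")
  proof (rule subset_antisym; rule subsetI)
    fix w assume w: "w \<in> ?L"
    then have wA: "w \<in> A_words (Suc m)" and ok: "gaps_ok n fresh w"
      by (simp_all add: no_zeros_from_def)
    show "w \<in> ?R"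
    proof (cases "1 \<le> gaps n w fresh (Suc m)")
      case True
      have "1 \<le> gaps n w fresh y" if "k - 1 < y" for y
      proof -
        consider "y < Suc m" | "y = Suc m" | "Suc m < y" by linarith
        then show ?thesis
        proof cases
          case 1
          then show ?thesis using w that by (auto simp: no_zeros_from_def)
        next
          case 2
          then show ?thesis using True by simp
        next
          case 3
          then show ?thesis using gaps_A_words[OF wA, of y n] by linarith
        qed
      qed
      then show ?thesis using wA ok by (simp add: zeros_le_def)
    next
      case False
      from wA show ?thesis
      proof (cases rule: A_words_SucE)
        case 1
        then show ?thesis using False gaps_A_words[OF 1, of "Suc m" n] by simp
      next
        case (2 v i)
        have "gaps n (Suc m # rev [i..<Suc m]) (gaps n v fresh) (Suc m) = 0"
          using False unfolding \<open>w = _\<close> fold_append comp_apply by linarith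
        then have "i = Suc m"
          using gaps_block(1)[OF top 2(3,4), of "Suc m" "gaps n v fresh"] 2(4)
          by (cases "i = Suc m") auto
        then have wv: "w = v @ [Suc m]" using 2 by simp
        have "1 \<le> gaps n v fresh y" if "y \<in> {k..<m}" for y
        proof -
          have "1 \<le> gaps n w fresh y" using w that by (auto simp: no_zeros_from_def)
          then show ?thesis unfolding wv using gap[of y v] that assms(2) by simp
        qed
        then have "v \<in> no_zeros_from n m k"
          using 2 ok wv by (simp add: no_zeros_from_def)
        then show ?thesis using wv by blast
      qed
    qed
  next
    fix w assume "w \<in> ?R"
    then show "w \<in> ?L"
    proof
      assume "w \<in> zeros_le n (Suc m) (k - 1)"
      then show ?thesis using assms(2) by (auto simp: zeros_le_def no_zeros_from_def)
    next
      assume "w \<in> (\<lambda>w. w @ [Suc m]) ` no_zeros_from n m k"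
      then obtain v where v: "w = v @ [Suc m]" "v \<in> no_zeros_from n m k" by blast
      then have vA: "v \<in> A_words m" "gaps_ok n fresh v" by (simp_all add: no_zeros_from_def)
      have "w \<in> A_words (Suc m)" using A_words_SucI2[OF vA(1), of "Suc m"] v by simp
      moreover have "gaps_ok n fresh w"
        using v vA gaps_A_words[OF vA(1), of "Suc m" n] by simp
      moreover have "1 \<le> gaps n w fresh y" if "y \<in> {k..<Suc m}" for y
      proof (cases "y = m")
        case True
        then show ?thesis using gap_m[of v] v that assms(2) by simp
      next
        case False
        then show ?thesis using gap[of y v] v that assms(2) by (simp add: no_zeros_from_def)
      qed
      ultimately show ?thesis by (simp add: no_zeros_from_def)
    qed
  qed
  show "zeros_le n (Suc m) (k - 1) \<inter> (\<lambda>w. w @ [Suc m]) ` no_zeros_from n m k = {}"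
  proof (rule equals0I)
    fix w assume w: "w \<in> zeros_le n (Suc m) (k - 1) \<inter> (\<lambda>w. w @ [Suc m]) ` no_zeros_from n m k"
    have "k - 1 < Suc m" using assms(3) by simp
    then have "1 \<le> gaps n w fresh (Suc m)" using w unfolding zeros_le_def by blast
    then show False using w gap_top by force
  qed
qed

text \<open>The two parts of \<open>no_zeros_from_Suc\<close> are counted by the two summands of the
  triangle's rule. The outcome is the same number as for \<open>zeros_le n m k\<close>, although the
  condition on the words differs.\<close>

lemma card_no_zeros_from:
  assumes "m < n" "1 \<le> k" "k \<le> Suc m"
  shows "card (no_zeros_from n m k) = catalan_triangle (Suc m) k"
  using assms
proof (induction m)
  case 0
  then have "no_zeros_from n 0 k = zeros_le n 0 k" by (auto simp: no_zeros_from_def zeros_le_max)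
  then show ?case using card_zeros_le[of 0 n k] 0 by simp
next
  case (Suc m)
  show ?case
  proof (cases "k \<le> Suc m")
    case False
    then have "no_zeros_from n (Suc m) k = zeros_le n (Suc m) k"
      by (auto simp: no_zeros_from_def zeros_le_max)
    then show ?thesis using card_zeros_le[of "Suc m" n k] Suc.prems by simp
  next
    case True
    have "finite (no_zeros_from n m k)"
      using finite_A_words[of m] by (simp add: no_zeros_from_def)
    then have "card (no_zeros_from n (Suc m) k) =
        card (zeros_le n (Suc m) (k - 1)) + card ((\<lambda>w. w @ [Suc m]) ` no_zeros_from n m k)"
      unfolding no_zeros_from_Suc(1)[OF Suc.prems(1,2) True]
      using no_zeros_from_Suc(2)[OF Suc.prems(1,2) True] finite_zeros_le
      by (intro card_Un_disjoint) auto
    also have "card ((\<lambda>w. w @ [Suc m]) ` no_zeros_from n m k) = card (no_zeros_from n m k)"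
      by (intro card_image inj_onI) simp
    also have "card (no_zeros_from n m k) = catalan_triangle (Suc m) k"
      using Suc True by simp
    also have "card (zeros_le n (Suc m) (k - 1)) = catalan_triangle (Suc (Suc m)) (k - 1)"
      using Suc.prems by (intro card_zeros_le) auto
    finally show ?thesis using Suc.prems(2) True by (cases k) auto
  qed
qed

section \<open>Packets\<close>

text \<open>After a block with label \<open>j\<close> that is not the last, \<open>y\<close> has
  gained one, \<open>x\<close> has counter 1, and so have the tail letters above \<open>j\<close>.
  Labels increase, so the hypotheses hold again with the tops exchanged: a suffix imposes nothing
  beyond its first two tops and its first tail.\<close>

lemma gaps_ok_alt_blocks:
  assumes "2 \<le> n" "{x, y} = {n - 1, n}" "js \<in> suffix_labels n" "2 \<le> \<sigma> x"
    "js \<noteq> [] \<Longrightarrow> \<forall>z\<in>{hd js..<n - 1}. 1 \<le> \<sigma> z" "2 \<le> length js \<Longrightarrow> 1 \<le> \<sigma> y"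
  shows "gaps_ok n \<sigma> (alt_blocks n x y js)"
  using assms(2-6)
proof (induction js arbitrary: x y \<sigma>)
  case (Cons j js)
  have top: "block_top n x (n - 1)" and xy: "x \<noteq> y" and y: "y = n - 1 \<or> y = n"
    using Cons.prems(1) assms(1) by (auto simp: block_top_def doubleton_eq_iff)
  have j: "1 \<le> j" "j \<le> n - 1" and js: "js \<in> suffix_labels n" "\<forall>i\<in>set js. j < i"
    using Cons.prems(2) by (auto simp: suffix_labels_def)
  let ?\<sigma> = "gaps n (x # rev [j..<n - 1]) \<sigma>"
  have "gaps_ok n \<sigma> (x # rev [j..<n - 1])"
    unfolding gaps_ok_block[OF top j] using Cons.prems(3,4) by simp
  moreover have "gaps_ok n ?\<sigma> (alt_blocks n y x js)"
  proof (cases js)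
    case Nil
    then show ?thesis by simp
  next
    case (Cons i ks)
    then have i: "j < i" "i \<le> n - 1" using js by (auto simp: suffix_labels_def)
    have "?\<sigma> y = Suc (\<sigma> y)" "?\<sigma> x = 1" "\<forall>z\<in>{i..<n - 1}. ?\<sigma> z = 1"
      using gaps_block(6)[OF top j, of y \<sigma>] gaps_block(1)[OF top j, of x \<sigma>]
        gaps_block(2)[OF top j, of _ \<sigma>] i y xy assms(1) top by (auto simp: block_top_def)
    then show ?thesis
      using Cons.prems i js \<open>js = _\<close> by (intro Cons.IH) (auto simp: insert_commute)
  qed
  ultimately show ?case
    by (simp only: alt_blocks.simps append_Cons[symmetric] gaps_ok_append)
qed simp

text \<open>A single block does not read n - 1, hence a zero there is harmless. A second block has n
  - 1 as its top, which excludes that zero, and later blocks add no condition by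
  \<open>gaps_ok_alt_blocks\<close>.\<close>

lemma prefix_homogeneous_iff:
  assumes "3 \<le> n" "w0 \<in> A_words (n - 1)" "js \<in> suffix_labels n"
  shows "gaps_ok n fresh (w0 @ alt_blocks n n (n - 1) js) \<longleftrightarrow>
    w0 \<in> (case js of [] \<Rightarrow> zeros_le n (n - 1) n
      | [j] \<Rightarrow> no_zeros_from n (n - 1) j | j # _ \<Rightarrow> zeros_le n (n - 1) (j - 1))"
proof -
  let ?\<sigma> = "gaps n w0 fresh"
  have top: "block_top n n (n - 1)" using assms(1) by (simp add: block_top_def)
  have n: "2 \<le> ?\<sigma> n" using assms(1) by (intro gaps_A_words[OF assms(2)]) simp
  consider "js = []" | j where "js = [j]" | j i ks where "js = j # i # ks"
    by (metis list.exhaust)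
  then show ?thesis
  proof cases
    case 1
    then show ?thesis using assms(2) by (simp add: zeros_le_max)
  next
    case 2
    then have "1 \<le> j" "j \<le> n - 1" using assms(3) by (auto simp: suffix_labels_def)
    from gaps_ok_block[OF top this, of ?\<sigma>] show ?thesis
      using 2 n assms(2) by (simp add: no_zeros_from_def)
  next
    case 3
    have j: "1 \<le> j" "j \<le> n - 1" "j < i" "i \<le> n - 1"
      using assms(3) 3 by (auto simp: suffix_labels_def)
    have "gaps_ok n ?\<sigma> (alt_blocks n n (n - 1) js) \<longleftrightarrow> (\<forall>y>j - 1. 1 \<le> ?\<sigma> y)" (is "?L \<longleftrightarrow> ?R")
    proof
      assume ?L
      then have ok: "gaps_ok n ?\<sigma> ((n # rev [j..<n - 1]) @ (n - 1) # rev [i..<n - 1] @ alt_blocks n n (n - 1) ks)"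
        using 3 by simp
      then have "\<forall>y\<in>{j..<n - 1}. 1 \<le> ?\<sigma> y" "2 \<le> gaps n (n # rev [j..<n - 1]) ?\<sigma> (n - 1)"
        unfolding gaps_ok_append gaps_ok_block[OF top j(1,2)] by simp_all
      \<comment> \<open>The second top needs counter 2 and gains exactly one from the letter n - 2
        of the first block, so the prefix must leave it at least 1.\<close>
      moreover have "gaps n (n # rev [j..<n - 1]) ?\<sigma> (n - 1) = Suc (?\<sigma> (n - 1))"
        using gaps_block(6)[OF top j(1,2), of "n - 1" ?\<sigma>] j assms(1) by simp
      ultimately have small: "\<forall>y\<in>{j..<n - 1}. 1 \<le> ?\<sigma> y" "1 \<le> ?\<sigma> (n - 1)" by simp_all
      show ?R
      proof (intro allI impI)
        fix y assume "j - 1 < y"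
        then consider "y \<in> {j..<n - 1}" | "y = n - 1" | "n - 1 < y" by fastforce
        then show "1 \<le> ?\<sigma> y"
          using small gaps_A_words[OF assms(2), of y n] by cases auto
      qed
    next
      assume ?R
      then have "1 \<le> ?\<sigma> y" if "j \<le> y" for y using that j by simp
      then show ?L
        using assms n 3 j by (intro gaps_ok_alt_blocks) auto
    qed
    then show ?thesis using 3 assms(2) by (simp add: zeros_le_def)
  qed
qed

text \<open>The value is a column of Catalan's triangle. One block with label \<open>j\<close> is
  counted by \<open>no_zeros_from\<close> at \<open>j\<close>, two or more blocks by
  \<open>zeros_le\<close> at j - 1; this is the origin of the shift.\<close>

definition packet_index :: "nat \<Rightarrow> nat list \<Rightarrow> nat" where
  "packet_index n js = (case js of [] \<Rightarrow> n | [j] \<Rightarrow> j | j # _ \<Rightarrow> j - 1)"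

text \<open>The letter n occurs in no prefix and opens every nonempty suffix, so it shows where the
  suffix starts.\<close>

lemma dropWhile_canonical:
  assumes "2 \<le> n" "w0 \<in> A_words (n - 1)"
  shows "dropWhile (\<lambda>z. z \<noteq> n) (w0 @ alt_blocks n n (n - 1) js) = alt_blocks n n (n - 1) js"
proof -
  have "\<forall>z\<in>set w0. z \<noteq> n" using A_words_set[OF assms(2)] assms(1) by fastforce
  then show ?thesis by (cases js) (auto simp: dropWhile_append2)
qed

lemma collection_eq:
  assumes "3 \<le> n" "js \<in> suffix_labels n"
  shows "collection n (suffix_word n js) = (\<lambda>w0. w0 @ alt_blocks n n (n - 1) js) `
    {w0 \<in> A_words (n - 1). gaps_ok n fresh (w0 @ alt_blocks n n (n - 1) js)}"
proof -
  have eq: "suffix_word n js = alt_blocks n n (n - 1) js"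
    using assms by (intro suffix_word_eq) (auto simp: suffix_labels_def)
  have n: "1 \<le> n" "2 \<le> n" using assms(1) by auto
  have "w0 @ alt_blocks n n (n - 1) js \<in> canonical_words n" if "w0 \<in> A_words (n - 1)" for w0
    unfolding canonical_words_eq[OF n(2)] using that assms(2) by blast
  then have "w0 @ alt_blocks n n (n - 1) js \<in> homogeneous_canonical n \<longleftrightarrow>
      gaps_ok n fresh (w0 @ alt_blocks n n (n - 1) js)" if "w0 \<in> A_words (n - 1)" for w0
    using that by (simp only: homogeneous_canonical_def homogeneous_word_iff mem_Collect_eq simp_thms)
  moreover have "collection n (suffix_word n js) = (\<lambda>w0. w0 @ alt_blocks n n (n - 1) js) `
      {w0 \<in> A_words (n - 1). w0 @ alt_blocks n n (n - 1) js \<in> homogeneous_canonical n}"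
    unfolding collection_def eq prefixes_A_words[OF n(1)] by (auto simp del: append_same_eq)
  ultimately show ?thesis by (metis (mono_tags, lifting) Collect_cong)
qed

lemma card_collection:
  assumes "3 \<le> n" "js \<in> suffix_labels n"
  shows "card (collection n (suffix_word n js)) = catalan_triangle n (packet_index n js)"
proof -
  let ?A = "case js of [] \<Rightarrow> zeros_le n (n - 1) n
      | [j] \<Rightarrow> no_zeros_from n (n - 1) j | j # _ \<Rightarrow> zeros_le n (n - 1) (j - 1)"
  have "?A \<subseteq> A_words (n - 1)"
    by (auto simp: zeros_le_def no_zeros_from_def split: list.splits)
  then have "{w0 \<in> A_words (n - 1). gaps_ok n fresh (w0 @ alt_blocks n n (n - 1) js)} = ?A"
    using prefix_homogeneous_iff[OF assms(1) _ assms(2)] by blast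
  then have "card (collection n (suffix_word n js)) = card ?A"
    unfolding collection_eq[OF assms] by (simp only:) (intro card_image inj_onI, simp)
  also have "\<dots> = catalan_triangle n (packet_index n js)"
  proof -
    have n: "Suc (n - 1) = n" "n - 1 < n" using assms(1) by auto
    have "\<forall>j\<in>set js. 1 \<le> j \<and> j \<le> n - 1" using assms(2) by (auto simp: suffix_labels_def)
    then show ?thesis
      using card_zeros_le[OF n(2)] card_no_zeros_from[OF n(2)] n
      by (auto simp: packet_index_def split: list.splits)
  qed
  finally show ?thesis .
qed

text \<open>Tops are at least n - 1 and tails stay below n - 1, so the block boundaries can be read
  off the word.\<close>

lemma alt_blocks_inject:
  assumes "n - 1 \<le> x" "n - 1 \<le> y" "set js \<subseteq> {1..n - 1}" "set js' \<subseteq> {1..n - 1}"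
    "alt_blocks n x y js = alt_blocks n x y js'"
  shows "js = js'"
  using assms
proof (induction js arbitrary: x y js')
  case Nil
  then show ?case by (cases js') auto
next
  case (Cons j js)
  then obtain j' ks where js': "js' = j' # ks" by (cases js') auto
  have take: "takeWhile (\<lambda>z. z < n - 1) (rev [i..<n - 1] @ alt_blocks n y x ks) = rev [i..<n - 1]" for i ks
    using Cons.prems(2) by (cases ks) (auto simp: takeWhile_append2 takeWhile_tail)
  have eq: "rev [j..<n - 1] @ alt_blocks n y x js = rev [j'..<n - 1] @ alt_blocks n y x ks"
    using Cons.prems(5) js' by simp
  then have rev: "rev [j..<n - 1] = rev [j'..<n - 1]" using take by metis
  then have "n - 1 - j = n - 1 - j'" by (metis length_rev length_upt)
  then have "j = j'" using Cons.prems js' by auto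
  moreover have "js = ks"
    by (rule Cons.IH[of y x]) (use Cons.prems eq rev js' in auto)
  ultimately show ?case using js' by simp
qed

lemma collection_disjoint:
  assumes "3 \<le> n" "js \<in> suffix_labels n" "js' \<in> suffix_labels n"
    "w \<in> collection n (suffix_word n js)" "w \<in> collection n (suffix_word n js')"
  shows "js = js'"
proof -
  have "alt_blocks n n (n - 1) js = alt_blocks n n (n - 1) js'"
  proof -
    have drop: "dropWhile (\<lambda>z. z \<noteq> n) w = alt_blocks n n (n - 1) ks"
      if ks: "ks \<in> suffix_labels n" and w: "w \<in> collection n (suffix_word n ks)" for ks
    proof -
      obtain u where "u \<in> A_words (n - 1)" "w = u @ alt_blocks n n (n - 1) ks"
        using w unfolding collection_eq[OF assms(1) ks] by blast
      then show ?thesis using dropWhile_canonical[of n u ks] assms(1) by simp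
    qed
    show ?thesis using drop[OF assms(2,4)] drop[OF assms(3,5)] by simp
  qed
  moreover have "set js \<subseteq> {1..n - 1}" "set js' \<subseteq> {1..n - 1}"
    using assms(2,3) by (auto simp: suffix_labels_def)
  ultimately show ?thesis
    using alt_blocks_inject[of n n "n - 1" js js'] by simp
qed

text \<open>The case distinction in \<open>packet\<close> collapses: a list of at least two labels
  starts with at most n - 2, so none starts with k + 1 when k > n - 3, and the words
  \<open>[n, n - 2]\<close> and \<open>[n]\<close> are s_nk for k = n - 2 and k = n - 1.\<close>

lemma packet_eq:
  assumes "4 \<le> n" "k \<le> n"
  shows "packet n k = {collection n (suffix_word n js) | js. js \<in> suffix_labels n \<and> packet_index n js = k}"
proof -
  have single: "[j] \<in> suffix_labels n \<longleftrightarrow> 1 \<le> j \<and> j \<le> n - 1" for j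
    by (auto simp: suffix_labels_def)
  have two: "j \<le> n - 2" "1 \<le> j" if "j # i # ks \<in> suffix_labels n" for j i ks
    using that by (auto simp: suffix_labels_def)
  have word: "suffix_word n [j] = s_word n n j" for j
    by (simp add: suffix_word_def)
  have cases3: "(\<exists>js. P js) \<longleftrightarrow> P [] \<or> (\<exists>j. P [j]) \<or> (\<exists>j i ks. P (j # i # ks))" for P :: "nat list \<Rightarrow> bool"
    by (metis list.exhaust)
  have R: "c \<in> {collection n (suffix_word n js) | js. js \<in> suffix_labels n \<and> packet_index n js = k} \<longleftrightarrow>
     c = collection n [] \<and> k = n \<or>
     1 \<le> k \<and> k \<le> n - 1 \<and> c = collection n (s_word n n k) \<or>
     (\<exists>i ks. (k + 1) # i # ks \<in> suffix_labels n \<and> c = collection n (suffix_word n ((k + 1) # i # ks)))"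
    for c
  proof -
    have "suffix_word n [] = []" "[] \<in> suffix_labels n" by (auto simp: suffix_word_def suffix_labels_def)
    then have a: "(c = collection n (suffix_word n []) \<and> [] \<in> suffix_labels n \<and> packet_index n [] = k) \<longleftrightarrow>
        c = collection n [] \<and> k = n"
      by (auto simp: packet_index_def)
    have b: "(\<exists>j. c = collection n (suffix_word n [j]) \<and> [j] \<in> suffix_labels n \<and> packet_index n [j] = k) \<longleftrightarrow>
        1 \<le> k \<and> k \<le> n - 1 \<and> c = collection n (s_word n n k)"
      unfolding single word by (auto simp: packet_index_def)
    have idx: "packet_index n (j # i # ks) = k \<longleftrightarrow> j = k + 1" if "j # i # ks \<in> suffix_labels n" for j i ks
      using two(2)[OF that] by (auto simp: packet_index_def)
    have d: "(\<exists>j i ks. c = collection n (suffix_word n (j # i # ks)) \<and> j # i # ks \<in> suffix_labels n \<and>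
          packet_index n (j # i # ks) = k) \<longleftrightarrow>
        (\<exists>i ks. (k + 1) # i # ks \<in> suffix_labels n \<and> c = collection n (suffix_word n ((k + 1) # i # ks)))"
      (is "?L \<longleftrightarrow> ?R")
    proof
      assume ?L
      then obtain j i ks where *: "c = collection n (suffix_word n (j # i # ks))"
        "j # i # ks \<in> suffix_labels n" "packet_index n (j # i # ks) = k" by blast
      then have j: "j = k + 1" using idx by simp
      show ?R
        by (intro exI conjI) (rule *(2)[unfolded j], rule *(1)[unfolded j])
    next
      assume ?R
      then obtain i ks where *: "(k + 1) # i # ks \<in> suffix_labels n"
        "c = collection n (suffix_word n ((k + 1) # i # ks))" by blast
      then have "packet_index n ((k + 1) # i # ks) = k" using idx[OF *(1)] by simp
      then show ?L
        by (intro exI conjI) (rule *(2), rule *(1))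
    qed
    show ?thesis
      unfolding mem_Collect_eq
        cases3[of "\<lambda>js. c = collection n (suffix_word n js) \<and> js \<in> suffix_labels n \<and> packet_index n js = k"]
        a b d ..
  qed
  have len2: "(\<exists>js. c = collection n (suffix_word n js) \<and> js \<in> suffix_labels n \<and> 2 \<le> length js \<and> hd js = k + 1) \<longleftrightarrow>
     (\<exists>i ks. (k + 1) # i # ks \<in> suffix_labels n \<and> c = collection n (suffix_word n ((k + 1) # i # ks)))" for c
    unfolding cases3[of "\<lambda>js. c = collection n (suffix_word n js) \<and> js \<in> suffix_labels n \<and>
      2 \<le> length js \<and> hd js = k + 1"]
    by auto
  have none: "\<not> (k + 1) # i # ks \<in> suffix_labels n" if "n - 3 < k" for i ks
    using two(1)[of "k + 1" i ks] that assms(1) by auto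
  consider "k = 0" | "1 \<le> k" "k \<le> n - 3" | "k = n - 2" | "k = n - 1" | "k = n"
    using assms by linarith
  then have P: "c \<in> packet n k \<longleftrightarrow>
     c = collection n [] \<and> k = n \<or>
     1 \<le> k \<and> k \<le> n - 1 \<and> c = collection n (s_word n n k) \<or>
     (\<exists>i ks. (k + 1) # i # ks \<in> suffix_labels n \<and> c = collection n (suffix_word n ((k + 1) # i # ks)))" for c
  proof cases
    case 1
    then show ?thesis using assms(1) len2[of c] by (simp add: packet_def)
  next
    case 2
    then show ?thesis using assms(1) len2[of c] by (auto simp: packet_def)
  next
    case 3
    then have "s_word n n k = [n, n - 2]" using assms(1)
      by (simp add: s_word_def upt_conv_Cons)
    then show ?thesis using 3 none assms(1) by (auto simp: packet_def)
  next
    case 4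
    then have "s_word n n k = [n]" using assms(1) by (simp add: s_word_def)
    then show ?thesis using 4 none assms(1) by (auto simp: packet_def)
  next
    case 5
    then show ?thesis using none assms(1) by (auto simp: packet_def)
  qed
  show ?thesis by (rule Set.set_eqI) (simp only: P R)
qed

lemma packet_index_le: "4 \<le> n \<Longrightarrow> js \<in> suffix_labels n \<Longrightarrow> packet_index n js \<le> n"
  by (auto simp: packet_index_def suffix_labels_def split: list.splits)

lemma Union_packets:
  assumes "4 \<le> n"
  shows "(\<Union>k\<in>{0..n}. \<Union>(packet n k)) = homogeneous_canonical n"
proof -
  have "\<Union>(packet n k) =
      (\<Union>js\<in>{js \<in> suffix_labels n. packet_index n js = k}. collection n (suffix_word n js))"
    if "k \<in> {0..n}" for k
    using that packet_eq[OF assms, of k] by auto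
  then have "(\<Union>k\<in>{0..n}. \<Union>(packet n k)) =
      (\<Union>k\<in>{0..n}. \<Union>js\<in>{js \<in> suffix_labels n. packet_index n js = k}. collection n (suffix_word n js))"
    by (intro SUP_cong refl)
  also have "\<dots> = (\<Union>js\<in>suffix_labels n. collection n (suffix_word n js))"
    using packet_index_le[OF assms] by (force simp: Bex_def)
  also have "\<dots> = homogeneous_canonical n"
    unfolding collection_def homogeneous_canonical_def canonical_words_def suffixes_D_def by blast
  finally show ?thesis .
qed

lemma packets_disjoint:
  assumes "4 \<le> n" "k \<le> n" "k' \<le> n" "c \<in> packet n k" "c' \<in> packet n k'" "(k, c) \<noteq> (k', c')"
  shows "c \<inter> c' = {}"
proof -
  from assms(4) obtain js where js: "js \<in> suffix_labels n" "c = collection n (suffix_word n js)"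
      "packet_index n js = k"
    unfolding packet_eq[OF assms(1,2)] by blast
  moreover from assms(5) obtain js' where js': "js' \<in> suffix_labels n"
      "c' = collection n (suffix_word n js')" "packet_index n js' = k'"
    unfolding packet_eq[OF assms(1,3)] by blast
  ultimately have "js \<noteq> js'" using assms(6) by auto
  then show ?thesis using collection_disjoint[of n js js'] js js' assms(1) by auto
qed

lemma card_packet:
  assumes "4 \<le> n" "k \<le> n" "c \<in> packet n k"
  shows "card c = catalan_triangle n k"
proof -
  from assms(3) obtain js where js: "js \<in> suffix_labels n" "c = collection n (suffix_word n js)"
      "packet_index n js = k"
    unfolding packet_eq[OF assms(1,2)] by blast
  have "3 \<le> n" using assms(1) by simp
  from card_collection[OF this js(1)] show ?thesis unfolding js(2,3) .
qed

section \<open>The free algebra and its quotient\<close>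

lemma zero_in_klr_free [simp]: "0 \<in> carrier (klr_free \<alpha>)"
  by (simp add: klr_free_def)

lemma one_in_klr_free [simp]: "1 \<in> carrier (klr_free \<alpha>)"
  by (simp add: klr_free_def zero_monomial_def)

lemma add_in_klr_free [simp]:
  "p \<in> carrier (klr_free \<alpha>) \<Longrightarrow> q \<in> carrier (klr_free \<alpha>) \<Longrightarrow> p + q \<in> carrier (klr_free \<alpha>)"
  using Poly_Mapping.keys_add[of p q] by (auto simp: klr_free_def)

lemma uminus_in_klr_free [simp]:
  "p \<in> carrier (klr_free \<alpha>) \<Longrightarrow> - p \<in> carrier (klr_free \<alpha>)"
  by (simp add: klr_free_def in_keys_iff)

lemma diff_in_klr_free [simp]:
  "p \<in> carrier (klr_free \<alpha>) \<Longrightarrow> q \<in> carrier (klr_free \<alpha>) \<Longrightarrow> p - q \<in> carrier (klr_free \<alpha>)"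
  using add_in_klr_free[of p \<alpha> "- q"] by simp

lemma mult_in_klr_free [simp]:
  assumes "p \<in> carrier (klr_free \<alpha>)" "q \<in> carrier (klr_free \<alpha>)"
  shows "p * q \<in> carrier (klr_free \<alpha>)"
proof -
  have "set (factors m) \<subseteq> klr_gens \<alpha>" if m: "m \<in> Poly_Mapping.keys (p * q)" for m
  proof -
    obtain a b where "a \<in> Poly_Mapping.keys p" "b \<in> Poly_Mapping.keys q" "m = a + b"
      using keys_mult[of p q] m by blast
    then show ?thesis using assms by (simp add: klr_free_def plus_monomial_def)
  qed
  then show ?thesis by (simp add: klr_free_def)
qed

lemma scalar_in_klr_free [simp]: "scalar c \<in> carrier (klr_free \<alpha>)"
  by (simp add: klr_free_def scalar_def zero_monomial_def)

lemma gen_in_klr_free: "g \<in> klr_gens \<alpha> \<Longrightarrow> gen g \<in> carrier (klr_free \<alpha>)"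
  by (simp add: klr_free_def gen_def)

lemma ee_in_klr_free [simp]: "w \<in> permutations_of_multiset \<alpha> \<Longrightarrow> ee w \<in> carrier (klr_free \<alpha>)"
  by (rule gen_in_klr_free) (simp add: klr_gens_def)

lemma psi_in_klr_free [simp]: "1 \<le> k \<Longrightarrow> k < size \<alpha> \<Longrightarrow> \<psi> k \<in> carrier (klr_free \<alpha>)"
  by (rule gen_in_klr_free) (simp add: klr_gens_def)

lemma yy_in_klr_free [simp]: "1 \<le> k \<Longrightarrow> k \<le> size \<alpha> \<Longrightarrow> yy k \<in> carrier (klr_free \<alpha>)"
  by (rule gen_in_klr_free) (simp add: klr_gens_def)

lemma sum_in_klr_free:
  "(\<And>i. i \<in> A \<Longrightarrow> f i \<in> carrier (klr_free \<alpha>)) \<Longrightarrow> sum f A \<in> carrier (klr_free \<alpha>)"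
  by (induction A rule: infinite_finite_induct) auto

lemma klr_free_simps [simp]:
  "add (klr_free \<alpha>) = (+)" "mult (klr_free \<alpha>) = (*)" "one (klr_free \<alpha>) = 1" "zero (klr_free \<alpha>) = 0"
  by (simp_all add: klr_free_def)

lemma ring_klr_free: "ring (klr_free \<alpha> :: ('f::field) klr_free_elt ring)"
proof (rule ringI)
  show "abelian_group (klr_free \<alpha> :: 'f klr_free_elt ring)"
  proof (rule abelian_groupI)
    fix x :: "'f klr_free_elt" assume "x \<in> carrier (klr_free \<alpha>)"
    then show "\<exists>y\<in>carrier (klr_free \<alpha>). y \<oplus>\<^bsub>klr_free \<alpha>\<^esub> x = \<zero>\<^bsub>klr_free \<alpha>\<^esub>"
      by (intro bexI[of _ "- x"]) simp_all
  qed (simp_all add: add_ac)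
  show "monoid (klr_free \<alpha> :: 'f klr_free_elt ring)"
    by (rule monoidI) (simp_all add: mult.assoc)
qed (simp_all add: algebra_simps)

lemma swap_at_permutation:
  assumes "w \<in> permutations_of_multiset \<alpha>" "1 \<le> k" "k < size \<alpha>"
  shows "swap_at k w \<in> permutations_of_multiset \<alpha>"
proof -
  have "length w = size \<alpha>" using assms(1) by (auto simp: permutations_of_multiset_def)
  moreover have "swap_at k w = w[k - 1 := w ! k, k := w ! (k - 1)]"
    by (simp add: swap_at_def letter_def)
  ultimately have "mset (swap_at k w) = mset w"
    using assms mset_swap[of "k - 1" w k] by (simp add: list_update_swap)
  then show ?thesis using assms(1) by (simp add: permutations_of_multiset_def)
qed

lemma klr_relations_in_klr_free: "klr_relations \<Gamma> \<alpha> \<subseteq> carrier (klr_free \<alpha>)"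
proof
  fix r assume "r \<in> klr_relations \<Gamma> \<alpha>"
  then show "r \<in> carrier (klr_free \<alpha>)"
    by cases (auto simp: swap_at_permutation intro!: diff_in_klr_free sum_in_klr_free)
qed

lemma klr_ideal: "ideal (klr_ideal \<Gamma> \<alpha>) (klr_free \<alpha>)"
  unfolding klr_ideal_def
  by (rule ring.genideal_ideal[OF ring_klr_free klr_relations_in_klr_free])

lemma klr_relations_in_klr_ideal: "klr_relations \<Gamma> \<alpha> \<subseteq> klr_ideal \<Gamma> \<alpha>"
  unfolding klr_ideal_def
  by (rule ring.genideal_self[OF ring_klr_free klr_relations_in_klr_free])

lemma klr_ideal_minimal:
  assumes "ideal J (klr_free \<alpha>)" "klr_relations \<Gamma> \<alpha> \<subseteq> J"
  shows "klr_ideal \<Gamma> \<alpha> \<subseteq> J"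
  unfolding klr_ideal_def using assms by (rule ring.genideal_minimal[OF ring_klr_free])

lemma ring_klr: "ring (klr \<Gamma> \<alpha>)"
  unfolding klr_def by (rule ideal.quotient_is_ring[OF klr_ideal])

lemma klr_class_hom: "klr_class \<Gamma> \<alpha> \<in> ring_hom (klr_free \<alpha>) (klr \<Gamma> \<alpha>)"
proof -
  have "klr_class \<Gamma> \<alpha> = (+>\<^bsub>klr_free \<alpha>\<^esub>) (klr_ideal \<Gamma> \<alpha>)"
    by (simp add: klr_class_def fun_eq_iff)
  then show ?thesis unfolding klr_def using ideal.rcos_ring_hom[OF klr_ideal] by metis
qed

lemma carrier_klr: "carrier (klr \<Gamma> \<alpha>) = klr_class \<Gamma> \<alpha> ` carrier (klr_free \<alpha>)"
  by (auto simp: klr_def FactRing_def A_RCOSETS_def' klr_class_def)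

lemma klr_class_closed [simp]:
  "p \<in> carrier (klr_free \<alpha>) \<Longrightarrow> klr_class \<Gamma> \<alpha> p \<in> carrier (klr \<Gamma> \<alpha>)"
  by (simp add: carrier_klr)

lemma klr_class_add:
  "p \<in> carrier (klr_free \<alpha>) \<Longrightarrow> q \<in> carrier (klr_free \<alpha>) \<Longrightarrow>
     klr_class \<Gamma> \<alpha> (p + q) = klr_class \<Gamma> \<alpha> p \<oplus>\<^bsub>klr \<Gamma> \<alpha>\<^esub> klr_class \<Gamma> \<alpha> q"
  using ring_hom_add[OF klr_class_hom, of p \<alpha> q] by simp

lemma klr_class_mult:
  "p \<in> carrier (klr_free \<alpha>) \<Longrightarrow> q \<in> carrier (klr_free \<alpha>) \<Longrightarrow>
     klr_class \<Gamma> \<alpha> (p * q) = klr_class \<Gamma> \<alpha> p \<otimes>\<^bsub>klr \<Gamma> \<alpha>\<^esub> klr_class \<Gamma> \<alpha> q"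
  using ring_hom_mult[OF klr_class_hom, of p \<alpha> q] by simp

lemma klr_class_one: "klr_class \<Gamma> \<alpha> 1 = \<one>\<^bsub>klr \<Gamma> \<alpha>\<^esub>"
  using ring_hom_one[OF klr_class_hom, of \<Gamma> \<alpha>] by simp

lemma klr_class_ideal:
  assumes "r \<in> klr_ideal \<Gamma> \<alpha>"
  shows "klr_class \<Gamma> \<alpha> r = \<zero>\<^bsub>klr \<Gamma> \<alpha>\<^esub>"
  using ring.a_rcos_zero[OF ring_klr_free klr_ideal assms]
  by (simp add: klr_class_def klr_def FactRing_def)

lemma klr_class_eq_UN: "klr_class \<Gamma> \<alpha> p = (\<Union>h\<in>klr_ideal \<Gamma> \<alpha>. {h + p})"
  by (simp add: klr_class_def a_r_coset_def')

lemma zero_in_klr_ideal: "0 \<in> klr_ideal \<Gamma> \<alpha>"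
  using additive_subgroup.zero_closed[OF ideal.axioms(1)[OF klr_ideal]] by simp

lemma poly_mapping_eq_sum_single:
  "p = (\<Sum>m\<in>Poly_Mapping.keys p. Poly_Mapping.single m (Poly_Mapping.lookup p m))"
proof (rule poly_mapping_eqI)
  fix k
  have "(\<Sum>m\<in>Poly_Mapping.keys p. if m = k then Poly_Mapping.lookup p m else 0) = Poly_Mapping.lookup p k"
    unfolding sum.delta[OF finite_keys] by (simp add: in_keys_iff)
  then show "Poly_Mapping.lookup p k =
      Poly_Mapping.lookup (\<Sum>m\<in>Poly_Mapping.keys p. Poly_Mapping.single m (Poly_Mapping.lookup p m)) k"
    by (simp only: lookup_sum lookup_single when_def)
qed

lemma klr_free_induct [consumes 1, case_names zero single add]:
  assumes "p \<in> carrier (klr_free \<alpha>)"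
    and "P 0"
    and "\<And>m c. set (factors m) \<subseteq> klr_gens \<alpha> \<Longrightarrow> P (Poly_Mapping.single m c)"
    and "\<And>p q. p \<in> carrier (klr_free \<alpha>) \<Longrightarrow> q \<in> carrier (klr_free \<alpha>) \<Longrightarrow> P p \<Longrightarrow> P q \<Longrightarrow> P (p + q)"
  shows "P p"
proof -
  have "P q \<and> q \<in> carrier (klr_free \<alpha>)"
    if "finite A" "A \<subseteq> Poly_Mapping.keys p" "q = (\<Sum>m\<in>A. Poly_Mapping.single m (Poly_Mapping.lookup p m))" for A q
    using that
  proof (induction A arbitrary: q rule: finite_induct)
    case (insert m A)
    let ?s = "Poly_Mapping.single m (Poly_Mapping.lookup p m)"
    have m: "set (factors m) \<subseteq> klr_gens \<alpha>"
      using insert.prems(1) assms(1) by (auto simp: klr_free_def)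
    then have "?s \<in> carrier (klr_free \<alpha>)" by (simp add: klr_free_def)
    then show ?case
      using insert assms(3)[OF m] assms(4) by simp
  qed (use assms(2) in simp)
  then show ?thesis
    using poly_mapping_eq_sum_single[of p] finite_keys[of p] by (metis order_refl)
qed

lemma single_eq_prod:
  "Poly_Mapping.single m c = scalar c * prod_list (map gen (factors m))"
proof (induction m)
  case (Monomial gs)
  have "prod_list (map gen gs) = (Poly_Mapping.single (Monomial gs) 1 :: 'a klr_free_elt)" for gs
    by (induction gs)
      (simp_all add: gen_def mult_single plus_monomial_def flip: zero_monomial_def)
  then show ?case by (simp add: scalar_def mult_single)
qed

text \<open>The form in which the intertwining property of a map between modules is checked: on
  generators, scalars and sums.\<close>

lemma klr_free_left_mult_induct [consumes 1, case_names one gen scale add]: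
  fixes p :: "('a::field) klr_free_elt"
  assumes "p \<in> carrier (klr_free \<alpha>)"
    and "P 1"
    and "\<And>g p. g \<in> klr_gens \<alpha> \<Longrightarrow> p \<in> carrier (klr_free \<alpha>) \<Longrightarrow> P p \<Longrightarrow> P (gen g * p)"
    and "\<And>c p. p \<in> carrier (klr_free \<alpha>) \<Longrightarrow> P p \<Longrightarrow> P (scalar c * p)"
    and "\<And>p q. p \<in> carrier (klr_free \<alpha>) \<Longrightarrow> q \<in> carrier (klr_free \<alpha>) \<Longrightarrow> P p \<Longrightarrow> P q \<Longrightarrow> P (p + q)"
  shows "P p"
  using assms(1)
proof (induction rule: klr_free_induct)
  case zero
  have "scalar 0 * 1 = (0 :: 'a klr_free_elt)" by (simp add: scalar_def)
  then show ?case using assms(4)[of 1 0] assms(2) by simp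
next
  case (single m c)
  have "P (prod_list (map gen gs)) \<and> (prod_list (map gen gs) :: 'a klr_free_elt) \<in> carrier (klr_free \<alpha>)"
    if "set gs \<subseteq> klr_gens \<alpha>" for gs
    using that
  proof (induction gs)
    case (Cons g gs)
    then show ?case using assms(3)[of g] by (simp add: gen_in_klr_free)
  qed (use assms(2) in simp)
  then show ?case using single assms(4) by (simp add: single_eq_prod)
qed (rule assms(5))

section \<open>The modules \<open>S(w)\<close>\<close>

lemma letter_swap_at:
  assumes "1 \<le> k" "k < length x" "1 \<le> j"
  shows "letter (swap_at k x) j = (if j = k then letter x (k + 1) else if j = k + 1 then letter x k else letter x j)"
  using assms by (auto simp: letter_def swap_at_def nth_list_update)

lemma length_swap_at [simp]: "length (swap_at k x) = length x"
  by (simp add: swap_at_def)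

lemma word_eqI:
  assumes "length x = length y" "\<And>j. 1 \<le> j \<Longrightarrow> j \<le> length x \<Longrightarrow> letter x j = letter y j"
  shows "x = y"
proof (rule nth_equalityI)
  fix i assume "i < length x"
  then show "x ! i = y ! i" using assms(2)[of "Suc i"] by (simp add: letter_def)
qed (rule assms(1))

lemma swap_at_swap_at:
  assumes "1 \<le> k" "k < length x"
  shows "swap_at k (swap_at k x) = x"
  by (rule word_eqI) (use assms in \<open>auto simp: letter_swap_at\<close>)

lemma swap_at_far:
  assumes "1 \<le> k" "k < length x" "1 \<le> l" "l < length x" "k + 1 < l \<or> l + 1 < k"
  shows "swap_at k (swap_at l x) = swap_at l (swap_at k x)"
  by (rule word_eqI) (use assms in \<open>auto simp: letter_swap_at\<close>)

lemma swap_at_braid: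
  assumes "1 \<le> k" "k + 1 < length x"
  shows "swap_at (k + 1) (swap_at k (swap_at (k + 1) x)) = swap_at k (swap_at (k + 1) (swap_at k x))"
  by (rule word_eqI) (use assms in \<open>auto simp: letter_swap_at\<close>)

lemma admissible_swap_iff:
  "admissible_swap n r x \<longleftrightarrow> 1 \<le> r \<and> r < length x \<and> commute n (letter x r) (letter x (r + 1))"
  by (auto simp: admissible_swap_def commute_def)

lemma admissible_swap_self [simp]:
  "admissible_swap n r x \<Longrightarrow> admissible_swap n r (swap_at r x)"
  by (auto simp: admissible_swap_iff letter_swap_at commute_sym)

lemma admissible_swap_far:
  assumes "1 \<le> k" "k < length x" "1 \<le> l" "l < length x" "k + 1 < l \<or> l + 1 < k"
  shows "admissible_swap n k (swap_at l x) = admissible_swap n k x"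
  using assms by (auto simp: admissible_swap_iff letter_swap_at)

locale word_module =
  fixes n :: nat and \<Gamma> :: "(nat \<times> nat) set" and w :: "nat list" and F :: "'f::field itself"
  assumes quiver: "type_D_quiver n \<Gamma>"
    and homogeneous: "homogeneous_word n w"
    and vertices: "set w \<subseteq> {1..n}"
begin

abbreviation C :: "nat list set" where "C \<equiv> word_component n w"
abbreviation \<alpha> :: "nat multiset" where "\<alpha> \<equiv> mset w"

definition V :: "(nat list \<Rightarrow> 'f) set" where
  "V = {f. \<forall>u. u \<notin> C \<longrightarrow> f u = 0}"

abbreviation act :: "'f klr_free_elt \<Rightarrow> (nat list \<Rightarrow> 'f) \<Rightarrow> (nat list \<Rightarrow> 'f)" where
  "act \<equiv> act_free n w"

lemma C_self: "w \<in> C"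
  by (simp add: word_component_eq)

lemma C_mset: "u \<in> C \<Longrightarrow> mset u = mset w"
  by (auto simp: word_component_eq comm_equiv_mset)

lemma C_length: "u \<in> C \<Longrightarrow> length u = size \<alpha>"
  using C_mset by (metis size_mset)

lemma C_homogeneous: "u \<in> C \<Longrightarrow> homogeneous_word n u"
  using homogeneous homogeneous_word_comm_equiv by (auto simp: word_component_eq)

lemma C_permutation: "u \<in> C \<Longrightarrow> u \<in> permutations_of_multiset \<alpha>"
  by (simp add: permutations_of_multiset_def C_mset)

lemma finite_C: "finite C"
  by (rule finite_subset[of _ "permutations_of_multiset \<alpha>"]) (auto intro: C_permutation)

lemma C_swap: "admissible_swap n r u \<Longrightarrow> swap_at r u \<in> C \<longleftrightarrow> u \<in> C"
  unfolding word_component_eq mem_Collect_eq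
  by (meson admissible_swap_self comm_step_iff comm_step_sym rtranclp.rtrancl_into_rtrancl)

lemma V_zero [simp]: "(\<lambda>_. 0) \<in> V"
  by (simp add: V_def)

lemma V_add [simp]: "f \<in> V \<Longrightarrow> g \<in> V \<Longrightarrow> (\<lambda>x. f x + g x) \<in> V"
  by (simp add: V_def)

lemma V_scale [simp]: "f \<in> V \<Longrightarrow> (\<lambda>x. c * f x) \<in> V"
  by (simp add: V_def)

lemma basis_vector_V: "u \<in> C \<Longrightarrow> basis_vector u \<in> V"
  by (auto simp: V_def basis_vector_def)

lemma act_gen_E:
  assumes "f \<in> V"
  shows "act_gen n w (EGen v) f = (\<lambda>x. if x = v then f x else 0)"
proof
  fix x
  have "act_gen n w (EGen v) f x = (\<Sum>u\<in>C. if u = v then (if x = v then f v else 0) else 0)"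
    unfolding act_gen_def by (intro sum.cong refl) (simp add: basis_vector_def)
  also have "\<dots> = (if x = v then f x else 0)"
    unfolding sum.delta[OF finite_C] using assms by (auto simp: V_def)
  finally show "act_gen n w (EGen v) f x = (if x = v then f x else 0)" .
qed

lemma act_gen_Y: "act_gen n w (YGen r) f = (\<lambda>_. 0)"
  by (simp add: act_gen_def)

text \<open>Read on coefficients: the basis vector of \<open>u\<close> moves to that of
  \<open>swap_at r u\<close>, and as swaps are involutions the coefficient at \<open>x\<close> comes
  from \<open>swap_at r x\<close>.\<close>

lemma act_gen_Psi:
  assumes "f \<in> V"
  shows "act_gen n w (PsiGen r) f = (\<lambda>x. if admissible_swap n r x then f (swap_at r x) else 0)"
proof
  fix x
  have "act_gen n w (PsiGen r) f x =
      (\<Sum>u\<in>C. if u = swap_at r x then (if admissible_swap n r x then f (swap_at r x) else 0) else 0)"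
    unfolding act_gen_def
  proof (intro sum.cong refl)
    fix u assume "u \<in> C"
    have "admissible_swap n r u \<and> x = swap_at r u \<longleftrightarrow> admissible_swap n r x \<and> u = swap_at r x"
      using swap_at_swap_at[of r] admissible_swap_self[of n r] by (metis admissible_swap_def)
    then show "f u * act_on_basis n (PsiGen r) u x =
        (if u = swap_at r x then if admissible_swap n r x then f (swap_at r x) else 0 else 0)"
      by (auto simp: basis_vector_def)
  qed
  also have "\<dots> = (if admissible_swap n r x then f (swap_at r x) else 0)"
    unfolding sum.delta[OF finite_C] using assms by (auto simp: V_def)
  finally show "act_gen n w (PsiGen r) f x = (if admissible_swap n r x then f (swap_at r x) else 0)" .
qed

lemma act_gen_V: "f \<in> V \<Longrightarrow> act_gen n w g f \<in> V"
proof (cases g)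
  case (PsiGen r)
  assume "f \<in> V"
  then show ?thesis using C_swap unfolding PsiGen act_gen_Psi[OF \<open>f \<in> V\<close>] by (auto simp: V_def)
qed (auto simp: act_gen_E act_gen_Y V_def)

lemma act_gen_add: "act_gen n w g (\<lambda>x. f x + h x) = (\<lambda>x. act_gen n w g f x + act_gen n w g h x)"
  by (simp add: act_gen_def algebra_simps sum.distrib)

lemma act_gen_scale: "act_gen n w g (\<lambda>x. c * f x) = (\<lambda>x. c * act_gen n w g f x)"
  by (simp add: act_gen_def sum_distrib_left algebra_simps)

lemma foldr_act_gen_V: "f \<in> V \<Longrightarrow> foldr (act_gen n w) gs f \<in> V"
  by (induction gs) (auto intro: act_gen_V)

lemma foldr_act_gen_add:
  "foldr (act_gen n w) gs (\<lambda>x. f x + h x) =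
     (\<lambda>x. foldr (act_gen n w) gs f x + foldr (act_gen n w) gs h x)"
  by (induction gs) (auto simp: act_gen_add)

lemma foldr_act_gen_scale:
  "foldr (act_gen n w) gs (\<lambda>x. c * f x) = (\<lambda>x. c * foldr (act_gen n w) gs f x)"
  by (induction gs) (auto simp: act_gen_scale)

lemma act_single: "act (Poly_Mapping.single m c) f = (\<lambda>x. c * foldr (act_gen n w) (factors m) f x)"
  by (cases "c = 0") (auto simp: act_free_def)

lemma act_add: "act (p + q) f = (\<lambda>x. act p f x + act q f x)"
  unfolding act_free_def
  by (rule ext, rule setsum_keys_plus_distrib) (auto simp: algebra_simps)

lemma act_0 [simp]: "act 0 f = (\<lambda>_. 0)"
  by (simp add: act_free_def)

lemma act_uminus: "act (- p) f = (\<lambda>x. - act p f x)"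
  by (simp add: act_free_def sum_negf)

lemma act_diff: "act (p - q) f = (\<lambda>x. act p f x - act q f x)"
  using act_add[of p "- q" f] by (simp add: act_uminus)

lemma act_sum: "act (sum p A) f = (\<lambda>x. \<Sum>i\<in>A. act (p i) f x)"
  by (induction A rule: infinite_finite_induct) (auto simp: act_add)

lemma act_one [simp]: "act 1 f = f"
proof -
  have "act (Poly_Mapping.single 0 1) f = f"
    unfolding act_single by (simp add: zero_monomial_def)
  then show ?thesis by (simp only: single_one)
qed

lemma act_gen: "act (gen g) f = act_gen n w g f"
  by (simp add: gen_def act_single)

lemma act_scalar: "act (scalar c) f = (\<lambda>x. c * f x)"
  by (simp add: scalar_def act_single zero_monomial_def)

lemma act_V: "f \<in> V \<Longrightarrow> act p f \<in> V"
  using foldr_act_gen_V[of f] by (auto simp: act_free_def V_def intro!: sum.neutral)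

lemma act_add_right: "act p (\<lambda>x. f x + h x) = (\<lambda>x. act p f x + act p h x)"
  by (simp add: act_free_def foldr_act_gen_add algebra_simps sum.distrib)

lemma act_scale_right: "act p (\<lambda>x. c * f x) = (\<lambda>x. c * act p f x)"
  by (simp add: act_free_def foldr_act_gen_scale algebra_simps sum_distrib_left)

lemma act_zero_right [simp]: "act p (\<lambda>_. 0) = (\<lambda>_. 0)"
  using act_scale_right[of p 0 "\<lambda>_. 0"] by simp

lemma act_mult: "act (p * q) f = act p (act q f)"
proof -
  have single: "act (Poly_Mapping.single m c * Poly_Mapping.single m' c') f =
      act (Poly_Mapping.single m c) (act (Poly_Mapping.single m' c') f)" for m m' c c'
    by (simp add: mult_single act_single plus_monomial_def foldr_act_gen_scale mult.assoc)
  have left: "act (Poly_Mapping.single m c * (\<Sum>i\<in>A. Poly_Mapping.single i (b i))) f =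
      act (Poly_Mapping.single m c) (act (\<Sum>i\<in>A. Poly_Mapping.single i (b i)) f)" for m c A b
    by (induction A rule: infinite_finite_induct)
      (auto simp: distrib_left act_add act_add_right single)
  have "act (Poly_Mapping.single m c * q) f = act (Poly_Mapping.single m c) (act q f)" for m c
    using left[of m c "Poly_Mapping.lookup q" "Poly_Mapping.keys q"]
    by (simp flip: poly_mapping_eq_sum_single)
  then have "act ((\<Sum>i\<in>A. Poly_Mapping.single i (b i)) * q) f =
      act (\<Sum>i\<in>A. Poly_Mapping.single i (b i)) (act q f)" for A b
    by (induction A rule: infinite_finite_induct) (auto simp: distrib_right act_add)
  from this[of "Poly_Mapping.lookup p" "Poly_Mapping.keys p"] show ?thesis
    by (simp flip: poly_mapping_eq_sum_single)
qed

lemma act_E: "f \<in> V \<Longrightarrow> act (ee v) f x = (if x = v then f x else 0)"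
  by (simp add: act_gen act_gen_E)

lemma act_Y [simp]: "act (yy k) f = (\<lambda>_. 0)"
  by (simp add: act_gen act_gen_Y)

lemma act_Psi:
  "f \<in> V \<Longrightarrow> act (\<psi> k) f x = (if admissible_swap n k x then f (swap_at k x) else 0)"
  by (simp add: act_gen act_gen_Psi)

lemma act_E_outside:
  assumes "f \<in> V" "v \<notin> C"
  shows "act (ee v) f = (\<lambda>_. 0)"
  using assms by (auto simp: act_E V_def fun_eq_iff)

lemma act_Psi_E:
  assumes "f \<in> V" "v \<in> permutations_of_multiset \<alpha>" "1 \<le> k" "k < size \<alpha>"
  shows "act (\<psi> k) (act (ee v) f) =
    (if admissible_swap n k v then (\<lambda>x. if x = swap_at k v then f v else 0) else (\<lambda>_. 0))"
proof
  fix x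
  have len: "length v = size \<alpha>" using assms(2) by (metis permutations_of_multisetD size_mset)
  have "admissible_swap n k x \<and> swap_at k x = v \<longleftrightarrow> admissible_swap n k v \<and> x = swap_at k v"
    using swap_at_swap_at[of k] admissible_swap_self[of n k] by (metis admissible_swap_def)
  then show "act (\<psi> k) (act (ee v) f) x =
    (if admissible_swap n k v then (\<lambda>x. if x = swap_at k v then f v else 0) else (\<lambda>_. 0)) x"
    using assms(1) by (auto simp: act_Psi act_V act_E)
qed

lemma act_Psi_Psi:
  assumes "g \<in> V"
  shows "act (\<psi> k) (act (\<psi> k) g) = (\<lambda>x. if admissible_swap n k x then g x else 0)"
proof
  fix x
  have "swap_at k (swap_at k x) = x" if "admissible_swap n k x"
    using that by (intro swap_at_swap_at) (auto simp: admissible_swap_def)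
  then show "act (\<psi> k) (act (\<psi> k) g) x = (if admissible_swap n k x then g x else 0)"
    using assms by (simp add: act_Psi act_V)
qed

lemma no_equal_neighbours:
  assumes "u \<in> C" "1 \<le> k" "k < size \<alpha>"
  shows "letter u k \<noteq> letter u (k + 1)"
proof
  assume "letter u k = letter u (k + 1)"
  then have "\<exists>s t. k < s \<and> s < t \<and> t < k + 1"
    using C_homogeneous[OF assms(1)] C_length[OF assms(1)] assms(2,3)
    unfolding homogeneous_word_def by (metis Suc_eq_plus1 Suc_leI lessI)
  then show False by auto
qed

lemma no_braid_pattern:
  assumes "u \<in> C" "1 \<le> k" "k + 1 < size \<alpha>"
  shows "letter u k \<noteq> letter u (k + 2)"
proof
  assume "letter u k = letter u (k + 2)"
  then have "\<exists>s t. k < s \<and> s < t \<and> t < k + 2"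
    using C_homogeneous[OF assms(1)] C_length[OF assms(1)] assms(2,3)
    unfolding homogeneous_word_def by (metis Suc_eq_plus1 add_2_eq_Suc' less_add_same_cancel1 less_eq_Suc_le zero_less_numeral)
  then show False by auto
qed

lemma arrow_iff:
  assumes "u \<in> permutations_of_multiset \<alpha>" "1 \<le> i" "i \<le> size \<alpha>" "1 \<le> j" "j \<le> size \<alpha>"
  shows "D_neighbors n (letter u i) (letter u j) \<longleftrightarrow>
    (letter u i, letter u j) \<in> \<Gamma> \<or> (letter u j, letter u i) \<in> \<Gamma>"
proof -
  have u: "mset u = \<alpha>" using assms(1) by (simp add: permutations_of_multiset_def)
  have "length u = size \<alpha>" "set u = set w"
    using arg_cong[OF u, of size] arg_cong[OF u, of set_mset] by simp_all
  then have "letter u k \<in> set w" if "1 \<le> k" "k \<le> size \<alpha>" for k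
    using that nth_mem[of "k - 1" u] by (simp add: letter_def)
  then have "letter u i \<in> D_vertices n" "letter u j \<in> D_vertices n"
    using assms(2-5) vertices unfolding D_vertices_def by blast+
  then show ?thesis using quiver unfolding type_D_quiver_def by blast
qed

text \<open>All terms with \<open>yy k\<close> vanish. The extra terms in the relations
  \<open>y_psi\<close>, \<open>psi_y\<close> and \<open>braid\<close> involve equal letters at
  distance 1 or 2, which words in \<open>C\<close> do not have.\<close>

lemma act_relation:
  assumes "r \<in> klr_relations \<Gamma> \<alpha>" "f \<in> V"
  shows "act r f = (\<lambda>_. 0)"
  using assms(1)
proof cases
  case (idem v u)
  then show ?thesis using assms(2) by (auto simp: act_diff act_mult act_E act_V fun_eq_iff)
next
  case unit
  have "(\<Sum>v\<in>permutations_of_multiset \<alpha>. act (ee v) f x) = f x" for x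
  proof -
    have "(\<Sum>v\<in>permutations_of_multiset \<alpha>. act (ee v) f x) =
        (\<Sum>v\<in>permutations_of_multiset \<alpha>. if v = x then f x else 0)"
      using assms(2) by (intro sum.cong refl) (auto simp: act_E)
    also have "\<dots> = f x"
      unfolding sum.delta[OF finite_permutations_of_multiset]
      using assms(2) C_permutation by (auto simp: V_def)
    finally show ?thesis .
  qed
  then show ?thesis unfolding unit by (simp add: act_diff act_sum)
next
  case (psi_e v k)
  have len: "length v = size \<alpha>" using psi_e(2) by (metis permutations_of_multisetD size_mset)
  have "act (ee (swap_at k v)) (act (\<psi> k) f) =
    (if admissible_swap n k v then (\<lambda>x. if x = swap_at k v then f v else 0) else (\<lambda>_. 0))"
    using assms(2) psi_e len swap_at_swap_at[of k v] admissible_swap_self[of n k v]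
      admissible_swap_self[of n k "swap_at k v"]
    by (auto simp: act_E act_Psi act_V fun_eq_iff)
  then show ?thesis
    unfolding psi_e(1) act_diff act_mult act_Psi_E[OF assms(2) psi_e(2-4)] by (simp only: diff_self)
next
  case (psi_sq v k)
  have len: "length v = size \<alpha>" using psi_sq(2) by (metis permutations_of_multisetD size_mset)
  have sq: "act (\<psi> k) (act (\<psi> k) (act (ee v) f)) =
      (if admissible_swap n k v then act (ee v) f else (\<lambda>_. 0))"
    unfolding act_Psi_Psi[OF act_V[OF assms(2)]] using assms(2) by (auto simp: fun_eq_iff act_E)
  \<comment> \<open>Admissible swaps are exactly the last case of the relation, where the square of
    \<open>\<psi> k\<close> is the identity; in the other cases both sides act by 0.\<close>
  have "admissible_swap n k v \<longleftrightarrow> letter v k \<noteq> letter v (k + 1) \<and>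
      (letter v k, letter v (k + 1)) \<notin> \<Gamma> \<and> (letter v (k + 1), letter v k) \<notin> \<Gamma>"
    using arrow_iff[OF psi_sq(2), of k "k + 1"] psi_sq(3,4) len
    by (auto simp: admissible_swap_iff commute_def)
  then show ?thesis
    unfolding psi_sq(1) act_diff act_mult mult.assoc sq
    by (auto simp: act_mult act_diff)
next
  case (psi_far k l)
  have "act (\<psi> k) (act (\<psi> l) f) x = act (\<psi> l) (act (\<psi> k) f) x" for x
  proof (cases "length x = size \<alpha>")
    case True
    have a: "admissible_swap n k (swap_at l x) = admissible_swap n k x"
      "admissible_swap n l (swap_at k x) = admissible_swap n l x"
      using admissible_swap_far[of k x l n] admissible_swap_far[of l x k n] psi_far True by auto
    have "swap_at k (swap_at l x) = swap_at l (swap_at k x)"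
      using psi_far True by (intro swap_at_far) auto
    then show ?thesis
      using assms(2) by (simp add: act_Psi act_V a)
  next
    case False
    then have "x \<notin> C" using C_length by blast
    then show ?thesis using act_V[OF act_V[OF assms(2)]] by (auto simp: V_def)
  qed
  then show ?thesis unfolding psi_far(1) by (simp add: act_diff act_mult)
next
  case (y_psi v k)
  have "act (ee v) f = (\<lambda>_. 0)" if "letter v k = letter v (k + 1)"
    using act_E_outside[OF assms(2)] no_equal_neighbours[of v k] y_psi that by blast
  then show ?thesis unfolding y_psi(1) by (auto simp: act_diff act_mult)
next
  case (psi_y v k)
  have "act (ee v) f = (\<lambda>_. 0)" if "letter v k = letter v (k + 1)"
    using act_E_outside[OF assms(2)] no_equal_neighbours[of v k] psi_y that by blast
  then show ?thesis unfolding psi_y(1) by (auto simp: act_diff act_mult)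
next
  case (braid v k)
  have corr: "act (ee v) f = (\<lambda>_. 0)" if "letter v (k + 2) = letter v k"
    using act_E_outside[OF assms(2)] no_braid_pattern[of v k] braid that by metis
  have "act (\<psi> (k + 1)) (act (\<psi> k) (act (\<psi> (k + 1)) g)) x =
      act (\<psi> k) (act (\<psi> (k + 1)) (act (\<psi> k) g)) x" if g: "g \<in> V" for g x
  proof (cases "length x = size \<alpha>")
    case True
    \<comment> \<open>Along either side of the braid each pair among the letters at k, k + 1 and k +
      2 is exchanged once, so both sides require the same three commutations.\<close>
    have adm: "admissible_swap n (k + 1) x \<and> admissible_swap n k (swap_at (k + 1) x) \<and>
        admissible_swap n (k + 1) (swap_at k (swap_at (k + 1) x)) \<longleftrightarrow>
      admissible_swap n k x \<and> admissible_swap n (k + 1) (swap_at k x) \<and>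
        admissible_swap n k (swap_at (k + 1) (swap_at k x))"
      using braid(3,4) True by (auto simp: admissible_swap_iff letter_swap_at)
    have "swap_at (k + 1) (swap_at k (swap_at (k + 1) x)) = swap_at k (swap_at (k + 1) (swap_at k x))"
      using braid(3,4) True by (intro swap_at_braid) auto
    then show ?thesis
      using adm g by (simp add: act_Psi act_V) blast
  next
    case False
    then have "x \<notin> C" using C_length by blast
    then show ?thesis using act_V[OF act_V[OF act_V[OF g]]] by (auto simp: V_def)
  qed
  from this[OF act_V[OF assms(2)]] show ?thesis
    unfolding braid(1) using corr by (auto simp: act_diff act_mult act_uminus)
qed (auto simp: act_diff act_mult act_V)

end

section \<open>The quotient algebra acting on S(w): grading, dimension and irreducibility\<close>

lemma (in abelian_group) finsum_concentrated:
  assumes "\<And>d. d \<noteq> e \<Longrightarrow> f d = \<zero>" "f e \<in> carrier G"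
  shows "finsum G f {d. f d \<noteq> \<zero>} = f e"
proof (cases "f e = \<zero>")
  case True
  then have "{d. f d \<noteq> \<zero>} = {}" using assms(1) by (metis (mono_tags) empty_Collect_eq)
  then show ?thesis using True by simp
next
  case False
  then have "{d. f d \<noteq> \<zero>} = {e}" using assms(1) by blast
  then show ?thesis using assms(2) by (simp add: finsum_insert)
qed

context word_module
begin

abbreviation S :: "('f, nat list \<Rightarrow> 'f) klr_module" where "S \<equiv> S_module n w"

lemma carrier_S [simp]: "carrier S = V"
  and zero_S [simp]: "\<zero>\<^bsub>S\<^esub> = (\<lambda>_. 0)"
  and add_S [simp]: "f \<oplus>\<^bsub>S\<^esub> g = (\<lambda>x. f x + g x)"
  and component_S: "component S d = (if d = 0 then V else {\<lambda>_. 0})"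
  by (simp_all add: S_module_def V_def)

lemma act_ideal:
  assumes "p \<in> klr_ideal \<Gamma> \<alpha>" "f \<in> V"
  shows "act p f = (\<lambda>_. 0)"
proof -
  let ?R = "klr_free \<alpha> :: 'f klr_free_elt ring"
  \<comment> \<open>The annihilator of \<open>V\<close> in the free algebra. It is an ideal that
    contains the relations, hence contains the ideal generated by them.\<close>
  define J where "J = {p \<in> carrier ?R. \<forall>f\<in>V. act p f = (\<lambda>_. 0)}"
  interpret R: ring ?R by (rule ring_klr_free)
  have minus: "\<ominus>\<^bsub>?R\<^esub> p = - p" if "p \<in> carrier ?R" for p
    using R.minus_equality[of "- p" p] that by simp
  have "ideal J ?R"
  proof (rule idealI[OF ring_klr_free])
    show "subgroup J (add_monoid ?R)"
    proof (rule group.subgroupI[OF R.a_group])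
      show "J \<subseteq> carrier (add_monoid ?R)" by (auto simp: J_def)
      have "0 \<in> J" by (simp add: J_def)
      then show "J \<noteq> {}" by blast
    next
      fix a assume "a \<in> J"
      then have "- a \<in> J" by (simp add: J_def act_uminus)
      then show "inv\<^bsub>add_monoid ?R\<^esub> a \<in> J"
        using minus[of a] \<open>a \<in> J\<close> by (simp add: J_def a_inv_def)
    next
      fix a b assume "a \<in> J" "b \<in> J"
      then show "a \<otimes>\<^bsub>add_monoid ?R\<^esub> b \<in> J" by (simp add: J_def act_add)
    qed
  qed (auto simp: J_def act_mult act_V)
  moreover have "klr_relations \<Gamma> \<alpha> \<subseteq> J"
    using klr_relations_in_klr_free act_relation unfolding J_def by blast
  ultimately have "klr_ideal \<Gamma> \<alpha> \<subseteq> J" by (rule klr_ideal_minimal)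
  then show ?thesis using assms unfolding J_def by blast
qed

lemma smult_S:
  assumes "p \<in> carrier (klr_free \<alpha>)" "f \<in> V"
  shows "klr_class \<Gamma> \<alpha> p \<odot>\<^bsub>S\<^esub> f = act p f"
proof -
  have "(\<lambda>q. act q f) ` klr_class \<Gamma> \<alpha> p = {act p f}"
    using zero_in_klr_ideal[of \<Gamma> \<alpha>] act_ideal assms(2)
    unfolding klr_class_eq_UN by (auto simp: act_add image_iff intro!: bexI[of _ 0])
  then show ?thesis by (simp add: S_module_def)
qed

lemma abelian_group_S: "abelian_group S"
proof (rule abelian_groupI)
  fix f assume "f \<in> carrier S"
  then have "(\<lambda>x. - f x) \<in> carrier S" by (simp add: V_def)
  then show "\<exists>g\<in>carrier S. g \<oplus>\<^bsub>S\<^esub> f = \<zero>\<^bsub>S\<^esub>"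
    by (intro bexI[of _ "\<lambda>x. - f x"]) simp_all
qed (simp_all add: add_ac)

lemma left_module_S: "left_module (klr \<Gamma> \<alpha>) S"
proof (intro left_module.intro left_module_axioms.intro ring_klr abelian_group_S)
  fix a f assume "a \<in> carrier (klr \<Gamma> \<alpha> :: 'f klr_free_elt set ring)" "f \<in> carrier S"
  then show "a \<odot>\<^bsub>S\<^esub> f \<in> carrier S" by (auto simp: carrier_klr smult_S act_V)
next
  fix a b f assume "a \<in> carrier (klr \<Gamma> \<alpha> :: 'f klr_free_elt set ring)" "b \<in> carrier (klr \<Gamma> \<alpha> :: 'f klr_free_elt set ring)" "f \<in> carrier S"
  then show "(a \<oplus>\<^bsub>klr \<Gamma> \<alpha>\<^esub> b) \<odot>\<^bsub>S\<^esub> f = a \<odot>\<^bsub>S\<^esub> f \<oplus>\<^bsub>S\<^esub> b \<odot>\<^bsub>S\<^esub> f"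
    by (auto simp: carrier_klr smult_S act_add simp flip: klr_class_add)
next
  fix a f g assume "a \<in> carrier (klr \<Gamma> \<alpha> :: 'f klr_free_elt set ring)" "f \<in> carrier S" "g \<in> carrier S"
  then show "a \<odot>\<^bsub>S\<^esub> (f \<oplus>\<^bsub>S\<^esub> g) = a \<odot>\<^bsub>S\<^esub> f \<oplus>\<^bsub>S\<^esub> a \<odot>\<^bsub>S\<^esub> g"
    by (auto simp: carrier_klr smult_S act_add_right)
next
  fix a b f assume "a \<in> carrier (klr \<Gamma> \<alpha> :: 'f klr_free_elt set ring)" "b \<in> carrier (klr \<Gamma> \<alpha> :: 'f klr_free_elt set ring)" "f \<in> carrier S"
  then show "(a \<otimes>\<^bsub>klr \<Gamma> \<alpha>\<^esub> b) \<odot>\<^bsub>S\<^esub> f = a \<odot>\<^bsub>S\<^esub> (b \<odot>\<^bsub>S\<^esub> f)"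
    by (auto simp: carrier_klr smult_S act_mult act_V simp flip: klr_class_mult)
next
  fix f assume "f \<in> carrier S"
  then show "\<one>\<^bsub>klr \<Gamma> \<alpha>\<^esub> \<odot>\<^bsub>S\<^esub> f = f"
    by (simp add: smult_S flip: klr_class_one)
qed

lemma klr_homogeneous_in_klr_free:
  "klr_homogeneous n \<alpha> d p \<Longrightarrow> p \<in> carrier (klr_free \<alpha>)"
  by (induction rule: klr_homogeneous.induct) auto

text \<open>A factor \<open>\<psi> k * ee v\<close> acts by 0 unless the swap is admissible, and
  then it has degree 0, so that the nonzero degree must come from the remaining factors.\<close>

lemma act_homogeneous:
  "klr_homogeneous n \<alpha> d p \<Longrightarrow> d \<noteq> 0 \<Longrightarrow> f \<in> V \<Longrightarrow> act p f = (\<lambda>_. 0)"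
proof (induction arbitrary: f rule: klr_homogeneous.induct)
  case (mult_psi d p v k)
  show ?case
  proof (cases "admissible_swap n k v")
    case True
    then have "psi_degree n k v = 0" by (auto simp: psi_degree_def admissible_swap_def)
    then have "act p f = (\<lambda>_. 0)" using mult_psi by simp
    then show ?thesis by (simp add: act_mult)
  next
    case False
    then show ?thesis using mult_psi by (simp add: act_mult act_Psi_E act_V mult.assoc)
  qed
qed (simp_all add: act_mult act_add)

lemma is_graded_S: "is_graded_module (klr \<Gamma> \<alpha>) (klr_component n \<Gamma> \<alpha>) S"
  unfolding is_graded_module_def
proof (intro conjI allI ballI)
  interpret S: abelian_group S by (rule abelian_group_S)
  show "left_module (klr \<Gamma> \<alpha>) S" by (rule left_module_S)
  show "additive_subgroup (component S d) S" for d
  proof (rule additive_subgroup.intro)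
    show "subgroup (component S d) (add_monoid S)"
    proof (cases "d = 0")
      case True
      then show ?thesis using group.subgroup_self[OF S.a_group] by (simp add: component_S)
    next
      case False
      then show ?thesis using group.triv_subgroup[OF S.a_group] by (simp add: component_S)
    qed
  qed
  show "\<exists>!g. (\<forall>d. g d \<in> component S d) \<and> finite {d. g d \<noteq> \<zero>\<^bsub>S\<^esub>} \<and> f = finsum S g {d. g d \<noteq> \<zero>\<^bsub>S\<^esub>}"
    if f: "f \<in> carrier S" for f
  proof (rule ex1I)
    let ?g = "\<lambda>d::int. if d = 0 then f else \<zero>\<^bsub>S\<^esub>"
    have "finsum S ?g {d. ?g d \<noteq> \<zero>\<^bsub>S\<^esub>} = ?g 0"
      using f by (intro S.finsum_concentrated) simp_all
    moreover have "finite {d. ?g d \<noteq> \<zero>\<^bsub>S\<^esub>}"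
      by (rule finite_subset[of _ "{0}"]) auto
    ultimately show "(\<forall>d. ?g d \<in> component S d) \<and> finite {d. ?g d \<noteq> \<zero>\<^bsub>S\<^esub>} \<and>
        f = finsum S ?g {d. ?g d \<noteq> \<zero>\<^bsub>S\<^esub>}"
      using f by (auto simp: component_S)
  next
    fix g assume g: "(\<forall>d. g d \<in> component S d) \<and> finite {d. g d \<noteq> \<zero>\<^bsub>S\<^esub>} \<and>
        f = finsum S g {d. g d \<noteq> \<zero>\<^bsub>S\<^esub>}"
    then have g0: "g d = \<zero>\<^bsub>S\<^esub>" if "d \<noteq> 0" for d
      using g[THEN conjunct1, rule_format, of d] that by (simp add: component_S)
    have "g 0 \<in> carrier S" using g[THEN conjunct1, rule_format, of 0] by (simp add: component_S)
    with g0 have "finsum S g {d. g d \<noteq> \<zero>\<^bsub>S\<^esub>} = g 0" by (rule S.finsum_concentrated)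
    then have "f = g 0" using g by metis
    then show "g = (\<lambda>d. if d = 0 then f else \<zero>\<^bsub>S\<^esub>)" using g0 by auto
  qed
  show "a \<odot>\<^bsub>S\<^esub> f \<in> component S (i + j)"
    if a: "a \<in> klr_component n \<Gamma> \<alpha> i" and f: "f \<in> component S j" for i j a f
  proof -
    from a obtain p where p: "a = klr_class \<Gamma> \<alpha> p" "klr_homogeneous n \<alpha> i p"
      by (auto simp: klr_component_def)
    have fV: "f \<in> V" using f by (auto simp: component_S split: if_splits)
    have "a \<odot>\<^bsub>S\<^esub> f = act p f"
      using smult_S[OF klr_homogeneous_in_klr_free[OF p(2)] fV] p(1) by simp
    moreover have "act p f \<in> component S (i + j)"
    proof (cases "j = 0 \<and> i = 0")
      case True
      then show ?thesis using act_V[OF fV] by (simp add: component_S)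
    next
      case False
      then have "act p f = (\<lambda>_. 0)"
        using act_homogeneous[OF p(2) _ fV] f by (auto simp: component_S split: if_splits)
      then show ?thesis by (simp add: component_S)
    qed
    ultimately show ?thesis by simp
  qed
qed

lemma finsum_S:
  assumes "finite B" "\<And>b. b \<in> B \<Longrightarrow> g b \<in> V"
  shows "finsum S g B = (\<lambda>x. \<Sum>b\<in>B. g b x)"
proof -
  interpret S: abelian_group S by (rule abelian_group_S)
  show ?thesis using assms
  proof (induction B rule: finite_induct)
    case (insert b B)
    then show ?case by (subst S.finsum_insert) auto
  qed simp
qed

lemma V_expand:
  assumes "f \<in> V"
  shows "f = (\<lambda>x. \<Sum>u\<in>C. f u * basis_vector u x)"
proof
  fix x
  have "(\<Sum>u\<in>C. f u * basis_vector u x) = (\<Sum>u\<in>C. if u = x then f u else 0)"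
    by (intro sum.cong refl) (auto simp: basis_vector_def)
  also have "\<dots> = f x" unfolding sum.delta[OF finite_C] using assms by (auto simp: V_def)
  finally show "f x = (\<Sum>u\<in>C. f u * basis_vector u x)" by simp
qed

lemma inj_basis_vector: "inj (basis_vector :: nat list \<Rightarrow> nat list \<Rightarrow> 'f)"
proof (rule injI)
  fix u v :: "nat list" assume "(basis_vector u :: nat list \<Rightarrow> 'f) = basis_vector v"
  then have "basis_vector u u = (basis_vector v u :: 'f)" by simp
  then show "u = v" by (simp add: basis_vector_def split: if_splits)
qed

lemma finite_dimensional_S: "finite_dimensional \<Gamma> \<alpha> S"
  unfolding finite_dimensional_def
proof (intro exI[of _ "basis_vector ` C"] conjI ballI)
  show "finite (basis_vector ` C)" using finite_C by simp
  show sub: "basis_vector ` C \<subseteq> carrier S" using basis_vector_V by auto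
  fix f assume "f \<in> carrier S"
  then have f: "f \<in> V" by simp
  \<comment> \<open>Coefficients in \<open>finite_dimensional\<close> are indexed by the spanning
    vectors themselves, so the word is recovered from its basis vector.\<close>
  let ?c = "\<lambda>b. f (inv_into UNIV basis_vector b)"
  have "(\<Oplus>\<^bsub>S\<^esub>b\<in>basis_vector ` C. klr_class \<Gamma> \<alpha> (scalar (?c b)) \<odot>\<^bsub>S\<^esub> b) =
      (\<lambda>x. \<Sum>b\<in>basis_vector ` C. (klr_class \<Gamma> \<alpha> (scalar (?c b)) \<odot>\<^bsub>S\<^esub> b) x)"
    using finite_C sub by (intro finsum_S) (auto simp: smult_S act_V)
  also have "\<dots> = (\<lambda>x. \<Sum>u\<in>C. f u * basis_vector u x)"
  proof
    fix x
    have "(\<Sum>b\<in>basis_vector ` C. (klr_class \<Gamma> \<alpha> (scalar (?c b)) \<odot>\<^bsub>S\<^esub> b) x) =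
        (\<Sum>u\<in>C. (klr_class \<Gamma> \<alpha> (scalar (f u)) \<odot>\<^bsub>S\<^esub> basis_vector u) x)"
      using inj_basis_vector by (subst sum.reindex) (auto simp: inj_on_def intro!: sum.cong dest: injD)
    also have "\<dots> = (\<Sum>u\<in>C. f u * basis_vector u x)"
      by (intro sum.cong refl) (simp add: smult_S basis_vector_V act_scalar)
    finally show "(\<Sum>b\<in>basis_vector ` C. (klr_class \<Gamma> \<alpha> (scalar (?c b)) \<odot>\<^bsub>S\<^esub> b) x) =
      (\<Sum>u\<in>C. f u * basis_vector u x)" .
  qed
  also have "\<dots> = f" using V_expand[OF f] by simp
  finally show "\<exists>c. f = (\<Oplus>\<^bsub>S\<^esub>b\<in>basis_vector ` C. klr_class \<Gamma> \<alpha> (scalar (c b)) \<odot>\<^bsub>S\<^esub> b)"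
    by (intro exI[of _ ?c]) simp
qed

lemma act_Psi_basis:
  assumes "u \<in> C" "admissible_swap n k u"
  shows "act (\<psi> k) (basis_vector u) = basis_vector (swap_at k u)"
proof
  fix x
  have "admissible_swap n k x \<and> swap_at k x = u \<longleftrightarrow> x = swap_at k u"
    using assms(2) swap_at_swap_at[of k] admissible_swap_self[of n k] by (metis admissible_swap_def)
  then show "act (\<psi> k) (basis_vector u) x = basis_vector (swap_at k u) x"
    using basis_vector_V[OF assms(1)] by (auto simp: act_Psi basis_vector_def)
qed

text \<open>From a nonzero coefficient at \<open>u\<close>, the idempotent \<open>ee u\<close> and a
  scalar isolate the basis vector of \<open>u\<close>, and admissible swaps carry it to all others.
  The grading does not enter.\<close>

lemma submodule_S:
  assumes N: "additive_subgroup N S" "\<forall>a\<in>carrier (klr \<Gamma> \<alpha>). \<forall>x\<in>N. a \<odot>\<^bsub>S\<^esub> x \<in> N"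
  shows "N = {\<lambda>_. 0} \<or> N = V"
proof (cases "\<exists>f\<in>N. f \<noteq> (\<lambda>_. 0)")
  case False
  have "(\<lambda>_. 0) \<in> N" using additive_subgroup.zero_closed[OF N(1)] by simp
  then show ?thesis using False by blast
next
  case True
  then obtain f where "f \<in> N" "f \<noteq> (\<lambda>_. 0)" by blast
  then obtain u where f: "f \<in> N" "f u \<noteq> 0" by (auto simp: fun_eq_iff)
  have NV: "N \<subseteq> V" using additive_subgroup.a_subset[OF N(1)] by simp
  have act: "act p g \<in> N" if "p \<in> carrier (klr_free \<alpha>)" "g \<in> N" for p g
    using N(2) that NV smult_S[OF that(1), of g] klr_class_closed[OF that(1), of \<Gamma>] by fastforce
  have u: "u \<in> C" using f NV by (auto simp: V_def)
  have "act (scalar (1 / f u)) (act (ee u) f) \<in> N"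
    using f(1) u C_permutation by (intro act) auto
  moreover have "act (scalar (1 / f u)) (act (ee u) f) = basis_vector u"
    using f NV by (auto simp: act_scalar act_E basis_vector_def fun_eq_iff)
  ultimately have "basis_vector u \<in> N" by simp
  have basis: "basis_vector v \<in> N" if v: "v \<in> C" for v
  proof -
    have "comm_equiv n u v" using u v comm_equiv_sym unfolding word_component_eq
      by (metis mem_Collect_eq rtranclp_trans)
    then show ?thesis
    proof (induction rule: rtranclp_induct)
      case base
      show ?case by fact
    next
      case (step v v')
      have "v \<in> C" using step.hyps(1) u unfolding word_component_eq by auto
      obtain r where r: "admissible_swap n r v" "v' = swap_at r v"
        using step.hyps(2) by (auto simp: comm_step_iff)
      have "act (\<psi> r) (basis_vector v) \<in> N"
        using r(1) C_length[OF \<open>v \<in> C\<close>] step.IH by (intro act) (auto simp: admissible_swap_def)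
      then show ?case using act_Psi_basis[OF \<open>v \<in> C\<close> r(1)] r(2) by simp
    qed
  qed
  have "(\<lambda>x. \<Sum>u\<in>A. g u * basis_vector u x) \<in> N" if "finite A" "A \<subseteq> C" for g A
    using that
  proof (induction A rule: finite_induct)
    case empty
    then show ?case using additive_subgroup.zero_closed[OF N(1)] by simp
  next
    case (insert v A)
    have "(\<lambda>x. g v * basis_vector v x) \<in> N"
      using act[OF scalar_in_klr_free basis, of v "g v"] insert.prems by (simp add: act_scalar)
    then show ?case
      using additive_subgroup.a_closed[OF N(1), of "\<lambda>x. g v * basis_vector v x"] insert by simp
  qed
  then have "V \<subseteq> N" using V_expand finite_C by (metis order_refl subsetI)
  then show ?thesis using NV by blast
qed

lemma homogeneous_rep_S: "homogeneous_rep n \<Gamma> \<alpha> S"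
  unfolding homogeneous_rep_def
proof (intro conjI is_graded_S finite_dimensional_S)
  show "\<alpha> \<in> Q_plus n" using vertices by (simp add: Q_plus_def D_vertices_def)
  show "in_single_degree S" unfolding in_single_degree_def by (intro exI[of _ 0]) (simp add: component_S)
  show "graded_irreducible (klr \<Gamma> \<alpha>) S"
    unfolding graded_irreducible_def
  proof (intro conjI allI impI)
    have "(basis_vector w :: nat list \<Rightarrow> 'f) \<noteq> (\<lambda>_. 0)" by (auto simp: basis_vector_def fun_eq_iff)
    then show "carrier S \<noteq> {\<zero>\<^bsub>S\<^esub>}" using basis_vector_V[OF C_self] by auto
    fix N assume "graded_submodule (klr \<Gamma> \<alpha>) S N"
    then show "N = {\<zero>\<^bsub>S\<^esub>} \<or> N = carrier S"
      using submodule_S[of N] by (simp add: graded_submodule_def)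
  qed
qed

end

section \<open>Weight spaces of homogeneous representations\<close>

lemma not_gaps_ok_split:
  "\<not> gaps_ok n \<sigma> u \<Longrightarrow> \<exists>p a q. u = p @ a # q \<and> gaps n p \<sigma> a < 2"
proof (induction u arbitrary: \<sigma>)
  case (Cons x u)
  show ?case
  proof (cases "2 \<le> \<sigma> x")
    case True
    then have "\<not> gaps_ok n (tick n x \<sigma>) u" using Cons.prems by simp
    from Cons.IH[OF this] obtain p a q where "u = p @ a # q" "gaps n p (tick n x \<sigma>) a < 2"
      by blast
    then show ?thesis by (intro exI[of _ "x # p"] exI[of _ a] exI[of _ q]) simp
  next
    case False
    then show ?thesis by (intro exI[of _ "[]"] exI[of _ x] exI[of _ u]) simp
  qed
qed simp

lemma gaps_count:
  "a \<notin> set r \<Longrightarrow> gaps n r \<sigma> a = \<sigma> a + length (filter (\<lambda>x. D_neighbors n x a) r)"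
  by (induction r arbitrary: \<sigma>) (auto simp: tick_apply)

lemma filter_length_le_1:
  assumes "length (filter P r) \<le> 1"
  obtains "\<forall>x\<in>set r. \<not> P x"
  | r1 b r2 where "r = r1 @ b # r2" "P b" "\<forall>x\<in>set r1. \<not> P x" "\<forall>x\<in>set r2. \<not> P x"
proof (cases "\<exists>b\<in>set r. P b")
  case True
  then obtain r1 b r2 where r: "r = r1 @ b # r2" "P b" "\<forall>x\<in>set r1. \<not> P x"
    using split_list_first_prop[OF True] by blast
  then have "filter P r2 = []" using assms by (simp add: filter_empty_conv)
  then show ?thesis using that(2)[OF r] by (simp add: filter_empty_conv)
qed (use that(1) in blast)

text \<open>A letter that fails its test has at most one neighbor since its last occurrence.
  Everything else in between commutes with it, so the two occurrences can be moved together until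
  they touch or enclose just this neighbor.\<close>

lemma not_homogeneous_comm_equiv:
  assumes "\<not> homogeneous_word n u"
  shows "(\<exists>p a q. comm_equiv n u (p @ a # a # q)) \<or>
    (\<exists>p a b q. comm_equiv n u (p @ a # b # a # q) \<and> D_neighbors n a b)"
proof -
  obtain p a q where u: "u = p @ a # q" "gaps n p fresh a < 2"
    using not_gaps_ok_split assms unfolding homogeneous_word_iff by blast
  then have "a \<in> set p" using gaps_unused[of a p fresh n] by (metis not_le)
  then obtain p1 r where p: "p = p1 @ a # r" "a \<notin> set r" by (meson split_list_last)
  have "gaps n p fresh a = length (filter (\<lambda>x. D_neighbors n x a) r)"
    using gaps_count[OF p(2)] unfolding p(1) by (simp add: tick_apply)
  then have "length (filter (\<lambda>x. D_neighbors n x a) r) \<le> 1" using u(2) by simp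
  then show ?thesis
  proof (cases rule: filter_length_le_1)
    case 1
    then have "comm_equiv n (r @ a # q) (a # r @ q)"
      using p(2) by (intro comm_equiv_move) (metis commute_def D_neighbors_sym)
    then have "comm_equiv n u (p1 @ a # a # r @ q)"
      using comm_equiv_append[of n "r @ a # q" "a # r @ q" "p1 @ [a]" "[]"] u p by simp
    then show ?thesis by blast
  next
    case (2 r1 b r2)
    have "comm_equiv n (r2 @ a # q) (a # r2 @ q)"
      using p(2) 2 by (intro comm_equiv_move) (auto simp: commute_def D_neighbors_sym)
    then have 3: "comm_equiv n u (p1 @ a # r1 @ b # a # r2 @ q)"
      using comm_equiv_append[of n "r2 @ a # q" "a # r2 @ q" "p1 @ a # r1 @ [b]" "[]"] u p 2 by simp
    \<comment> \<open>The second \<open>a\<close> has moved left up to \<open>b\<close>. Now the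
      first one has to move right past \<open>r1\<close>, which is a leftward move read
      backwards.\<close>
    have "comm_equiv n (r1 @ a # b # a # r2 @ q) (a # r1 @ b # a # r2 @ q)"
      using p(2) 2 by (intro comm_equiv_move) (auto simp: commute_def D_neighbors_sym)
    then have "comm_equiv n (p1 @ r1 @ a # b # a # r2 @ q) (p1 @ a # r1 @ b # a # r2 @ q)"
      using comm_equiv_append[of n _ _ p1 "[]"] by fastforce
    from rtranclp_trans[OF 3 comm_equiv_sym[OF this]]
    have "comm_equiv n u ((p1 @ r1) @ a # b # a # r2 @ q)" by simp
    then show ?thesis using 2(2) D_neighbors_sym by blast
  qed
qed

lemma scalar_add: "scalar (a + b) = scalar a + scalar b"
  and scalar_mult: "scalar (a * b) = scalar a * scalar b"
  and scalar_one: "scalar 1 = 1"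
  and scalar_zero: "scalar 0 = 0"
  by (simp_all add: scalar_def single_add mult_single)

lemma scalar_commute: "scalar c * p = p * scalar c"
proof -
  have "scalar c * Poly_Mapping.single m b = Poly_Mapping.single m b * scalar c" for m b
    by (simp add: scalar_def mult_single mult.commute)
  then have "scalar c * (\<Sum>i\<in>A. Poly_Mapping.single i (b i)) =
      (\<Sum>i\<in>A. Poly_Mapping.single i (b i)) * scalar c" for A b
    by (simp add: sum_distrib_left sum_distrib_right)
  from this[of "Poly_Mapping.lookup p" "Poly_Mapping.keys p"] show ?thesis
    by (simp flip: poly_mapping_eq_sum_single)
qed

section \<open>Generators acting on a representation that lives in a single degree\<close>

locale rep_module =
  fixes n :: nat and \<Gamma> :: "(nat \<times> nat) set" and \<alpha> :: "nat multiset"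
    and M :: "('f::field, 'v) klr_module"
  assumes n: "4 \<le> n" and quiver: "type_D_quiver n \<Gamma>" and rep: "homogeneous_rep n \<Gamma> \<alpha> M"
begin

abbreviation "FA \<equiv> carrier (klr_free \<alpha> :: 'f klr_free_elt ring)"

definition dot :: "'f klr_free_elt \<Rightarrow> 'v \<Rightarrow> 'v" where
  "dot p x = klr_class \<Gamma> \<alpha> p \<odot>\<^bsub>M\<^esub> x"

lemma graded: "is_graded_module (klr \<Gamma> \<alpha>) (klr_component n \<Gamma> \<alpha>) M"
  using rep by (simp add: homogeneous_rep_def)

sublocale left_module "klr \<Gamma> \<alpha>" M
  using graded by (simp add: is_graded_module_def)

lemma dot_closed [simp]: "p \<in> FA \<Longrightarrow> x \<in> carrier M \<Longrightarrow> dot p x \<in> carrier M"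
  by (simp add: dot_def smult_closed)

lemma dot_add: "p \<in> FA \<Longrightarrow> q \<in> FA \<Longrightarrow> x \<in> carrier M \<Longrightarrow> dot (p + q) x = dot p x \<oplus>\<^bsub>M\<^esub> dot q x"
  by (simp add: dot_def klr_class_add smult_l_distr)

lemma dot_mult: "p \<in> FA \<Longrightarrow> q \<in> FA \<Longrightarrow> x \<in> carrier M \<Longrightarrow> dot (p * q) x = dot p (dot q x)"
  by (simp add: dot_def klr_class_mult smult_assoc)

lemma dot_one [simp]: "x \<in> carrier M \<Longrightarrow> dot 1 x = x"
  by (simp add: dot_def klr_class_one smult_one)

lemma dot_add_right:
  "p \<in> FA \<Longrightarrow> x \<in> carrier M \<Longrightarrow> z \<in> carrier M \<Longrightarrow> dot p (x \<oplus>\<^bsub>M\<^esub> z) = dot p x \<oplus>\<^bsub>M\<^esub> dot p z"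
  by (simp add: dot_def smult_r_distr)

lemma dot_zero_right [simp]: "p \<in> FA \<Longrightarrow> dot p \<zero>\<^bsub>M\<^esub> = \<zero>\<^bsub>M\<^esub>"
  using dot_add_right[of p "\<zero>\<^bsub>M\<^esub>" "\<zero>\<^bsub>M\<^esub>"] M.add.l_cancel_one[of "dot p \<zero>\<^bsub>M\<^esub>" "dot p \<zero>\<^bsub>M\<^esub>"]
  by simp

lemma dot_zero [simp]: "x \<in> carrier M \<Longrightarrow> dot 0 x = \<zero>\<^bsub>M\<^esub>"
  using dot_add[of 0 0 x] M.add.l_cancel_one[of "dot 0 x" "dot 0 x"] by simp

lemma dot_relation:
  assumes "p - q \<in> klr_relations \<Gamma> \<alpha>" "q \<in> FA" "x \<in> carrier M"
  shows "dot p x = dot q x"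
proof -
  have r: "p - q \<in> FA" using assms(1) klr_relations_in_klr_free by blast
  have ideal: "p - q \<in> klr_ideal \<Gamma> \<alpha>" using assms(1) klr_relations_in_klr_ideal by blast
  have "klr_class \<Gamma> \<alpha> ((p - q) + q) = klr_class \<Gamma> \<alpha> (p - q) \<oplus>\<^bsub>klr \<Gamma> \<alpha>\<^esub> klr_class \<Gamma> \<alpha> q"
    using r assms(2) by (rule klr_class_add)
  also have "\<dots> = klr_class \<Gamma> \<alpha> q"
    unfolding klr_class_ideal[OF ideal] using assms(2) by simp
  finally show ?thesis by (simp add: dot_def)
qed

definition deg :: int where
  "deg = (SOME d. \<forall>d'. d' \<noteq> d \<longrightarrow> component M d' = {\<zero>\<^bsub>M\<^esub>})"

lemma component_other: "d \<noteq> deg \<Longrightarrow> component M d = {\<zero>\<^bsub>M\<^esub>}"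
proof -
  have "\<exists>d. \<forall>d'. d' \<noteq> d \<longrightarrow> component M d' = {\<zero>\<^bsub>M\<^esub>}"
    using rep by (simp add: homogeneous_rep_def in_single_degree_def)
  from someI_ex[OF this] show "d \<noteq> deg \<Longrightarrow> component M d = {\<zero>\<^bsub>M\<^esub>}"
    unfolding deg_def by blast
qed

lemma component_subset: "component M d \<subseteq> carrier M"
  using graded additive_subgroup.a_subset unfolding is_graded_module_def by blast

lemma component_deg: "component M deg = carrier M"
proof
  show "carrier M \<subseteq> component M deg"
  proof
    fix x assume x: "x \<in> carrier M"
    have "\<exists>!f. (\<forall>d. f d \<in> component M d) \<and> finite {d. f d \<noteq> \<zero>\<^bsub>M\<^esub>} \<and>
        x = finsum M f {d. f d \<noteq> \<zero>\<^bsub>M\<^esub>}"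
      using graded x unfolding is_graded_module_def by blast
    then obtain f where f: "\<forall>d. f d \<in> component M d" "x = finsum M f {d. f d \<noteq> \<zero>\<^bsub>M\<^esub>}"
      by blast
    have "f d = \<zero>\<^bsub>M\<^esub>" if "d \<noteq> deg" for d
      using f(1) component_other[OF that] by blast
    moreover have "f deg \<in> carrier M" using f(1) component_subset by blast
    ultimately have "x = f deg" unfolding f(2) by (rule M.finsum_concentrated)
    then show "x \<in> component M deg" using f(1) by simp
  qed
qed (rule component_subset)

text \<open>The result lies in the component of degree d + deg, which is zero because all of M sits
  in degree deg.\<close>

lemma dot_degree:
  assumes "klr_homogeneous n \<alpha> d p" "d \<noteq> 0" "x \<in> carrier M"
  shows "dot p x = \<zero>\<^bsub>M\<^esub>"
proof -
  have "dot p x \<in> component M (d + deg)"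
    using graded assms component_deg unfolding is_graded_module_def klr_component_def dot_def by blast
  then show ?thesis using component_other[of "d + deg"] assms(2) by simp
qed

lemma dot_Y:
  assumes "1 \<le> k" "k \<le> size \<alpha>" "x \<in> carrier M"
  shows "dot (yy k) x = \<zero>\<^bsub>M\<^esub>"
  using dot_degree[OF klr_homogeneous.mult_y[OF klr_homogeneous.one assms(1,2)] _ assms(3)] by simp

abbreviation "words \<equiv> permutations_of_multiset \<alpha>"

lemma words_length: "u \<in> words \<Longrightarrow> length u = size \<alpha>"
  by (metis permutations_of_multisetD size_mset)

text \<open>The weight space of \<open>u\<close>, as the fixed points of the idempotent. It is empty
  when \<open>u\<close> is not a word of the right content, so membership carries this information
  along.\<close>

definition E :: "nat list \<Rightarrow> 'v set" where
  "E u = {x \<in> carrier M. u \<in> words \<and> dot (ee u) x = x}"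

lemma E_carrier: "x \<in> E u \<Longrightarrow> x \<in> carrier M"
  and E_words: "x \<in> E u \<Longrightarrow> u \<in> words"
  and E_dot: "x \<in> E u \<Longrightarrow> dot (ee u) x = x"
  by (auto simp: E_def)

lemma dot_E_E:
  assumes "v \<in> words" "u \<in> words" "x \<in> carrier M"
  shows "dot (ee v) (dot (ee u) x) = (if v = u then dot (ee v) x else \<zero>\<^bsub>M\<^esub>)"
proof -
  have "dot (ee v * ee u) x = dot (if v = u then ee v else 0) x"
    using assms by (intro dot_relation klr_relations.idem) auto
  then show ?thesis using assms by (simp add: dot_mult split: if_splits)
qed

lemma dot_E_in: "u \<in> words \<Longrightarrow> x \<in> carrier M \<Longrightarrow> dot (ee u) x \<in> E u"
  by (simp add: E_def dot_E_E)

lemma dot_E_other: "x \<in> E u \<Longrightarrow> v \<in> words \<Longrightarrow> v \<noteq> u \<Longrightarrow> dot (ee v) x = \<zero>\<^bsub>M\<^esub>"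
  using dot_E_E[of v u x] by (simp add: E_def)

lemma exists_E:
  assumes "x \<in> carrier M" "x \<noteq> \<zero>\<^bsub>M\<^esub>"
  shows "\<exists>u\<in>words. dot (ee u) x \<noteq> \<zero>\<^bsub>M\<^esub>"
proof (rule ccontr)
  assume contra: "\<not> ?thesis"
  have "dot (\<Sum>u\<in>A. ee u) x = \<zero>\<^bsub>M\<^esub>" if "finite A" "A \<subseteq> words" for A
    using that
  proof (induction A rule: finite_induct)
    case (insert u A)
    have "(\<Sum>u\<in>A. ee u) \<in> FA" using insert.prems by (intro sum_in_klr_free) auto
    then show ?case using insert contra assms(1) by (simp add: dot_add)
  qed (use assms in simp)
  then have "dot (\<Sum>u\<in>words. ee u) x = \<zero>\<^bsub>M\<^esub>" by simp
  moreover have "dot (\<Sum>u\<in>words. ee u) x = dot 1 x"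
    using assms by (intro dot_relation klr_relations.unit) auto
  ultimately show False using assms by simp
qed

lemma dot_Psi_in:
  assumes "x \<in> E u" "1 \<le> k" "k < size \<alpha>"
  shows "dot (\<psi> k) x \<in> E (swap_at k u)"
proof -
  have u: "u \<in> words" "x \<in> carrier M" "dot (ee u) x = x" using assms by (auto simp: E_def)
  have sw: "swap_at k u \<in> words" using swap_at_permutation u assms by blast
  have "dot (\<psi> k * ee u) x = dot (ee (swap_at k u) * \<psi> k) x"
    using u sw assms by (intro dot_relation klr_relations.psi_e) auto
  then have "dot (\<psi> k) x = dot (ee (swap_at k u)) (dot (\<psi> k) x)"
    using u sw assms by (simp add: dot_mult)
  then show ?thesis using u sw assms by (simp add: E_def)
qed

lemma dot_Psi_zero:
  assumes "x \<in> E u" "1 \<le> k" "k < size \<alpha>" "\<not> admissible_swap n k u"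
  shows "dot (\<psi> k) x = \<zero>\<^bsub>M\<^esub>"
proof -
  have u: "u \<in> words" "x \<in> carrier M" "dot (ee u) x = x" using assms by (auto simp: E_def)
  \<comment> \<open>The summand 0 and the factor 1 match the rule \<open>mult_psi\<close> applied to
    \<open>one\<close>. A swap that is not admissible exchanges equal letters or neighbors, so the
    degree is -2 or 1.\<close>
  have "klr_homogeneous n \<alpha> (psi_degree n k u + 0) (\<psi> k * ee u * 1 :: 'f klr_free_elt)"
    using u assms by (intro klr_homogeneous.mult_psi klr_homogeneous.one)
  moreover have "psi_degree n k u + 0 \<noteq> 0"
    using assms words_length[OF u(1)] by (auto simp: psi_degree_def admissible_swap_def)
  ultimately have "dot (\<psi> k * ee u * 1) x = \<zero>\<^bsub>M\<^esub>" using u(2) by (rule dot_degree)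
  then show ?thesis using u assms by (simp add: dot_mult)
qed

lemma arrow_neighbors:
  assumes "(a, b) \<in> \<Gamma> \<or> (b, a) \<in> \<Gamma>"
  shows "D_neighbors n a b"
  using assms quiver unfolding type_D_quiver_def by blast

lemma vertices: "u \<in> words \<Longrightarrow> set u \<subseteq> {1..n}"
proof -
  assume "u \<in> words"
  then have "set u = set_mset \<alpha>" by (metis permutations_of_multisetD set_mset_mset)
  then show ?thesis using rep by (simp add: homogeneous_rep_def Q_plus_def D_vertices_def)
qed

lemma dot_Psi_Psi:
  assumes "x \<in> E u" "admissible_swap n k u"
  shows "dot (\<psi> k) (dot (\<psi> k) x) = x"
proof -
  have u: "u \<in> words" "x \<in> carrier M" "dot (ee u) x = x" using assms by (auto simp: E_def)
  have k: "1 \<le> k" "k < size \<alpha>" and ne: "letter u k \<noteq> letter u (k + 1)"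
    "\<not> D_neighbors n (letter u k) (letter u (k + 1))"
    using assms words_length[OF u(1)] by (auto simp: admissible_swap_def)
  then have "(letter u k, letter u (k + 1)) \<notin> \<Gamma>" "(letter u (k + 1), letter u k) \<notin> \<Gamma>"
    using arrow_neighbors by blast+
  then have "dot (\<psi> k * \<psi> k * ee u) x = dot (ee u) x"
    using klr_relations.psi_sq[OF u(1) k, of \<Gamma>] u(1,2) ne by (intro dot_relation) auto
  then show ?thesis using u k by (simp add: dot_mult)
qed

lemma dot_Psi_nonzero:
  assumes "x \<in> E u" "admissible_swap n k u" "x \<noteq> \<zero>\<^bsub>M\<^esub>"
  shows "dot (\<psi> k) x \<noteq> \<zero>\<^bsub>M\<^esub>"
proof -
  have "1 \<le> k" "k < size \<alpha>"
    using assms words_length[OF E_words[OF assms(1)]] by (auto simp: admissible_swap_def)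
  then show ?thesis using dot_Psi_Psi[OF assms(1,2)] assms(3) by auto
qed

lemma dot_Psi_far:
  assumes "x \<in> carrier M" "1 \<le> k" "k < size \<alpha>" "1 \<le> l" "l < size \<alpha>" "k + 1 < l \<or> l + 1 < k"
  shows "dot (\<psi> k) (dot (\<psi> l) x) = dot (\<psi> l) (dot (\<psi> k) x)"
proof -
  have "dot (\<psi> k * \<psi> l) x = dot (\<psi> l * \<psi> k) x"
    using assms by (intro dot_relation klr_relations.psi_far) auto
  then show ?thesis using assms by (simp add: dot_mult)
qed

lemma dot_eq_sub:
  assumes "p \<in> FA" "q \<in> FA" "x \<in> carrier M"
  shows "dot (p - q) x \<oplus>\<^bsub>M\<^esub> dot q x = dot p x"
  using dot_add[of "p - q" q x] assms by simp

lemma dot_braid: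
  assumes "x \<in> E u" "1 \<le> k" "k + 1 < size \<alpha>" "letter u (k + 2) \<noteq> letter u k"
  shows "dot (\<psi> (k + 1)) (dot (\<psi> k) (dot (\<psi> (k + 1)) x)) = dot (\<psi> k) (dot (\<psi> (k + 1)) (dot (\<psi> k) x))"
proof -
  have u: "u \<in> words" "x \<in> carrier M" "dot (ee u) x = x" using assms by (auto simp: E_def)
  let ?a = "\<psi> (k + 1) * \<psi> k * \<psi> (k + 1) :: 'f klr_free_elt"
  let ?b = "\<psi> k * \<psi> (k + 1) * \<psi> k :: 'f klr_free_elt"
  have ab: "?a \<in> FA" "?b \<in> FA" using assms by auto
  have "dot ((?a - ?b) * ee u) x = dot 0 x"
    using klr_relations.braid[OF u(1) assms(2,3), of \<Gamma>] assms(4) u(2) by (intro dot_relation) auto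
  then have "dot (?a - ?b) x = \<zero>\<^bsub>M\<^esub>" using u ab by (simp add: dot_mult)
  then have "dot ?a x = dot ?b x" using dot_eq_sub[OF ab u(2)] ab u(2) by simp
  then show ?thesis using u assms by (simp add: dot_mult)
qed

text \<open>For equal letters the relation \<open>y_psi\<close> writes \<open>x\<close> as a
  combination of terms that contain some \<open>yy k\<close>, and these act by 0.\<close>

lemma E_no_equal:
  assumes "x \<in> E u" "x \<noteq> \<zero>\<^bsub>M\<^esub>" "1 \<le> k" "k < size \<alpha>"
  shows "letter u k \<noteq> letter u (k + 1)"
proof
  assume eq: "letter u k = letter u (k + 1)"
  have u: "u \<in> words" "x \<in> carrier M" "dot (ee u) x = x" using assms by (auto simp: E_def)
  let ?a = "yy (k + 1) * \<psi> k :: 'f klr_free_elt"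
  let ?b = "\<psi> k * yy k :: 'f klr_free_elt"
  have ab: "?a \<in> FA" "?b \<in> FA" using assms by auto
  have "dot ((?a - ?b) * ee u) x = dot (ee u) x"
    using klr_relations.y_psi[OF u(1) assms(3,4), of \<Gamma>] eq u(1,2) by (intro dot_relation) auto
  then have "dot (?a - ?b) x = x" using u ab by (simp add: dot_mult)
  moreover have "dot ?a x = \<zero>\<^bsub>M\<^esub>" "dot ?b x = \<zero>\<^bsub>M\<^esub>"
    using u assms by (simp_all add: dot_mult dot_Y)
  ultimately show False using dot_eq_sub[OF ab u(2)] u(2) assms(2) by simp
qed

text \<open>In a factor a b a neither of the two swaps is admissible, so both triple products kill
  \<open>x\<close>, whereas the braid relation makes their difference \<open>x\<close> or its
  negative.\<close>

lemma E_no_braid: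
  assumes "x \<in> E u" "x \<noteq> \<zero>\<^bsub>M\<^esub>" "1 \<le> k" "k + 1 < size \<alpha>"
    and nb: "D_neighbors n (letter u k) (letter u (k + 1))"
  shows "letter u (k + 2) \<noteq> letter u k"
proof
  assume eq: "letter u (k + 2) = letter u k"
  have u: "u \<in> words" "x \<in> carrier M" "dot (ee u) x = x" using assms by (auto simp: E_def)
  have len: "length u = size \<alpha>" by (rule words_length[OF u(1)])
  have "letter u k \<in> set u" "letter u (k + 1) \<in> set u"
    using assms(3,4) len by (simp_all add: letter_def)
  then have letters: "letter u k \<in> D_vertices n" "letter u (k + 1) \<in> D_vertices n"
    using vertices[OF u(1)] unfolding D_vertices_def by blast+
  let ?a = "\<psi> (k + 1) * \<psi> k * \<psi> (k + 1) :: 'f klr_free_elt"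
  let ?b = "\<psi> k * \<psi> (k + 1) * \<psi> k :: 'f klr_free_elt"
  have ab: "?a \<in> FA" "?b \<in> FA" using assms by auto
  have "\<not> admissible_swap n k u" "\<not> admissible_swap n (k + 1) u"
    using nb eq D_neighbors_sym[of n] by (auto simp: admissible_swap_def)
  then have "dot (\<psi> k) x = \<zero>\<^bsub>M\<^esub>" "dot (\<psi> (k + 1)) x = \<zero>\<^bsub>M\<^esub>"
    using dot_Psi_zero[OF assms(1)] assms(3,4) by auto
  then have "dot ?a x = \<zero>\<^bsub>M\<^esub>" "dot ?b x = \<zero>\<^bsub>M\<^esub>"
    using u assms by (simp_all add: dot_mult)
  then have ab0: "dot (?a - ?b) x = \<zero>\<^bsub>M\<^esub>"
    using dot_eq_sub[OF ab u(2)] ab u(2) by simp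
  have "(letter u k, letter u (k + 1)) \<in> \<Gamma> \<or> (letter u (k + 1), letter u k) \<in> \<Gamma>"
    using quiver nb letters unfolding type_D_quiver_def by blast
  then consider "(letter u k, letter u (k + 1)) \<in> \<Gamma>"
    | "(letter u k, letter u (k + 1)) \<notin> \<Gamma>" "(letter u (k + 1), letter u k) \<in> \<Gamma>" by blast
  then have "dot (ee u) x = \<zero>\<^bsub>M\<^esub>"
  proof cases
    case 1
    then have "dot ((?a - ?b) * ee u) x = dot (ee u) x"
      using klr_relations.braid[OF u(1) assms(3,4), of \<Gamma>] eq u(1,2) by (intro dot_relation) auto
    then show ?thesis using ab0 u ab by (simp add: dot_mult)
  next
    case 2
    then have "dot ((?a - ?b) * ee u) x = dot (- ee u) x"
      using klr_relations.braid[OF u(1) assms(3,4), of \<Gamma>] eq u(1,2) by (intro dot_relation) auto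
    then have "dot (- ee u) x = \<zero>\<^bsub>M\<^esub>" using ab0 u ab by (simp add: dot_mult)
    then show ?thesis using dot_add[of "- ee u" "ee u" x] u by simp
  qed
  then show False using u assms(2) by simp
qed

text \<open>An admissible \<open>\<psi> r\<close> is its own inverse between weight spaces, so it
  keeps vectors nonzero.\<close>

lemma E_comm_equiv:
  assumes "comm_equiv n u v" "x \<in> E u" "x \<noteq> \<zero>\<^bsub>M\<^esub>"
  shows "\<exists>y\<in>E v. y \<noteq> \<zero>\<^bsub>M\<^esub>"
  using assms(1)
proof (induction rule: rtranclp_induct)
  case (step v v')
  obtain y where y: "y \<in> E v" "y \<noteq> \<zero>\<^bsub>M\<^esub>" using step.IH by blast
  obtain r where r: "admissible_swap n r v" "v' = swap_at r v"
    using step.hyps(2) by (auto simp: comm_step_iff)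
  have "1 \<le> r" "r < size \<alpha>"
    using r(1) words_length[OF E_words[OF y(1)]] by (auto simp: admissible_swap_def)
  then have "dot (\<psi> r) y \<in> E v'" unfolding r(2) by (rule dot_Psi_in[OF y(1)])
  moreover have "dot (\<psi> r) y \<noteq> \<zero>\<^bsub>M\<^esub>" by (rule dot_Psi_nonzero[OF y(1) r(1) y(2)])
  ultimately show ?case by blast
qed (use assms in blast)

lemma E_homogeneous:
  assumes "x \<in> E u" "x \<noteq> \<zero>\<^bsub>M\<^esub>"
  shows "homogeneous_word n u"
proof (rule ccontr)
  assume "\<not> ?thesis"
  from not_homogeneous_comm_equiv[OF this] show False
  proof (elim disjE exE conjE)
    fix p a q assume "comm_equiv n u (p @ a # a # q)"
    from E_comm_equiv[OF this assms] obtain y where y: "y \<in> E (p @ a # a # q)" "y \<noteq> \<zero>\<^bsub>M\<^esub>" by blast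
    then show False
      using E_no_equal[OF y, of "length p + 1"] words_length[OF E_words[OF y(1)]]
      by (simp add: letter_def nth_append)
  next
    fix p a b q assume "comm_equiv n u (p @ a # b # a # q)" and nb: "D_neighbors n a b"
    from E_comm_equiv[OF this(1) assms] obtain y where
      y: "y \<in> E (p @ a # b # a # q)" "y \<noteq> \<zero>\<^bsub>M\<^esub>" by blast
    then show False
      using E_no_braid[OF y, of "length p + 1"] words_length[OF E_words[OF y(1)]] nb
      by (simp add: letter_def nth_append)
  qed
qed

end

subsection \<open>Independence of paths\<close>

text \<open>
  Any family of operators \<open>\<psi>\<^sub>k\<close> that are involutions on admissible swaps and satisfy the far and braid
  relations transports vectors along paths in the weight graph in a way that depends on the end
  points only. Orienting the swaps by descents gives a terminating and locally confluent rewriting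
  system, and Newman's lemma applies.
\<close>

fun weight :: "nat list \<Rightarrow> nat" where
  "weight [] = 0"
| "weight (a # u) = length (a # u) * a + weight u"

text \<open>A letter counts as often as there are letters from it to the end, so moving the larger
  letter to the right lowers the total by the difference of the two.\<close>

lemma weight_swap: "b < a \<Longrightarrow> weight (p @ b # a # q) < weight (p @ a # b # q)"
  by (induction p) (auto simp: algebra_simps)

lemma weight_swap_at:
  assumes "admissible_swap n k u" "letter u (k + 1) < letter u k"
  shows "weight (swap_at k u) < weight u"
proof -
  obtain p a b q where u: "u = p @ a # b # q" "length p = k - 1" "swap_at k u = p @ b # a # q"
    using admissible_swapE[OF assms(1)] by metis
  have "1 \<le> k" using assms(1) by (simp add: admissible_swap_def)
  then have "letter u k = a" "letter u (k + 1) = b"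
    using u(2) unfolding u(1) by (auto simp: letter_def nth_append)
  then show ?thesis using weight_swap[of b a p q] assms(2) u(1,3) by simp
qed

locale transport =
  fixes n :: nat and E :: "nat list \<Rightarrow> 'v set" and op :: "nat \<Rightarrow> 'v \<Rightarrow> 'v"
  assumes n: "3 \<le> n"
    and op_in: "x \<in> E u \<Longrightarrow> admissible_swap n k u \<Longrightarrow> op k x \<in> E (swap_at k u)"
    and op_op: "x \<in> E u \<Longrightarrow> admissible_swap n k u \<Longrightarrow> op k (op k x) = x"
    and op_far: "x \<in> E u \<Longrightarrow> admissible_swap n k u \<Longrightarrow> admissible_swap n l u \<Longrightarrow> k + 1 < l \<Longrightarrow>
      op k (op l x) = op l (op k x)"
    and op_braid: "x \<in> E u \<Longrightarrow> 1 \<le> k \<Longrightarrow> k + 1 < length u \<Longrightarrow> letter u (k + 2) \<noteq> letter u k \<Longrightarrow>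
      op (k + 1) (op k (op (k + 1) x)) = op k (op (k + 1) (op k x))"
begin

text \<open>A state couples a word with a vector of its weight space; confluence on states then
  compares the vectors produced by different paths.\<close>

definition step :: "nat list \<times> 'v \<Rightarrow> nat list \<times> 'v \<Rightarrow> bool" where
  "step s t \<longleftrightarrow> (\<exists>u x k. s = (u, x) \<and> x \<in> E u \<and> admissible_swap n k u \<and> t = (swap_at k u, op k x))"

definition down :: "nat list \<times> 'v \<Rightarrow> nat list \<times> 'v \<Rightarrow> bool" where
  "down s t \<longleftrightarrow> (\<exists>u x k. s = (u, x) \<and> x \<in> E u \<and> admissible_swap n k u \<and>
     letter u (k + 1) < letter u k \<and> t = (swap_at k u, op k x))"

lemma downI:
  "x \<in> E u \<Longrightarrow> admissible_swap n k u \<Longrightarrow> letter u (k + 1) < letter u k \<Longrightarrow> down (u, x) (swap_at k u, op k x)"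
  by (auto simp: down_def)

lemma down_weight: "down s t \<Longrightarrow> weight (fst t) < weight (fst s)"
  using weight_swap_at by (auto simp: down_def)

lemma descents_local_confluence_adjacent:
  assumes x: "x \<in> E u" and k: "admissible_swap n k u" "letter u (k + 1) < letter u k"
    and l: "admissible_swap n (k + 1) u" "letter u (k + 2) < letter u (k + 1)"
  shows "\<exists>t. down\<^sup>*\<^sup>* (swap_at k u, op k x) t \<and> down\<^sup>*\<^sup>* (swap_at (k + 1) u, op (k + 1) x) t"
proof -
  define a b c where "a = letter u k" "b = letter u (k + 1)" "c = letter u (k + 2)"
  note abc = this
  have k': "1 \<le> k" "k + 1 < length u" using k(1) l(1) by (auto simp: admissible_swap_def)
  have ab: "commute n a b" and bc: "commute n b c" and lt: "c < b" "b < a"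
    using k l by (auto simp: admissible_swap_iff abc numeral_2_eq_2)
  \<comment> \<open>The only place where the shape of the diagram enters. If \<open>a\<close> and
    \<open>c\<close> were neighbors with \<open>b\<close> between them, then a = n and c = n - 2,
    hence b = n - 1, which is a neighbor of n - 2 and does not commute with
    \<open>c\<close>.\<close>
  have ac: "commute n a c"
  proof -
    have "\<not> D_neighbors n a c"
    proof
      assume "D_neighbors n a c"
      then have "a = n" "c = n - 2" using lt unfolding D_neighbors_iff by linarith+
      then have "D_neighbors n b c" using lt n unfolding D_neighbors_iff by linarith
      then show False using bc by (simp add: commute_def)
    qed
    then show ?thesis using lt by (simp add: commute_def)
  qed
  have adm: "admissible_swap n j v \<longleftrightarrow> commute n (letter v j) (letter v (j + 1))"
    if "length v = length u" "j = k \<or> j = k + 1" for v j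
    using that k' by (auto simp: admissible_swap_iff)
  let ?u1 = "swap_at k u" and ?u2 = "swap_at (k + 1) u"
  let ?x1 = "op k x" and ?x2 = "op (k + 1) x"
  have u1: "letter ?u1 k = b" "letter ?u1 (k + 1) = a" "letter ?u1 (k + 2) = c"
    and u2: "letter ?u2 k = a" "letter ?u2 (k + 1) = c" "letter ?u2 (k + 2) = b"
    using k' by (simp_all add: letter_swap_at abc)
  have x1: "?x1 \<in> E ?u1" and x2: "?x2 \<in> E ?u2" using op_in x k l by blast+
  let ?u12 = "swap_at (k + 1) ?u1" and ?u21 = "swap_at k ?u2"
  have adm1: "admissible_swap n (k + 1) ?u1" and adm2: "admissible_swap n k ?u2"
    using ac u1 u2 by (simp_all add: adm)
  have d1: "down (?u1, ?x1) (?u12, op (k + 1) ?x1)"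
    using x1 adm1 u1 lt by (intro downI) simp_all
  have d2: "down (?u2, ?x2) (?u21, op k ?x2)"
    using x2 adm2 u2 lt by (intro downI) simp_all
  have x12: "op (k + 1) ?x1 \<in> E ?u12" and x21: "op k ?x2 \<in> E ?u21"
    using op_in x1 x2 adm1 adm2 by blast+
  have u12: "letter ?u12 k = b" "letter ?u12 (k + 1) = c"
    and u21: "letter ?u21 (k + 1) = a" "letter ?u21 (k + 2) = b"
    using k' u1 u2 by (simp_all add: letter_swap_at)
  have d12: "down (?u12, op (k + 1) ?x1) (swap_at k ?u12, op k (op (k + 1) ?x1))"
    using x12 u12 bc lt by (intro downI) (simp_all add: adm)
  have d21: "down (?u21, op k ?x2) (swap_at (k + 1) ?u21, op (k + 1) (op k ?x2))"
    using x21 u21 ab lt by (intro downI) (simp_all add: adm)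
  have "swap_at (k + 1) ?u21 = swap_at k ?u12" using swap_at_braid k' by simp
  moreover have "op (k + 1) (op k ?x2) = op k (op (k + 1) ?x1)"
    using op_braid[OF x k'] lt by (simp add: abc)
  ultimately have "down\<^sup>*\<^sup>* (?u2, ?x2) (swap_at k ?u12, op k (op (k + 1) ?x1))"
    using d2 d21 by (metis converse_rtranclp_into_rtranclp rtranclp.rtrancl_refl)
  moreover have "down\<^sup>*\<^sup>* (?u1, ?x1) (swap_at k ?u12, op k (op (k + 1) ?x1))"
    using d1 d12 by (metis converse_rtranclp_into_rtranclp rtranclp.rtrancl_refl)
  ultimately show ?thesis by blast
qed

lemma descents_local_confluence_far:
  assumes x: "x \<in> E u" and k: "admissible_swap n k u" "letter u (k + 1) < letter u k"
    and l: "admissible_swap n l u" "letter u (l + 1) < letter u l" and far: "k + 1 < l"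
  shows "\<exists>t. down\<^sup>*\<^sup>* (swap_at k u, op k x) t \<and> down\<^sup>*\<^sup>* (swap_at l u, op l x) t"
proof -
  have kl: "1 \<le> k" "k < length u" "1 \<le> l" "l < length u" using k l by (auto simp: admissible_swap_def)
  have adm: "admissible_swap n l (swap_at k u)" "admissible_swap n k (swap_at l u)"
    using admissible_swap_far[of l u k n] admissible_swap_far[of k u l n] kl far k l by auto
  have "down (swap_at k u, op k x) (swap_at l (swap_at k u), op l (op k x))"
    using op_in[OF x k(1)] adm l(2) kl far by (intro downI) (simp_all add: letter_swap_at)
  moreover have "down (swap_at l u, op l x) (swap_at k (swap_at l u), op k (op l x))"
    using op_in[OF x l(1)] adm k(2) kl far by (intro downI) (simp_all add: letter_swap_at)
  moreover have "swap_at k (swap_at l u) = swap_at l (swap_at k u)"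
    using kl far by (intro swap_at_far) auto
  moreover have "op k (op l x) = op l (op k x)" using op_far x k(1) l(1) far by blast
  ultimately show ?thesis by (metis r_into_rtranclp)
qed

lemma down_local_confluence:
  assumes "down s s1" "down s s2"
  shows "\<exists>t. down\<^sup>*\<^sup>* s1 t \<and> down\<^sup>*\<^sup>* s2 t"
proof -
  obtain u x k where k: "s = (u, x)" "x \<in> E u" "admissible_swap n k u" "letter u (k + 1) < letter u k"
    "s1 = (swap_at k u, op k x)" using assms(1) by (auto simp: down_def)
  obtain l where l: "admissible_swap n l u" "letter u (l + 1) < letter u l"
    "s2 = (swap_at l u, op l x)" using assms(2) k(1) by (auto simp: down_def)
  consider "k = l" | "l = k + 1" | "k = l + 1" | "k + 1 < l" | "l + 1 < k" by linarith
  then show ?thesis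
  proof cases
    case 1
    then show ?thesis using k l by blast
  next
    case 2
    then show ?thesis using descents_local_confluence_adjacent[OF k(2-4)] k(5) l by simp
  next
    case 3
    then show ?thesis using descents_local_confluence_adjacent[OF k(2) l(1,2)] k l by auto
  next
    case 4
    then show ?thesis using descents_local_confluence_far[OF k(2-4) l(1,2)] k(5) l(3) by simp
  next
    case 5
    then show ?thesis using descents_local_confluence_far[OF k(2) l(1,2) k(3,4)] k(5) l(3) by auto
  qed
qed

definition nf :: "nat list \<times> 'v \<Rightarrow> nat list \<times> 'v \<Rightarrow> bool" where
  "nf s z \<longleftrightarrow> down\<^sup>*\<^sup>* s z \<and> (\<forall>t. \<not> down z t)"

lemma nf_exists: "\<exists>z. nf s z"
proof (induction "weight (fst s)" arbitrary: s rule: less_induct)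
  case less
  show ?case
  proof (cases "\<exists>t. down s t")
    case True
    then obtain t where t: "down s t" by blast
    then obtain z where "nf t z" using less[of t] down_weight by blast
    then show ?thesis using t unfolding nf_def by (meson converse_rtranclp_into_rtranclp)
  next
    case False
    then have "nf s s" by (simp add: nf_def)
    then show ?thesis by blast
  qed
qed

text \<open>Newman's lemma by induction on the weight: two first descents are joined by local
  confluence, and the hypothesis at their targets identifies both normal forms with one of the
  common reduct.\<close>

lemma nf_unique: "nf s z1 \<Longrightarrow> nf s z2 \<Longrightarrow> z1 = z2"
proof (induction "weight (fst s)" arbitrary: s z1 z2 rule: less_induct)
  case less
  show ?case
  proof (cases "\<exists>t. down s t")
    case False
    then show ?thesis using less.prems unfolding nf_def by (metis converse_rtranclpE)
  next
    case True
    then obtain s1 s2 where s: "down s s1" "nf s1 z1" "down s s2" "nf s2 z2"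
      using less.prems unfolding nf_def by (metis converse_rtranclpE)
    obtain t where t: "down\<^sup>*\<^sup>* s1 t" "down\<^sup>*\<^sup>* s2 t" using down_local_confluence[OF s(1,3)] by blast
    obtain z where "nf t z" using nf_exists by blast
    then have "nf s1 z" "nf s2 z" using t unfolding nf_def by (meson rtranclp_trans)+
    then have "z1 = z" "z2 = z"
      using less.hyps[OF down_weight[OF s(1)] s(2)] less.hyps[OF down_weight[OF s(3)] s(4)] by blast+
    then show ?thesis by simp
  qed
qed

text \<open>A step that is not a descent is reversed by one, since the operators are
  involutions.\<close>

lemma step_nf:
  assumes "step s t"
  shows "nf s z \<longleftrightarrow> nf t z"
proof -
  obtain u x k where k: "s = (u, x)" "x \<in> E u" "admissible_swap n k u" "t = (swap_at k u, op k x)"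
    using assms by (auto simp: step_def)
  have k': "1 \<le> k" "k < length u" "letter u k \<noteq> letter u (k + 1)" using k(3) by (auto simp: admissible_swap_def)
  have nf: "nf s' z \<longleftrightarrow> nf t' z" if "down s' t'" for s' t'
    using that nf_exists[of t'] nf_unique unfolding nf_def
    by (metis converse_rtranclp_into_rtranclp nf_def)
  show ?thesis
  proof (cases "letter u (k + 1) < letter u k")
    case True
    then show ?thesis using nf downI k by simp
  next
    case False
    then have "down (swap_at k u, op k x) (swap_at k (swap_at k u), op k (op k x))"
      using k k' op_in by (intro downI) (simp_all add: letter_swap_at)
    then have "down t s" using k k' op_op swap_at_swap_at by simp
    then show ?thesis using nf by blast
  qed
qed

lemma steps_nf: "step\<^sup>*\<^sup>* s t \<Longrightarrow> nf s z \<longleftrightarrow> nf t z"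
  by (induction rule: rtranclp_induct) (auto simp: step_nf)

lemma down_E: "down\<^sup>*\<^sup>* s t \<Longrightarrow> snd s \<in> E (fst s) \<Longrightarrow> snd t \<in> E (fst t)"
  by (induction rule: rtranclp_induct) (auto simp: down_def op_in)

text \<open>Which descents are available depends on the word alone, so a path can be replayed with
  another vector of the same weight space. As each operator is injective, equal results force equal
  starts.\<close>

lemma down_lift:
  assumes "down\<^sup>*\<^sup>* s t" "snd s \<in> E (fst s)" "y \<in> E (fst s)"
  shows "\<exists>y'. down\<^sup>*\<^sup>* (fst s, y) (fst t, y') \<and> (y' = snd t \<longrightarrow> y = snd s)"
  using assms(1)
proof (induction rule: rtranclp_induct)
  case (step t t')
  then obtain y' where y': "down\<^sup>*\<^sup>* (fst s, y) (fst t, y')" "y' = snd t \<longrightarrow> y = snd s" by blast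
  have E: "y' \<in> E (fst t)" "snd t \<in> E (fst t)"
    using down_E[OF y'(1)] down_E[OF step.hyps(1)] assms by auto
  obtain k where k: "admissible_swap n k (fst t)" "letter (fst t) (k + 1) < letter (fst t) k"
    "t' = (swap_at k (fst t), op k (snd t))"
    using step.hyps(2) by (auto simp: down_def)
  have "down (fst t, y') (fst t', op k y')" using downI[OF E(1) k(1,2)] k(3) by simp
  moreover have "op k y' = snd t' \<longrightarrow> y' = snd t" using op_op E k(1,3) by (metis snd_conv)
  ultimately show ?case using y' by (meson rtranclp.rtrancl_into_rtrancl)
qed auto

text \<open>Both states have the same normal form. Replaying the descent of the first from the
  second vector ends in a normal form too, hence in the same vector, and \<open>down_lift\<close>
  cancels the path.\<close>

lemma steps_unique:
  assumes "step\<^sup>*\<^sup>* s (u, y)" "step\<^sup>*\<^sup>* s (u, y')" "y \<in> E u" "y' \<in> E u"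
  shows "y = y'"
proof -
  obtain z where z: "nf (u, y) z" using nf_exists by blast
  have z': "nf (u, y') z" using steps_nf[OF assms(1)] steps_nf[OF assms(2)] z by blast
  have "down\<^sup>*\<^sup>* (u, y) z" using z by (simp add: nf_def)
  from down_lift[OF this, of y'] obtain t where
    t: "down\<^sup>*\<^sup>* (u, y') (fst z, t)" "t = snd z \<longrightarrow> y' = y" using assms by auto
  have E: "snd z \<in> E (fst z)" "t \<in> E (fst z)"
    using down_E[OF \<open>down\<^sup>*\<^sup>* (u, y) z\<close>] down_E[OF t(1)] assms by auto
  have "\<not> down (fst z, t) r" for r
  proof
    assume "down (fst z, t) r"
    then obtain k where "admissible_swap n k (fst z)" "letter (fst z) (k + 1) < letter (fst z) k"
      by (auto simp: down_def)
    from downI[OF E(1) this] show False using z unfolding nf_def by simp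
  qed
  then have "nf (u, y') (fst z, t)" using t(1) by (simp add: nf_def)
  then have "(fst z, t) = z" using nf_unique z' by blast
  then show ?thesis using t(2) by (metis snd_conv)
qed

lemma steps_E: "step\<^sup>*\<^sup>* s t \<Longrightarrow> snd s \<in> E (fst s) \<Longrightarrow> snd t \<in> E (fst t)"
  by (induction rule: rtranclp_induct) (auto simp: step_def op_in)

lemma steps_exist:
  assumes "comm_equiv n w u" "x \<in> E w"
  shows "\<exists>y. step\<^sup>*\<^sup>* (w, x) (u, y)"
  using assms(1)
proof (induction rule: rtranclp_induct)
  case (step u v)
  then obtain y where y: "step\<^sup>*\<^sup>* (w, x) (u, y)" by blast
  obtain k where k: "admissible_swap n k u" "v = swap_at k u"
    using step.hyps(2) by (auto simp: comm_step_iff)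
  have "y \<in> E u" using steps_E[OF y] assms(2) by simp
  then have "step (u, y) (v, op k y)" using k by (auto simp: step_def)
  with y show ?case by (meson rtranclp.rtrancl_into_rtrancl)
qed blast

lemma transport_exists:
  assumes "x \<in> E w"
  shows "\<exists>v. v w = x \<and> (\<forall>u. comm_equiv n w u \<longrightarrow> v u \<in> E u) \<and>
    (\<forall>u k. comm_equiv n w u \<longrightarrow> admissible_swap n k u \<longrightarrow> op k (v u) = v (swap_at k u))"
proof -
  define v where "v u = (SOME y. step\<^sup>*\<^sup>* (w, x) (u, y))" for u
  have v: "step\<^sup>*\<^sup>* (w, x) (u, v u)" if "comm_equiv n w u" for u
    unfolding v_def using steps_exist[OF that assms] by (rule someI_ex)
  have vE: "v u \<in> E u" if "comm_equiv n w u" for u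
    using steps_E[OF v[OF that]] assms by simp
  have "v w = x"
    using steps_unique[OF v[of w], of x] vE[of w] assms by simp
  moreover have "op k (v u) = v (swap_at k u)" if u: "comm_equiv n w u" and k: "admissible_swap n k u" for u k
  proof -
    have u': "comm_equiv n w (swap_at k u)"
      using u k by (meson comm_step_iff rtranclp.rtrancl_into_rtrancl)
    have "step (u, v u) (swap_at k u, op k (v u))" using vE[OF u] k by (auto simp: step_def)
    then have "step\<^sup>*\<^sup>* (w, x) (swap_at k u, op k (v u))" using v[OF u] by (meson rtranclp.rtrancl_into_rtrancl)
    from steps_unique[OF this v[OF u'] op_in[OF vE[OF u] k] vE[OF u']] show ?thesis .
  qed
  ultimately show ?thesis using vE by blast
qed

end

section \<open>Classification\<close>

context rep_module
begin

lemma dot_finsum: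
  assumes "finite A" "p \<in> FA" "\<And>i. i \<in> A \<Longrightarrow> h i \<in> carrier M"
  shows "dot p (finsum M h A) = finsum M (\<lambda>i. dot p (h i)) A"
  using assms(1,3)
proof (induction A rule: finite_induct)
  case (insert i A)
  have c: "h \<in> A \<rightarrow> carrier M" "(\<lambda>i. dot p (h i)) \<in> A \<rightarrow> carrier M" "h i \<in> carrier M"
    using insert.prems assms(2) by auto
  have "dot p (finsum M h (insert i A)) = dot p (h i \<oplus>\<^bsub>M\<^esub> finsum M h A)"
    using insert.hyps c by (simp add: M.finsum_insert)
  also have "\<dots> = dot p (h i) \<oplus>\<^bsub>M\<^esub> finsum M (\<lambda>i. dot p (h i)) A"
    using insert c assms(2) by (simp add: dot_add_right)
  also have "\<dots> = finsum M (\<lambda>i. dot p (h i)) (insert i A)"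
    using insert.hyps c assms(2) by (simp add: M.finsum_insert)
  finally show ?case .
qed (use assms(2) in simp)

lemma transport: "transport n E (\<lambda>k. dot (\<psi> k))"
proof
  fix x u k l
  show "3 \<le> n" using n by simp
  assume x: "x \<in> E u"
  then have len: "length u = size \<alpha>" using E_words words_length by blast
  show "dot (\<psi> k) x \<in> E (swap_at k u)" if "admissible_swap n k u"
    using dot_Psi_in[OF x] that len by (simp add: admissible_swap_def)
  show "dot (\<psi> k) (dot (\<psi> k) x) = x" if "admissible_swap n k u"
    using dot_Psi_Psi[OF x that] .
  show "dot (\<psi> k) (dot (\<psi> l) x) = dot (\<psi> l) (dot (\<psi> k) x)"
    if "admissible_swap n k u" "admissible_swap n l u" "k + 1 < l"
    using dot_Psi_far[of x k l] E_carrier[OF x] that len by (simp add: admissible_swap_def)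
  show "dot (\<psi> (k + 1)) (dot (\<psi> k) (dot (\<psi> (k + 1)) x)) = dot (\<psi> k) (dot (\<psi> (k + 1)) (dot (\<psi> k) x))"
    if "1 \<le> k" "k + 1 < length u" "letter u (k + 2) \<noteq> letter u k"
    using dot_braid[OF x] that len by simp
qed

end

locale rep_iso = rep_module n \<Gamma> "mset w" M
  for n :: nat and \<Gamma> :: "(nat \<times> nat) set" and w :: "nat list" and M :: "('f::field, 'v) klr_module" +
  fixes x0 :: 'v
  assumes x0: "x0 \<in> E w" "x0 \<noteq> \<zero>\<^bsub>M\<^esub>"
begin

sublocale W: word_module n \<Gamma> w "TYPE('f)"
  using quiver E_homogeneous[OF x0] vertices[OF E_words[OF x0(1)]] by unfold_locales

text \<open>The transports of \<open>x0\<close>, one for each word of the component; they become the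
  images of the basis vectors of S(w).\<close>

definition vv :: "nat list \<Rightarrow> 'v" where
  "vv = (SOME v. v w = x0 \<and> (\<forall>u. comm_equiv n w u \<longrightarrow> v u \<in> E u) \<and>
    (\<forall>u k. comm_equiv n w u \<longrightarrow> admissible_swap n k u \<longrightarrow> dot (\<psi> k) (v u) = v (swap_at k u)))"

lemma vv: "vv w = x0" "u \<in> W.C \<Longrightarrow> vv u \<in> E u"
  "u \<in> W.C \<Longrightarrow> admissible_swap n k u \<Longrightarrow> dot (\<psi> k) (vv u) = vv (swap_at k u)"
  using someI_ex[OF transport.transport_exists[OF transport x0(1)], folded vv_def]
  by (auto simp: word_component_eq)

lemma vv_carrier [simp]: "u \<in> W.C \<Longrightarrow> vv u \<in> carrier M"
  using vv(2) E_carrier by blast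

lemma vv_nonzero: "u \<in> W.C \<Longrightarrow> vv u \<noteq> \<zero>\<^bsub>M\<^esub>"
  unfolding word_component_eq mem_Collect_eq
proof (induction rule: rtranclp_induct)
  case base
  show ?case using vv(1) x0(2) by simp
next
  case (step u v)
  have u: "u \<in> W.C" using step.hyps(1) by (simp add: word_component_eq)
  obtain k where k: "admissible_swap n k u" "v = swap_at k u"
    using step.hyps(2) by (auto simp: comm_step_iff)
  show ?case
    using dot_Psi_nonzero[OF vv(2)[OF u] k(1) step.IH] vv(3)[OF u k(1)] k(2) by simp
qed

definition \<Phi> :: "(nat list \<Rightarrow> 'f) \<Rightarrow> 'v" where
  "\<Phi> f = finsum M (\<lambda>u. dot (scalar (f u)) (vv u)) W.C"

lemma \<Phi>_closed [simp]: "\<Phi> f \<in> carrier M"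
  unfolding \<Phi>_def by (intro M.finsum_closed) auto

lemma \<Phi>_add: "\<Phi> (\<lambda>x. f x + g x) = \<Phi> f \<oplus>\<^bsub>M\<^esub> \<Phi> g"
proof -
  have "\<Phi> (\<lambda>x. f x + g x) = finsum M (\<lambda>u. dot (scalar (f u)) (vv u) \<oplus>\<^bsub>M\<^esub> dot (scalar (g u)) (vv u)) W.C"
    unfolding \<Phi>_def by (intro M.finsum_cong') (auto simp: scalar_add dot_add)
  also have "\<dots> = \<Phi> f \<oplus>\<^bsub>M\<^esub> \<Phi> g"
    unfolding \<Phi>_def by (intro M.finsum_addf) auto
  finally show ?thesis .
qed

lemma \<Phi>_zero [simp]: "\<Phi> (\<lambda>_. 0) = \<zero>\<^bsub>M\<^esub>"
proof -
  have "\<Phi> (\<lambda>_. 0) = finsum M (\<lambda>u. \<zero>\<^bsub>M\<^esub>) W.C"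
    unfolding \<Phi>_def by (intro M.finsum_cong') (auto simp: scalar_zero)
  then show ?thesis by simp
qed

lemma \<Phi>_scale: "\<Phi> (\<lambda>x. c * f x) = dot (scalar c) (\<Phi> f)"
proof -
  have "dot (scalar c) (\<Phi> f) = finsum M (\<lambda>u. dot (scalar c) (dot (scalar (f u)) (vv u))) W.C"
    unfolding \<Phi>_def using W.finite_C by (intro dot_finsum) auto
  also have "\<dots> = \<Phi> (\<lambda>x. c * f x)"
    unfolding \<Phi>_def by (intro M.finsum_cong') (auto simp: scalar_mult dot_mult)
  finally show ?thesis by simp
qed

lemma dot_scalar_commute:
  assumes "p \<in> FA" "x \<in> carrier M"
  shows "dot p (dot (scalar c) x) = dot (scalar c) (dot p x)"
  using assms scalar_commute[of c p] by (simp flip: dot_mult)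

lemma dot_\<Phi>:
  assumes "p \<in> FA"
  shows "dot p (\<Phi> f) = finsum M (\<lambda>u. dot (scalar (f u)) (dot p (vv u))) W.C"
proof -
  have "dot p (\<Phi> f) = finsum M (\<lambda>u. dot p (dot (scalar (f u)) (vv u))) W.C"
    unfolding \<Phi>_def using W.finite_C assms by (intro dot_finsum) auto
  also have "\<dots> = finsum M (\<lambda>u. dot (scalar (f u)) (dot p (vv u))) W.C"
    using assms by (intro M.finsum_cong') (auto simp: dot_scalar_commute)
  finally show ?thesis .
qed

lemma \<Phi>_E:
  assumes "f \<in> W.V" "v \<in> words"
  shows "\<Phi> (W.act (ee v) f) = dot (ee v) (\<Phi> f)"
  unfolding dot_\<Phi>[OF ee_in_klr_free[OF assms(2)]] unfolding \<Phi>_def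
proof (intro M.finsum_cong' refl)
  show "(\<lambda>u. dot (scalar (f u)) (dot (ee v) (vv u))) \<in> W.C \<rightarrow> carrier M" using assms(2) by auto
  fix u assume u: "u \<in> W.C"
  show "dot (scalar (W.act (ee v) f u)) (vv u) = dot (scalar (f u)) (dot (ee v) (vv u))"
    using W.act_E[OF assms(1)] E_dot[OF vv(2)[OF u]] dot_E_other[OF vv(2)[OF u] assms(2)] u
    by (cases "u = v") (auto simp: scalar_zero)
qed

lemma \<Phi>_Y:
  assumes "1 \<le> k" "k \<le> size (mset w)"
  shows "\<Phi> (W.act (yy k) f) = dot (yy k) (\<Phi> f)"
  using dot_Y[OF assms \<Phi>_closed] by simp

lemma \<Phi>_Psi:
  assumes "f \<in> W.V" "1 \<le> k" "k < size (mset w)"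
  shows "\<Phi> (W.act (\<psi> k) f) = dot (\<psi> k) (\<Phi> f)"
proof -
  \<comment> \<open>An involution of the component that fixes the words without an admissible swap.
    The sum over images of basis vectors can then be reindexed over the whole component, with 0
    contributed at the fixed words.\<close>
  define \<tau> where "\<tau> u = (if admissible_swap n k u then swap_at k u else u)" for u
  define h where "h u = (if admissible_swap n k u then dot (scalar (f u)) (vv (swap_at k u)) else \<zero>\<^bsub>M\<^esub>)" for u
  have swap: "swap_at k (swap_at k u) = u" if "admissible_swap n k u" for u
    using that by (intro swap_at_swap_at) (auto simp: admissible_swap_def)
  have C_swap: "swap_at k u \<in> W.C" if "u \<in> W.C" "admissible_swap n k u" for u
    using W.C_swap that by blast
  have h_closed: "h u \<in> carrier M" if "u \<in> W.C" for u
    using that C_swap by (simp add: h_def)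
  have \<tau>\<tau>: "\<tau> (\<tau> u) = u" for u by (simp add: \<tau>_def swap)
  have \<tau>_C: "\<tau> u \<in> W.C" if "u \<in> W.C" for u using that C_swap by (simp add: \<tau>_def)
  have img: "\<tau> ` W.C = W.C" using \<tau>\<tau> \<tau>_C by (metis image_subset_iff subsetI subset_antisym image_eqI)
  have inj: "inj_on \<tau> W.C" using \<tau>\<tau> by (metis inj_onI)
  have "dot (\<psi> k) (\<Phi> f) = finsum M h W.C"
    unfolding dot_\<Phi>[OF psi_in_klr_free[OF assms(2,3)]]
  proof (intro M.finsum_cong' refl)
    show "h \<in> W.C \<rightarrow> carrier M" using h_closed by auto
    fix u assume u: "u \<in> W.C"
    show "dot (scalar (f u)) (dot (\<psi> k) (vv u)) = h u"
      using vv(3)[OF u] dot_Psi_zero[OF vv(2)[OF u] assms(2,3)] by (simp add: h_def)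
  qed
  also have "\<dots> = finsum M h (\<tau> ` W.C)" by (simp only: img)
  also have "\<dots> = finsum M (\<lambda>u. h (\<tau> u)) W.C"
    using h_closed img inj by (intro M.add.finprod_reindex) auto
  also have "\<dots> = \<Phi> (W.act (\<psi> k) f)"
    unfolding \<Phi>_def
  proof (intro M.finsum_cong' refl)
    show "(\<lambda>u. dot (scalar (W.act (\<psi> k) f u)) (vv u)) \<in> W.C \<rightarrow> carrier M" by auto
    fix u assume u: "u \<in> W.C"
    show "h (\<tau> u) = dot (scalar (W.act (\<psi> k) f u)) (vv u)"
      using u swap by (auto simp: h_def \<tau>_def W.act_Psi[OF assms(1)] scalar_zero)
  qed
  finally show ?thesis by simp
qed

lemma \<Phi>_act:
  assumes "p \<in> FA"
  shows "f \<in> W.V \<Longrightarrow> \<Phi> (W.act p f) = dot p (\<Phi> f)"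
  using assms
proof (induction arbitrary: f rule: klr_free_left_mult_induct)
  case (gen g p)
  have "\<Phi> (W.act (gen g) h) = dot (gen g) (\<Phi> h)" if "h \<in> W.V" for h
    using gen.hyps(1) \<Phi>_E[OF that] \<Phi>_Psi[OF that] \<Phi>_Y by (auto simp: klr_gens_def)
  then show ?case
    using gen by (simp add: W.act_mult W.act_V dot_mult gen_in_klr_free)
next
  case (scale c p)
  then show ?case by (simp add: W.act_mult W.act_V W.act_scalar \<Phi>_scale dot_mult)
next
  case (add p q)
  then show ?case by (simp add: W.act_add \<Phi>_add dot_add)
qed simp

lemma \<Phi>_smult:
  assumes "a \<in> carrier (klr \<Gamma> (mset w))" "f \<in> W.V"
  shows "\<Phi> (a \<odot>\<^bsub>W.S\<^esub> f) = a \<odot>\<^bsub>M\<^esub> \<Phi> f"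
  using assms \<Phi>_act by (auto simp: carrier_klr W.smult_S dot_def)

text \<open>The idempotent of \<open>u\<close> isolates one coefficient of \<open>f\<close>, which
  is how \<open>\<Phi>_inj\<close> compares coefficients.\<close>

lemma \<Phi>_component:
  assumes "f \<in> W.V" "u \<in> W.C"
  shows "dot (ee u) (\<Phi> f) = dot (scalar (f u)) (vv u)"
proof -
  have u: "u \<in> words" using E_words vv(2) assms(2) by blast
  have "dot (ee u) (\<Phi> f) = \<Phi> (W.act (ee u) f)" using \<Phi>_E assms(1) u by simp
  also have "\<dots> = finsum M (\<lambda>v. if u = v then dot (scalar (f v)) (vv v) else \<zero>\<^bsub>M\<^esub>) W.C"
    unfolding \<Phi>_def by (intro M.finsum_cong') (auto simp: W.act_E[OF assms(1)] scalar_zero)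
  also have "\<dots> = dot (scalar (f u)) (vv u)"
    using assms W.finite_C by (intro M.add.finprod_singleton) auto
  finally show ?thesis .
qed

lemma \<Phi>_inj: "inj_on \<Phi> W.V"
proof (rule inj_onI)
  fix f g assume fg: "f \<in> W.V" "g \<in> W.V" "\<Phi> f = \<Phi> g"
  have "f u = g u" if u: "u \<in> W.C" for u
  proof (rule ccontr)
    assume ne: "f u \<noteq> g u"
    have eq: "dot (scalar (f u)) (vv u) = dot (scalar (g u)) (vv u)"
      using \<Phi>_component[OF fg(1) u] \<Phi>_component[OF fg(2) u] fg(3) by simp
    have "dot (scalar (f u - g u)) (vv u) \<oplus>\<^bsub>M\<^esub> dot (scalar (g u)) (vv u) = dot (scalar (g u)) (vv u)"
      using u eq dot_add[of "scalar (f u - g u)" "scalar (g u)" "vv u"] by (simp flip: scalar_add)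
    then have "dot (scalar (f u - g u)) (vv u) = \<zero>\<^bsub>M\<^esub>" using u by simp
    then have "dot (scalar (1 / (f u - g u))) (dot (scalar (f u - g u)) (vv u)) = \<zero>\<^bsub>M\<^esub>" by simp
    then have "dot (scalar (1 / (f u - g u)) * scalar (f u - g u)) (vv u) = \<zero>\<^bsub>M\<^esub>"
      using u by (simp add: dot_mult)
    then have "vv u = \<zero>\<^bsub>M\<^esub>" using u ne by (simp add: scalar_one flip: scalar_mult)
    then show False using vv_nonzero[OF u] by simp
  qed
  moreover have "f u = g u" if "u \<notin> W.C" for u using fg that by (simp add: W.V_def)
  ultimately show "f = g" by blast
qed

text \<open>The image is a submodule, graded because all of M has one degree, and nonzero by
  injectivity; irreducibility makes it everything.\<close>

lemma \<Phi>_surj: "\<Phi> ` W.V = carrier M"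
proof -
  let ?N = "\<Phi> ` W.V"
  have sub: "additive_subgroup ?N M"
  proof (rule additive_subgroup.intro)
    show "subgroup ?N (add_monoid M)"
    proof (rule group.subgroupI[OF M.a_group])
      show "?N \<subseteq> carrier (add_monoid M)" by auto
      show "?N \<noteq> {}" using W.V_zero by blast
      fix a assume "a \<in> ?N"
      then obtain f where f: "f \<in> W.V" "a = \<Phi> f" by blast
      have "(\<lambda>x. - 1 * f x) \<in> W.V" using f(1) by (rule W.V_scale)
      moreover have "\<Phi> (\<lambda>x. - 1 * f x) \<oplus>\<^bsub>M\<^esub> \<Phi> f = \<zero>\<^bsub>M\<^esub>" by (simp flip: \<Phi>_add)
      then have "\<ominus>\<^bsub>M\<^esub> a = \<Phi> (\<lambda>x. - 1 * f x)" using f(2) by (intro M.minus_equality) auto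
      ultimately show "inv\<^bsub>add_monoid M\<^esub> a \<in> ?N" by (auto simp: a_inv_def)
    next
      fix a b assume "a \<in> ?N" "b \<in> ?N"
      then show "a \<otimes>\<^bsub>add_monoid M\<^esub> b \<in> ?N" using W.V_add by (fastforce simp flip: \<Phi>_add)
    qed
  qed
  have "graded_submodule (klr \<Gamma> (mset w)) M ?N"
    unfolding graded_submodule_def
  proof (intro conjI sub ballI)
    show "a \<odot>\<^bsub>M\<^esub> y \<in> ?N" if a: "a \<in> carrier (klr \<Gamma> (mset w))" and y: "y \<in> ?N" for a y
    proof -
      obtain f where f: "f \<in> W.V" "y = \<Phi> f" using y by blast
      have "a \<odot>\<^bsub>W.S\<^esub> f \<in> W.V"
        using left_module.smult_closed[OF W.left_module_S a, of f] f(1) by simp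
      then show ?thesis using \<Phi>_smult[OF a f(1)] f(2) by (metis imageI)
    qed
    show "\<exists>f. (\<forall>d. f d \<in> ?N \<inter> component M d) \<and> finite {d. f d \<noteq> \<zero>\<^bsub>M\<^esub>} \<and>
        y = finsum M f {d. f d \<noteq> \<zero>\<^bsub>M\<^esub>}" if y: "y \<in> ?N" for y
    proof -
      let ?f = "\<lambda>d. if d = deg then y else \<zero>\<^bsub>M\<^esub>"
      have yM: "y \<in> carrier M" using y by auto
      have "finsum M ?f {d. ?f d \<noteq> \<zero>\<^bsub>M\<^esub>} = ?f deg"
        using yM by (intro M.finsum_concentrated) auto
      moreover have "finite {d. ?f d \<noteq> \<zero>\<^bsub>M\<^esub>}" by (rule finite_subset[of _ "{deg}"]) auto
      moreover have "\<zero>\<^bsub>M\<^esub> \<in> ?N" using additive_subgroup.zero_closed[OF sub] by simp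
      then have "\<forall>d. ?f d \<in> ?N \<inter> component M d"
        using y yM component_deg component_other by auto
      ultimately show ?thesis by (intro exI[of _ ?f]) simp
    qed
  qed
  then have "?N = {\<zero>\<^bsub>M\<^esub>} \<or> ?N = carrier M"
    using rep unfolding homogeneous_rep_def graded_irreducible_def by blast
  moreover have "?N \<noteq> {\<zero>\<^bsub>M\<^esub>}"
  proof
    assume "?N = {\<zero>\<^bsub>M\<^esub>}"
    then have "\<Phi> (basis_vector w) = \<zero>\<^bsub>M\<^esub>" using W.basis_vector_V[OF W.C_self] by blast
    moreover have "\<Phi> (basis_vector w) = \<Phi> (\<lambda>_. 0)" using calculation by simp
    then have "basis_vector w = (\<lambda>_. 0 :: 'f)"
      using \<Phi>_inj W.basis_vector_V[OF W.C_self] W.V_zero by (meson inj_onD)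
    then have "basis_vector w w = (0 :: 'f)" by simp
    then show False by (simp add: basis_vector_def)
  qed
  ultimately show ?thesis by blast
qed

lemma S_isomorphic: "graded_isomorphic (klr \<Gamma> (mset w)) (degree_shift deg W.S) M"
  unfolding graded_isomorphic_def degree_shift_def
proof (intro exI[of _ \<Phi>] conjI ballI allI)
  show "bij_betw \<Phi> (carrier (W.S\<lparr>component := \<lambda>d. component W.S (d - deg)\<rparr>)) (carrier M)"
    using \<Phi>_inj \<Phi>_surj by (simp add: bij_betw_def)
  show "\<Phi> ` component (W.S\<lparr>component := \<lambda>d. component W.S (d - deg)\<rparr>) d = component M d" for d
    using \<Phi>_surj component_deg component_other[of d] by (cases "d = deg") (auto simp: W.component_S)
qed (simp_all add: \<Phi>_add \<Phi>_smult)

end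

section \<open>Isomorphism classes\<close>

lemma degree_shift_simps [simp]:
  "carrier (degree_shift m M) = carrier M" "add (degree_shift m M) = add M"
  "smult (degree_shift m M) = smult M" "component (degree_shift m M) d = component M (d - m)"
  by (simp_all add: degree_shift_def)

lemma degree_shift_degree_shift: "degree_shift m (degree_shift k M) = degree_shift (m + k) M"
  by (simp add: degree_shift_def algebra_simps)

lemma graded_isomorphic_cong:
  assumes "graded_isomorphic R M N" "\<And>d. component N d = component N' d"
    "carrier N = carrier N'" "add N = add N'" "smult N = smult N'"
  shows "graded_isomorphic R M N'"
  using assms by (simp add: graded_isomorphic_def)

lemma graded_isomorphic_refl: "graded_isomorphic R M M"
  unfolding graded_isomorphic_def
proof (rule exI[of _ id], intro conjI ballI allI)
  show "bij_betw id (carrier M) (carrier M)" by (rule bij_betw_id)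
qed (simp_all only: id_apply image_id)

lemma graded_isomorphicE:
  assumes "graded_isomorphic R M N"
  obtains \<phi> where "bij_betw \<phi> (carrier M) (carrier N)"
    "\<And>x z. x \<in> carrier M \<Longrightarrow> z \<in> carrier M \<Longrightarrow> \<phi> (x \<oplus>\<^bsub>M\<^esub> z) = \<phi> x \<oplus>\<^bsub>N\<^esub> \<phi> z"
    "\<And>a x. a \<in> carrier R \<Longrightarrow> x \<in> carrier M \<Longrightarrow> \<phi> (a \<odot>\<^bsub>M\<^esub> x) = a \<odot>\<^bsub>N\<^esub> \<phi> x"
    "\<And>d. \<phi> ` component M d = component N d"
proof -
  from assms[unfolded graded_isomorphic_def] show thesis
  proof (elim exE conjE)
    fix \<phi>
    assume \<phi>: "bij_betw \<phi> (carrier M) (carrier N)"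
      "\<forall>x\<in>carrier M. \<forall>z\<in>carrier M. \<phi> (x \<oplus>\<^bsub>M\<^esub> z) = \<phi> x \<oplus>\<^bsub>N\<^esub> \<phi> z"
      "\<forall>a\<in>carrier R. \<forall>x\<in>carrier M. \<phi> (a \<odot>\<^bsub>M\<^esub> x) = a \<odot>\<^bsub>N\<^esub> \<phi> x"
      "\<forall>d. \<phi> ` component M d = component N d"
    show thesis
      by (rule that[OF \<phi>(1)]) (rule \<phi>(2)[rule_format] \<phi>(3)[rule_format] \<phi>(4)[rule_format]; assumption?)+
  qed
qed

text \<open>Closure of \<open>M\<close> lets the inverse map be evaluated at images of sums and
  multiples; \<open>graded_isomorphic\<close> by itself does not provide it.\<close>

lemma graded_isomorphic_sym:
  assumes iso: "graded_isomorphic R M N"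
    and add: "\<And>x z. x \<in> carrier M \<Longrightarrow> z \<in> carrier M \<Longrightarrow> x \<oplus>\<^bsub>M\<^esub> z \<in> carrier M"
    and smult: "\<And>a x. a \<in> carrier R \<Longrightarrow> x \<in> carrier M \<Longrightarrow> a \<odot>\<^bsub>M\<^esub> x \<in> carrier M"
    and comp: "\<And>d. component M d \<subseteq> carrier M"
  shows "graded_isomorphic R N M"
proof -
  from iso obtain \<phi> where \<phi>: "bij_betw \<phi> (carrier M) (carrier N)"
    "\<And>x z. x \<in> carrier M \<Longrightarrow> z \<in> carrier M \<Longrightarrow> \<phi> (x \<oplus>\<^bsub>M\<^esub> z) = \<phi> x \<oplus>\<^bsub>N\<^esub> \<phi> z"
    "\<And>a x. a \<in> carrier R \<Longrightarrow> x \<in> carrier M \<Longrightarrow> \<phi> (a \<odot>\<^bsub>M\<^esub> x) = a \<odot>\<^bsub>N\<^esub> \<phi> x"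
    "\<And>d. \<phi> ` component M d = component N d"
    by (rule graded_isomorphicE) blast
  let ?\<theta> = "inv_into (carrier M) \<phi>"
  have inj: "inj_on \<phi> (carrier M)" using \<phi>(1) by (simp add: bij_betw_def)
  have \<theta>: "?\<theta> (\<phi> x) = x" if "x \<in> carrier M" for x using inj that by simp
  have pre: "\<exists>x\<in>carrier M. y = \<phi> x" if "y \<in> carrier N" for y
    using \<phi>(1) that unfolding bij_betw_def by blast
  show ?thesis
    unfolding graded_isomorphic_def
  proof (intro exI[of _ ?\<theta>] conjI ballI allI)
    show "bij_betw ?\<theta> (carrier N) (carrier M)" using \<phi>(1) by (rule bij_betw_inv_into)
    show "?\<theta> (y \<oplus>\<^bsub>N\<^esub> z) = ?\<theta> y \<oplus>\<^bsub>M\<^esub> ?\<theta> z" if y: "y \<in> carrier N" and z: "z \<in> carrier N" for y z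
    proof -
      obtain y' z' where y': "y' \<in> carrier M" "y = \<phi> y'" and z': "z' \<in> carrier M" "z = \<phi> z'"
        using pre[OF y] pre[OF z] by blast
      then show ?thesis using \<theta>[OF add[OF y'(1) z'(1)]] \<theta> by (simp add: \<phi>(2))
    qed
    show "?\<theta> (a \<odot>\<^bsub>N\<^esub> y) = a \<odot>\<^bsub>M\<^esub> ?\<theta> y" if a: "a \<in> carrier R" and y: "y \<in> carrier N" for a y
    proof -
      obtain y' where y': "y' \<in> carrier M" "y = \<phi> y'" using pre[OF y] by blast
      then show ?thesis using \<theta>[OF smult[OF a y'(1)]] \<theta> a by (simp add: \<phi>(3))
    qed
    show "?\<theta> ` component N d = component M d" for d
      unfolding \<phi>(4)[symmetric] by (rule inv_into_image_cancel[OF inj comp])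
  qed
qed

lemma graded_isomorphic_trans:
  assumes "graded_isomorphic R M N" "graded_isomorphic R N P"
  shows "graded_isomorphic R M P"
proof -
  from assms(1) obtain \<phi> where \<phi>: "bij_betw \<phi> (carrier M) (carrier N)"
    "\<And>x z. x \<in> carrier M \<Longrightarrow> z \<in> carrier M \<Longrightarrow> \<phi> (x \<oplus>\<^bsub>M\<^esub> z) = \<phi> x \<oplus>\<^bsub>N\<^esub> \<phi> z"
    "\<And>a x. a \<in> carrier R \<Longrightarrow> x \<in> carrier M \<Longrightarrow> \<phi> (a \<odot>\<^bsub>M\<^esub> x) = a \<odot>\<^bsub>N\<^esub> \<phi> x"
    "\<And>d. \<phi> ` component M d = component N d"
    by (rule graded_isomorphicE) blast
  from assms(2) obtain \<theta> where \<theta>: "bij_betw \<theta> (carrier N) (carrier P)"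
    "\<And>x z. x \<in> carrier N \<Longrightarrow> z \<in> carrier N \<Longrightarrow> \<theta> (x \<oplus>\<^bsub>N\<^esub> z) = \<theta> x \<oplus>\<^bsub>P\<^esub> \<theta> z"
    "\<And>a x. a \<in> carrier R \<Longrightarrow> x \<in> carrier N \<Longrightarrow> \<theta> (a \<odot>\<^bsub>N\<^esub> x) = a \<odot>\<^bsub>P\<^esub> \<theta> x"
    "\<And>d. \<theta> ` component N d = component P d"
    by (rule graded_isomorphicE) blast
  have N: "\<phi> x \<in> carrier N" if "x \<in> carrier M" for x
    using \<phi>(1) that by (auto simp: bij_betw_def)
  show ?thesis
    unfolding graded_isomorphic_def
  proof (intro exI[of _ "\<theta> \<circ> \<phi>"] conjI ballI allI)
    show "bij_betw (\<theta> \<circ> \<phi>) (carrier M) (carrier P)" using \<phi>(1) \<theta>(1) by (rule bij_betw_trans)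
    show "(\<theta> \<circ> \<phi>) ` component M d = component P d" for d
      unfolding image_comp[symmetric] \<phi>(4) \<theta>(4) ..
  qed (simp_all add: \<phi>(2,3) \<theta>(2,3) N)
qed

lemma graded_isomorphic_degree_shift:
  assumes "graded_isomorphic R M N"
  shows "graded_isomorphic R (degree_shift m M) (degree_shift m N)"
proof (rule graded_isomorphicE[OF assms])
  fix \<phi>
  assume \<phi>: "bij_betw \<phi> (carrier M) (carrier N)"
    "\<And>x z. x \<in> carrier M \<Longrightarrow> z \<in> carrier M \<Longrightarrow> \<phi> (x \<oplus>\<^bsub>M\<^esub> z) = \<phi> x \<oplus>\<^bsub>N\<^esub> \<phi> z"
    "\<And>a x. a \<in> carrier R \<Longrightarrow> x \<in> carrier M \<Longrightarrow> \<phi> (a \<odot>\<^bsub>M\<^esub> x) = a \<odot>\<^bsub>N\<^esub> \<phi> x"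
    "\<And>d. \<phi> ` component M d = component N d"
  show ?thesis
    unfolding graded_isomorphic_def degree_shift_simps
    by (intro exI[of _ \<phi>] conjI ballI allI \<phi>)
qed

lemma isomorphic_up_to_shift_refl: "isomorphic_up_to_shift R M M"
  unfolding isomorphic_up_to_shift_def
  by (intro exI[of _ 0] graded_isomorphic_cong[OF graded_isomorphic_refl]) simp_all

lemma isomorphic_up_to_shift_trans:
  assumes "isomorphic_up_to_shift R M N" "isomorphic_up_to_shift R N P"
  shows "isomorphic_up_to_shift R M P"
proof -
  from assms(1) obtain m where m: "graded_isomorphic R M (degree_shift m N)"
    unfolding isomorphic_up_to_shift_def ..
  from assms(2) obtain k where k: "graded_isomorphic R N (degree_shift k P)"
    unfolding isomorphic_up_to_shift_def ..
  from m graded_isomorphic_degree_shift[OF k]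
  have "graded_isomorphic R M (degree_shift m (degree_shift k P))"
    by (rule graded_isomorphic_trans)
  then show ?thesis unfolding isomorphic_up_to_shift_def degree_shift_degree_shift by (rule exI)
qed

lemma is_graded_module_closed:
  assumes "is_graded_module R Rc M"
  shows "x \<in> carrier M \<Longrightarrow> z \<in> carrier M \<Longrightarrow> x \<oplus>\<^bsub>M\<^esub> z \<in> carrier M"
    and "a \<in> carrier R \<Longrightarrow> x \<in> carrier M \<Longrightarrow> a \<odot>\<^bsub>M\<^esub> x \<in> carrier M"
    and "component M d \<subseteq> carrier M"
proof -
  interpret left_module R M using assms by (simp add: is_graded_module_def)
  show "x \<in> carrier M \<Longrightarrow> z \<in> carrier M \<Longrightarrow> x \<oplus>\<^bsub>M\<^esub> z \<in> carrier M" by simp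
  show "a \<in> carrier R \<Longrightarrow> x \<in> carrier M \<Longrightarrow> a \<odot>\<^bsub>M\<^esub> x \<in> carrier M" by (rule smult_closed)
  show "component M d \<subseteq> carrier M"
    using assms additive_subgroup.a_subset unfolding is_graded_module_def by blast
qed

lemma isomorphic_up_to_shift_sym:
  assumes "is_graded_module R Rc M" "isomorphic_up_to_shift R M N"
  shows "isomorphic_up_to_shift R N M"
proof -
  from assms(2) obtain m where "graded_isomorphic R M (degree_shift m N)"
    unfolding isomorphic_up_to_shift_def ..
  then have "graded_isomorphic R (degree_shift m N) M"
    using is_graded_module_closed[OF assms(1)] by (rule graded_isomorphic_sym)
  then have "graded_isomorphic R (degree_shift (- m) (degree_shift m N)) (degree_shift (- m) M)"
    by (rule graded_isomorphic_degree_shift)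
  moreover have "graded_isomorphic R N (degree_shift (- m) (degree_shift m N))"
    by (rule graded_isomorphic_cong[OF graded_isomorphic_refl]) simp_all
  ultimately have "graded_isomorphic R N (degree_shift (- m) M)"
    by (rule graded_isomorphic_trans[rotated])
  then show ?thesis unfolding isomorphic_up_to_shift_def by (rule exI)
qed

lemma equiv_rep_equiv: "equiv (homogeneous_reps n \<Gamma>) (rep_equiv n \<Gamma>)"
proof (rule equivI)
  show "rep_equiv n \<Gamma> \<subseteq> homogeneous_reps n \<Gamma> \<times> homogeneous_reps n \<Gamma>"
    by (auto simp: rep_equiv_def)
  show "refl_on (homogeneous_reps n \<Gamma>) (rep_equiv n \<Gamma>)"
    by (auto simp: refl_on_def rep_equiv_def isomorphic_up_to_shift_refl)
  show "sym (rep_equiv n \<Gamma>)"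
    by (auto simp: sym_def rep_equiv_def homogeneous_reps_def homogeneous_rep_def
        intro: isomorphic_up_to_shift_sym)
  show "trans (rep_equiv n \<Gamma>)"
    by (auto simp: trans_def rep_equiv_def intro: isomorphic_up_to_shift_trans)
qed

section \<open>Canonical words as labels of the isomorphism classes\<close>

lemma alt_blocks_pos: "0 \<notin> set js \<Longrightarrow> 0 < x \<Longrightarrow> 0 < y \<Longrightarrow> 0 \<notin> set (alt_blocks n x y js)"
  by (induction js arbitrary: x y) auto

lemma canonical_words_vertices:
  assumes "3 \<le> n" "w \<in> canonical_words n"
  shows "set w \<subseteq> {1..n}"
proof
  fix z assume z: "z \<in> set w"
  obtain w0 js where w: "w0 \<in> A_words (n - 1)" "js \<in> suffix_labels n" "w = w0 @ alt_blocks n n (n - 1) js"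
    using assms canonical_words_eq[of n] by auto
  have "0 \<notin> set js" using w(2) by (auto simp: suffix_labels_def)
  then have "0 \<notin> set (alt_blocks n n (n - 1) js)" using assms(1) by (intro alt_blocks_pos) auto
  moreover have "z \<in> set w0 \<or> z \<in> set (alt_blocks n n (n - 1) js)" using z w(3) by auto
  ultimately show "z \<in> {1..n}"
    using A_words_set[OF w(1)] alt_blocks_set[of z n n "n - 1" js] by (cases "z = 0") fastforce+
qed

lemma word_module_canonical:
  assumes "4 \<le> n" "type_D_quiver n \<Gamma>" "w \<in> homogeneous_canonical n"
  shows "word_module n \<Gamma> w"
  using assms canonical_words_vertices[of n w]
  by (intro word_module.intro) (auto simp: homogeneous_canonical_def)

lemma homogeneous_rep_classification:
  fixes M :: "('f::field, 'v) klr_module"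
  assumes "4 \<le> n" "type_D_quiver n \<Gamma>" "homogeneous_rep n \<Gamma> \<alpha> M"
  shows "\<exists>w\<in>homogeneous_canonical n. mset w = \<alpha> \<and> isomorphic_up_to_shift (klr \<Gamma> \<alpha>) M (S_module n w)"
proof -
  interpret rep_module n \<Gamma> \<alpha> M using assms by unfold_locales
  have "carrier M \<noteq> {\<zero>\<^bsub>M\<^esub>}" using assms(3) by (simp add: homogeneous_rep_def graded_irreducible_def)
  then obtain x where x: "x \<in> carrier M" "x \<noteq> \<zero>\<^bsub>M\<^esub>" using M.zero_closed by blast
  then obtain u where u: "u \<in> words" "dot (ee u) x \<noteq> \<zero>\<^bsub>M\<^esub>" using exists_E by blast
  have E: "dot (ee u) x \<in> E u" using dot_E_in u(1) x(1) by blast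
  have "3 \<le> n" using assms(1) by simp
  then obtain w where w: "w \<in> homogeneous_canonical n" "comm_equiv n u w"
    using homogeneous_word_canonical E_homogeneous[OF E u(2)] vertices[OF u(1)] by blast
  \<comment> \<open>The weight vector is transported to the canonical word, so that M is compared
    with S(w) for canonical w directly.\<close>
  obtain x0 where x0: "x0 \<in> E w" "x0 \<noteq> \<zero>\<^bsub>M\<^esub>" using E_comm_equiv[OF w(2) E u(2)] by blast
  have \<alpha>: "mset w = \<alpha>" using E_words[OF x0(1)] by (rule permutations_of_multisetD)
  interpret I: rep_iso n \<Gamma> w M x0
    using assms x0 unfolding \<alpha>[symmetric] by unfold_locales
  have "graded_isomorphic (klr \<Gamma> (mset w)) M (degree_shift I.deg I.W.S)"
    using is_graded_module_closed[OF I.W.is_graded_S]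
    by (intro graded_isomorphic_sym[OF I.S_isomorphic]) auto
  then show ?thesis
    using w(1) \<alpha> unfolding isomorphic_up_to_shift_def by blast
qed

text \<open>The image of the basis vector of \<open>w\<close> is nonzero and fixed by
  \<open>ee w\<close>, which in S(w') keeps only the coefficient at \<open>w\<close>. Hence
  \<open>w\<close> lies in the component of \<open>w'\<close>, and a component has only one
  canonical word.\<close>

lemma S_module_isomorphic_imp_eq:
  assumes "4 \<le> n" "type_D_quiver n \<Gamma>" "w \<in> homogeneous_canonical n" "w' \<in> homogeneous_canonical n"
    "mset w = mset w'"
    "isomorphic_up_to_shift (klr \<Gamma> (mset w)) (S_module n w :: ('f::field, nat list \<Rightarrow> 'f) klr_module) (S_module n w')"
  shows "w = w'"
proof -
  interpret W: word_module n \<Gamma> w "TYPE('f)" using assms by (intro word_module_canonical)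
  interpret W': word_module n \<Gamma> w' "TYPE('f)" using assms by (intro word_module_canonical)
  from assms(6) obtain m \<phi> where \<phi>: "bij_betw \<phi> W.V W'.V"
    "\<And>x z. x \<in> W.V \<Longrightarrow> z \<in> W.V \<Longrightarrow> \<phi> (\<lambda>u. x u + z u) = (\<lambda>u. \<phi> x u + \<phi> z u)"
    "\<And>a x. a \<in> carrier (klr \<Gamma> (mset w)) \<Longrightarrow> x \<in> W.V \<Longrightarrow> \<phi> (a \<odot>\<^bsub>W.S\<^esub> x) = a \<odot>\<^bsub>W'.S\<^esub> \<phi> x"
    unfolding isomorphic_up_to_shift_def graded_isomorphic_def by auto
  let ?b = "basis_vector w :: nat list \<Rightarrow> 'f"
  have b: "?b \<in> W.V" by (rule W.basis_vector_V[OF W.C_self])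
  have g: "\<phi> ?b \<in> W'.V" using \<phi>(1) b by (auto simp: bij_betw_def)
  have w: "w \<in> permutations_of_multiset (mset w)" by (rule W.C_permutation[OF W.C_self])
  have "\<phi> (\<lambda>_. 0) u = \<phi> (\<lambda>_. 0) u + \<phi> (\<lambda>_. 0) u" for u
    using fun_cong[OF \<phi>(2)[of "\<lambda>_. 0" "\<lambda>_. 0"], of u] by simp
  then have "\<phi> (\<lambda>_. 0) u = 0" for u by (metis add_cancel_right_right)
  then have zero: "\<phi> (\<lambda>_. 0) = (\<lambda>_. 0)" by (rule ext)
  have "?b \<noteq> (\<lambda>_. 0)" by (auto simp: basis_vector_def fun_eq_iff)
  then have "\<phi> ?b \<noteq> (\<lambda>_. 0)"
    using \<phi>(1) b zero W.V_zero unfolding bij_betw_def inj_on_def by metis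
  then obtain u where u: "\<phi> ?b u \<noteq> 0" by (auto simp: fun_eq_iff)
  have "W.act (ee w) ?b = ?b" using b by (auto simp: fun_eq_iff W.act_E basis_vector_def)
  then have "klr_class \<Gamma> (mset w) (ee w) \<odot>\<^bsub>W.S\<^esub> ?b = ?b"
    using W.smult_S[OF ee_in_klr_free[OF w] b] by simp
  then have "klr_class \<Gamma> (mset w) (ee w) \<odot>\<^bsub>W'.S\<^esub> \<phi> ?b = \<phi> ?b"
    using \<phi>(3)[OF klr_class_closed[OF ee_in_klr_free[OF w]] b] by metis
  moreover have "klr_class \<Gamma> (mset w) (ee w) \<odot>\<^bsub>W'.S\<^esub> \<phi> ?b = W'.act (ee w) (\<phi> ?b)"
    using W'.smult_S[OF ee_in_klr_free g] w unfolding assms(5) by blast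
  ultimately have "W'.act (ee w) (\<phi> ?b) u = \<phi> ?b u" by simp
  then have "u = w" using u W'.act_E[OF g, of w u] by (auto split: if_splits)
  then have "w \<in> W'.C" using u g by (auto simp: W'.V_def)
  then have "comm_equiv n w' w" by (simp add: word_component_eq)
  moreover have "3 \<le> n" using assms(1) by simp
  ultimately show ?thesis
    using canonical_unique[of n w' w] assms(3,4) by (auto simp: homogeneous_canonical_def)
qed

theorem corollary2p13:
  fixes n :: nat and \<Gamma> :: "(nat \<times> nat) set"
  assumes "n \<ge> 4" and "type_D_quiver n \<Gamma>"
  shows
    "(\<forall>w\<in>homogeneous_canonical n.
        homogeneous_rep n \<Gamma> (mset w) (S_module n w :: ('f::field, nat list \<Rightarrow> 'f) klr_module)) \<and>
     (\<forall>\<alpha> (M :: ('f, 'v) klr_module). homogeneous_rep n \<Gamma> \<alpha> M \<longrightarrow>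
        (\<exists>w\<in>homogeneous_canonical n.
           mset w = \<alpha> \<and> isomorphic_up_to_shift (klr \<Gamma> \<alpha>) M (S_module n w))) \<and>
     (\<forall>w\<in>homogeneous_canonical n. \<forall>w'\<in>homogeneous_canonical n.
        mset w = mset w' \<and>
        isomorphic_up_to_shift (klr \<Gamma> (mset w))
          (S_module n w :: ('f, nat list \<Rightarrow> 'f) klr_module) (S_module n w') \<longrightarrow> w = w') \<and>
     (rep_classes n \<Gamma> :: (nat multiset \<times> ('f, nat list \<Rightarrow> 'f) klr_module) set set) =
       (\<Union>k\<in>{0..n}. \<Union>c\<in>packet n k. S_class n \<Gamma> ` c) \<and>
     (\<forall>k\<in>{0..n}. \<forall>k'\<in>{0..n}. \<forall>c\<in>packet n k. \<forall>c'\<in>packet n k'. (k, c) \<noteq> (k', c') \<longrightarrow>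
        (S_class n \<Gamma> ` c :: (nat multiset \<times> ('f, nat list \<Rightarrow> 'f) klr_module) set set)
          \<inter> S_class n \<Gamma> ` c' = {}) \<and>
     (\<forall>k\<in>{0..n}. \<forall>c\<in>packet n k.
        card (S_class n \<Gamma> ` c :: (nat multiset \<times> ('f, nat list \<Rightarrow> 'f) klr_module) set set)
          = catalan_triangle n k)"
proof -
  let ?H = "homogeneous_canonical n"
  let ?eq = "rep_equiv n \<Gamma> :: (nat multiset \<times> ('f, nat list \<Rightarrow> 'f) klr_module) rel"
  let ?cls = "S_class n \<Gamma> :: nat list \<Rightarrow> (nat multiset \<times> ('f, nat list \<Rightarrow> 'f) klr_module) set"
  note eq = equiv_rep_equiv[of n \<Gamma>]
  have rep: "homogeneous_rep n \<Gamma> (mset w) (S_module n w :: ('f, nat list \<Rightarrow> 'f) klr_module)"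
    if "w \<in> ?H" for w
    using word_module.homogeneous_rep_S[OF word_module_canonical[OF assms that]] .
  have classification: "\<exists>w\<in>?H. mset w = \<alpha> \<and> isomorphic_up_to_shift (klr \<Gamma> \<alpha>) M (S_module n w)"
    if "homogeneous_rep n \<Gamma> \<alpha> M" for \<alpha> and M :: "('f, 'v) klr_module"
    using homogeneous_rep_classification[OF assms that] .
  have irredundant: "w = w'" if "w \<in> ?H" "w' \<in> ?H" "mset w = mset w'"
    "isomorphic_up_to_shift (klr \<Gamma> (mset w)) (S_module n w :: ('f, nat list \<Rightarrow> 'f) klr_module) (S_module n w')"
    for w w'
    using S_module_isomorphic_imp_eq[OF assms that] .
  \<comment> \<open>Injectivity on words turns the disjointness and the cardinality of collections
    into those of the sets of classes.\<close>
  have inj: "inj_on ?cls ?H"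
  proof (rule inj_onI)
    fix w w' assume w: "w \<in> ?H" "w' \<in> ?H" "?cls w = ?cls w'"
    have "(mset w', S_module n w' :: ('f, nat list \<Rightarrow> 'f) klr_module) \<in> homogeneous_reps n \<Gamma>"
      using rep[OF w(2)] by (simp add: homogeneous_reps_def)
    then have "((mset w, S_module n w), (mset w', S_module n w')) \<in> ?eq"
      using w(3) eq_equiv_class[OF _ eq] unfolding S_class_def by blast
    then show "w = w'"
      unfolding rep_equiv_def mem_Collect_eq prod.case by (elim conjE) (rule irredundant[OF w(1,2)])
  qed
  have classes: "(rep_classes n \<Gamma> :: (nat multiset \<times> ('f, nat list \<Rightarrow> 'f) klr_module) set set) = ?cls ` ?H"
  proof (rule subset_antisym; rule subsetI)
    fix X :: "(nat multiset \<times> ('f, nat list \<Rightarrow> 'f) klr_module) set"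
    assume "X \<in> rep_classes n \<Gamma>"
    then obtain p where p: "p \<in> homogeneous_reps n \<Gamma>" "X = ?eq `` {p}"
      unfolding rep_classes_def by (rule quotientE)
    obtain \<alpha> M where M: "p = (\<alpha>, M)" "homogeneous_rep n \<Gamma> \<alpha> M"
      using p(1) by (cases p) (auto simp: homogeneous_reps_def)
    \<comment> \<open>The representation here has carrier type
      \<open>nat list \<Rightarrow> 'f\<close>, so the general lemma is used; the fact
      \<open>classification\<close> is fixed at the type \<open>'v\<close>.\<close>
    obtain w where w: "w \<in> ?H" "mset w = \<alpha>" "isomorphic_up_to_shift (klr \<Gamma> \<alpha>) M (S_module n w)"
      using homogeneous_rep_classification[OF assms M(2)] by blast
    have "(p, (mset w, S_module n w)) \<in> ?eq"
      using M w rep[OF w(1)] by (simp add: rep_equiv_def homogeneous_reps_def)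
    then have "X = ?cls w" unfolding p(2) S_class_def by (rule equiv_class_eq[OF eq])
    then show "X \<in> ?cls ` ?H" using w(1) by blast
  next
    fix X assume "X \<in> ?cls ` ?H"
    then obtain w where w: "w \<in> ?H" "X = ?cls w" by blast
    then show "X \<in> rep_classes n \<Gamma>"
      using rep[OF w(1)] unfolding rep_classes_def S_class_def
      by (auto intro: quotientI simp: homogeneous_reps_def)
  qed
  have union: "(\<Union>k\<in>{0..n}. \<Union>c\<in>packet n k. ?cls ` c) = ?cls ` ?H"
    unfolding Union_packets[OF assms(1), symmetric] by blast
  have sub: "c \<subseteq> ?H" if "k \<in> {0..n}" "c \<in> packet n k" for k c
    using Union_packets[OF assms(1)] that by blast
  have disjoint: "?cls ` c \<inter> ?cls ` c' = {}"
    if "k \<in> {0..n}" "k' \<in> {0..n}" "c \<in> packet n k" "c' \<in> packet n k'" "(k, c) \<noteq> (k', c')" for k k' c c'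
  proof -
    have "c \<inter> c' = {}" using packets_disjoint[OF assms(1)] that by simp
    then show ?thesis
      using inj_on_image_Int[OF inj sub[OF that(1,3)] sub[OF that(2,4)]] by simp
  qed
  have card: "card (?cls ` c) = catalan_triangle n k" if "k \<in> {0..n}" "c \<in> packet n k" for k c
    using card_image[OF inj_on_subset[OF inj sub[OF that]]] card_packet[OF assms(1) _ that(2)] that(1)
    by simp
  show ?thesis
    unfolding classes union using rep classification irredundant disjoint card by blast
qed

end
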